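(* Let $d\ge1$. Let $D_0,D$ be open convex bounded domains in $\mathbb{R}^d$ with $D_0\cap\mathbb{Z}^d\neq\emptyset$, $D\cap\mathbb{Z}^d\ne\emptyset$ and $\operatorname{dist}(D,D_0)>0$. Let $f_0,f:\mathbb{Z}^d\to\mathbb{C}$ satisfy $\operatorname{supp}f_0\subset D_0$, $\operatorname{supp}f\subset D$, $f_0\not\equiv0$. Let $a^-$ be the far-field amplitude of the source $f$ and $a_1^-$ the far-field amplitude of the source $f+f_0$. Let $\mathcal{N}\subseteq\mathbb{S}^{d-1}\times\Lambda$ be an open nonempty neighbourhood of some fixed pair $(\omega,\lambda)\in\mathbb{S}^{d-1}\times\Lambda$. Then the intensities $|a^-|^2=|a^-(\omega,\lambda)|^2$ and $|a_1^-|^2=|a_1^-(\omega,\lambda)|^2$ given on $\mathcal{N}$ uniquely determine $f$, assuming that $f_0$ is known a priori. That is, with $D_0,D,f_0$ fixed, if $f,g:\mathbb{Z}^d\to\mathbb{C}$ are both supported in $D$, the squared moduli of the far-field amplitudes $a^-$ of $f$ and of $g$ coincide on $\mathcal{N}$, and the squared moduli of the far-field amplitudes $a^-$ of $f+f_0$ and of $g+f_0$ coincide on $\mathcal{N}$, then $f=g$.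
   Context: Discrete Laplacian: $\Delta\psi(x)=\sum_{x'\in\mathbb{Z}^d,\,|x'-x|=1}\psi(x')$, $x\in\mathbb{Z}^d$. The discrete Helmholtz equation with source $f$ is $\Delta\psi-\lambda\psi=f$ on $\mathbb{Z}^d$. Let $\Lambda=\{\zeta\in\mathbb{R}:\ 2d-4<|\zeta|<2d\}$, $T^d=\mathbb{R}^d/2\pi\mathbb{Z}^d$, $\phi(k)=2\sum_{i=1}^d\cos k_i$, and $\Gamma(\lambda)=\{k\in T^d:\phi(k)=\lambda\}$. For bounded sets in $\mathbb{R}^d$: $\operatorname{dist}(D,D_0)=\inf_{x\in D,\,y\in D_0}|x-y|$. For $\lambda\in\Lambda$ and $\omega\in\mathbb{S}^{d-1}$, $\kappa(\omega,\lambda)$ denotes the unique point of $\Gamma(\lambda)$ with $\nabla\phi(\kappa)/|\nabla\phi(\kappa)|=\omega$, and $\mu(\omega,\lambda)=\kappa(\omega,\lambda)\cdot\omega$ (for $x\in\mathbb{Z}^d\setminus\{0\}$ and $\omega=x/|x|$ one has $e^{-i\mu(\omega,\lambda)|x|}=e^{-i\kappa(\omega,\lambda)\cdot x}$, which is well defined for $\kappa\in T^d$). For a compactly supported source $f$ and $\lambda\in\Lambda$ let $\psi^-(x)=\lim_{\nu\to\lambda-i0}\big((\Delta-\nu)^{-1}f\big)(x)$, $x\in\mathbb{Z}^d$, where $(\Delta-\nu)^{-1}:\ell^2(\mathbb{Z}^d)\to\ell^2(\mathbb{Z}^d)$ for $\operatorname{Im}\nu\ne0$. The far-field amplitude $a^-(\omega,\lambda)$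 of $f$ is the function, continuous (indeed smooth) in $\omega\in\mathbb{S}^{d-1}$, determined by the asymptotic formula $$\psi^-(x)=\frac{e^{-i\mu(\omega,\lambda)|x|}}{|x|^{(d-1)/2}}\,a^-(\omega,\lambda)+O\big(|x|^{-(d+1)/2}\big),\qquad \omega=x/|x|,\ |x|\to\infty,\ x\in\mathbb{Z}^d,$$ with remainder uniform in $\omega$. (The directions $x/|x|$, $x\in\mathbb{Z}^d\setminus\{0\}$, are dense in $\mathbb{S}^{d-1}$, and $a^-$ is extended to all of $\mathbb{S}^{d-1}$ by continuity.) *)

theory Defs
  imports "HOL-Analysis.Analysis" "HOL-Library.Landau_Symbols"
begin

text \<open>
  The dimension \<open>d\<close> is \<open>CARD('n)\<close>. The lattice is the type \<open>int ^ 'n\<close>, and \<open>lat\<close> is its inclusion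
  into Euclidean space.
\<close>

definition lat :: "int ^ 'n \<Rightarrow> real ^ 'n" where
  "lat x = (\<chi> i. real_of_int (x $ i))"

definition laplacian :: "(int ^ 'n \<Rightarrow> complex) \<Rightarrow> int ^ 'n \<Rightarrow> complex" where
  "laplacian \<psi> x = (\<Sum>x' | norm (lat (x' - x)) = 1. \<psi> x')"

definition ell2 :: "(int ^ 'n \<Rightarrow> complex) set" where
  "ell2 = {u. (\<lambda>x. (cmod (u x))\<^sup>2) summable_on UNIV}"

definition resolvent :: "complex \<Rightarrow> (int ^ 'n \<Rightarrow> complex) \<Rightarrow> int ^ 'n \<Rightarrow> complex" where
  "resolvent \<nu> = inv_into ell2 (\<lambda>u x. laplacian u x - \<nu> * u x)"

definition is_psi_minus :: "(int ^ 'n \<Rightarrow> complex) \<Rightarrow> real \<Rightarrow> (int ^ 'n \<Rightarrow> complex) \<Rightarrow> bool" where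
  "is_psi_minus f lam \<psi> \<longleftrightarrow>
     (\<forall>x. ((\<lambda>\<epsilon>. resolvent (complex_of_real lam - \<i> * complex_of_real \<epsilon>) f x) \<longlongrightarrow> \<psi> x) (at_right 0))"

definition Lambda :: "'n::finite itself \<Rightarrow> real set" where
  "Lambda _ = {\<zeta>. 2 * real CARD('n) - 4 < \<bar>\<zeta>\<bar> \<and> \<bar>\<zeta>\<bar> < 2 * real CARD('n)}"

definition phi :: "real ^ 'n \<Rightarrow> real" where
  "phi k = 2 * (\<Sum>i\<in>UNIV. cos (k $ i))"

definition gradient :: "(real ^ 'n \<Rightarrow> real) \<Rightarrow> real ^ 'n \<Rightarrow> real ^ 'n" where
  "gradient F k = (THE g. GDERIV F k :> g)"

text \<open>
  Each class of \<open>\<real>\<^sup>d / 2\<pi>\<int>\<^sup>d\<close> is represented by its unique member in the cube \<open>(-\<pi>, \<pi>]\<^sup>d\<close>. The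
  choice of the representative is immaterial: \<open>\<kappa>\<close> and \<open>\<mu>\<close> are only used in \<open>exp (-i\<mu>\<bar>x\<bar>) = exp (-i\<kappa>\<cdot>x)\<close>
  with \<open>x\<close> a lattice point.
\<close>

definition torus :: "(real ^ 'n) set" where
  "torus = {k. \<forall>i. - pi < k $ i \<and> k $ i \<le> pi}"

definition Gamma_surface :: "real \<Rightarrow> (real ^ 'n) set" where
  "Gamma_surface lam = {k \<in> torus. phi k = lam}"

definition kappa :: "real ^ 'n \<Rightarrow> real \<Rightarrow> real ^ 'n" where
  "kappa \<omega> lam =
     (THE k. k \<in> Gamma_surface lam \<and> gradient phi k /\<^sub>R norm (gradient phi k) = \<omega>)"

definition mu :: "real ^ 'n \<Rightarrow> real \<Rightarrow> real" where
  "mu \<omega> lam = kappa \<omega> lam \<bullet> \<omega>"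

definition direction :: "int ^ 'n \<Rightarrow> real ^ 'n" where
  "direction x = lat x /\<^sub>R norm (lat x)"

text \<open>
  \<open>is_far_field_amplitude f a\<close>: the function \<open>a\<close> of \<open>(\<omega>, lam)\<close> is the far-field amplitude of the source
  \<open>f\<close>. The values of \<open>a\<close> on \<open>sphere 0 1 \<times> Lambda\<close> are determined by this; values
  outside are irrelevant. The \<open>O\<close>-constant may depend on \<open>lam\<close> but not on the direction.
\<close>

definition is_far_field_amplitude ::
    "(int ^ 'n \<Rightarrow> complex) \<Rightarrow> (real ^ 'n \<Rightarrow> real \<Rightarrow> complex) \<Rightarrow> bool" where
  "is_far_field_amplitude f a \<longleftrightarrow>
     (\<forall>lam\<in>Lambda TYPE('n).
        continuous_on (sphere 0 1) (\<lambda>\<omega>. a \<omega> lam) \<and>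
        (\<exists>\<psi>. is_psi_minus f lam \<psi> \<and>
          (\<lambda>x. cmod (\<psi> x -
                 exp (- \<i> * complex_of_real (mu (direction x) lam * norm (lat x)))
                 / complex_of_real (norm (lat x) powr ((real CARD('n) - 1) / 2))
                 * a (direction x) lam))
            \<in> O[filtercomap (\<lambda>x. norm (lat x)) at_top](
                \<lambda>x. norm (lat x) powr (- (real CARD('n) + 1) / 2))))"

end

theory Submission
  imports Defs "HOL-Probability.Probability"
begin

text \<open>
  The far field of a source sees the source only through the values of its Fourier transform
  \<open>ft f k = (\<Sum>y. f y * cis (k \<bullet> lat y))\<close> on the level surfaces of \<open>phi\<close>: up to a factor that depends on
  direction and energy alone, \<open>a\<^sub>f \<omega> lam\<close> is \<open>ft f (kappa \<omega> lam)\<close>. The factor is never computed. The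
  resolvent commutes with convolution, so \<open>f\<^sub>0 * \<psi>\<^sub>f = f * \<psi>\<^sub>0\<close> for the outgoing fields \<open>\<psi>\<^sub>f\<close>, \<open>\<psi>\<^sub>0\<close> of
  \<open>f\<close> and \<open>f\<^sub>0\<close> (\<open>psi_minus_cross\<close>), and comparing the far fields of the two sides gives
  \<open>ft f\<^sub>0 (kappa) * a\<^sub>f = ft f (kappa) * a\<^sub>0\<close>, where \<open>a\<^sub>0 = a1\<^sub>f - a\<^sub>f\<close> is the amplitude of \<open>f\<^sub>0\<close>
  (\<open>far_field_limit_conv\<close>). What makes the comparison possible is that the phase of the far field,
  \<open>kappa (direction x) \<bullet> lat x\<close>, is a support function: \<open>kappa \<omega>\<close> minimises \<open>k \<bullet> \<omega>\<close> over the region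
  enclosed by the level surface (\<open>kappa_spec\<close>; this is for positive energies, to which the negative ones
  are reduced by a translation of the torus), so that translating \<open>x\<close> by \<open>- y\<close> lowers the phase by
  \<open>kappa \<omega> \<bullet> lat y\<close> in the limit (\<open>phase_limit\<close>).

  Equality of \<open>\<bar>a\<^sub>f\<bar>\<close> and \<open>\<bar>a\<^sub>g\<bar>\<close> on \<open>N\<close> thus says that \<open>(\<bar>ft f\<bar>\<^sup>2 - \<bar>ft g\<bar>\<^sup>2) (kappa) * \<bar>a\<^sub>0\<bar>\<^sup>2\<close> vanishes on
  \<open>N\<close>. Let \<open>p\<close> be the finitely supported function with \<open>ft p = \<bar>ft f\<bar>\<^sup>2 - \<bar>ft g\<bar>\<^sup>2\<close>. Then the far field of
  the source \<open>p * f\<^sub>0\<close> vanishes in an open cone of directions for an interval of energies. Such a source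
  is zero (\<open>no_decaying_far_field\<close>), and finitely supported functions have no zero divisors under
  convolution, so \<open>p = 0\<close> and \<open>\<bar>ft f\<bar> = \<bar>ft g\<bar>\<close> everywhere. The other pair of intensities gives
  \<open>\<bar>ft f + ft f\<^sub>0\<bar> = \<bar>ft g + ft f\<^sub>0\<bar>\<close>. For \<open>w = f - g\<close> the two equations leave
  \<open>Re (ft w * cnj (ft f\<^sub>0)) = 0\<close>: the correlation of \<open>w\<close> with \<open>f\<^sub>0\<close> and its reflected conjugate add up
  to zero. A hyperplane between \<open>D\<close> and \<open>D\<^sub>0\<close> puts their supports into opposite half-spaces, so both
  vanish, and \<open>w = 0\<close> (\<open>separated_phase_retrieval\<close>).

  The proof of \<open>no_decaying_far_field\<close> plays two descriptions of a wave packet against each other.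
  Replace the source by one, \<open>F\<close>, with \<open>ft F \<ge> 0\<close>. The imaginary part of the boundary value of the
  resolvent at the point \<open>x\<close> is, up to a constant, the density, in the energy, of \<open>ft F\<close> weighted by
  the plane wave. Hence the coefficients at \<open>x\<close> of \<open>cis (n * phi) * ft F\<close>, cut off to a compact set \<open>E\<close> of energies, are
  Fourier coefficients of this density in the variable \<open>n\<close>, and the inequality of Bessel bounds the sum
  of their squares over all times \<open>n\<close> by the square of the size of the field at \<open>x\<close>
  (\<open>time_bessel\<close>). Decay of the field in a cone therefore makes the mass of the packet in a ball around
  \<open>n *\<^sub>R v\<close> small for suitable large \<open>n\<close>, if \<open>v\<close> lies in the cone (\<open>packet_average\<close>). On the other hand
  the part of the packet with wave vector \<open>k\<close> moves with velocity \<open>grad_phi k\<close> (\<open>propagation\<close>). So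
  \<open>ft F\<close> vanishes at the wave vectors in question; they form a nonempty open set, and a trigonometric
  polynomial that vanishes on an open set is zero.
\<close>

section \<open>The level surfaces of the symbol\<close>

definition grad_phi :: "real ^ 'n \<Rightarrow> real ^ 'n" where
  "grad_phi k = (\<chi> i. - 2 * sin (k $ i))"

lemma gderiv_phi: "GDERIV phi k :> grad_phi k"
proof -
  have 1: "((\<lambda>k. 2 * (\<Sum>i\<in>UNIV. cos (k $ i))) has_derivative
     (\<lambda>h. 2 * (\<Sum>i\<in>UNIV. (h $ i) * (- sin (k $ i))))) (at k)"
    by (auto intro!: derivative_eq_intros bounded_linear_imp_has_derivative bounded_linear_vec_nth)
  have "(\<lambda>k::real^'a. 2 * (\<Sum>i\<in>UNIV. cos (k $ i))) = phi" by (simp add: phi_def fun_eq_iff)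
  moreover have "(\<lambda>h. 2 * (\<Sum>i\<in>UNIV. (h $ i) * (- sin (k $ i)))) = (\<lambda>h. inner h (grad_phi k))"
    by (auto simp: fun_eq_iff inner_vec_def grad_phi_def sum_distrib_left intro!: sum.cong)
  ultimately show ?thesis using 1 by (simp add: gderiv_def)
qed

lemma gradient_phi [simp]: "gradient phi k = grad_phi k"
  unfolding gradient_def
proof (rule the_equality)
  show "GDERIV phi k :> grad_phi k" by (rule gderiv_phi)
  fix g assume "GDERIV phi k :> g"
  then have "(\<lambda>h. inner h g) = (\<lambda>h. inner h (grad_phi k))"
    using gderiv_phi[of k] unfolding gderiv_def by (metis has_derivative_unique)
  then have "\<forall>h. inner h (g - grad_phi k) = 0" by (simp add: fun_eq_iff inner_diff_right)
  then show "g = grad_phi k" by (metis inner_eq_zero_iff right_minus_eq)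
qed

lemma phi_line_deriv:
  "((\<lambda>t. phi (k + t *\<^sub>R v)) has_real_derivative inner v (grad_phi k)) (at 0)"
proof -
  have "((\<lambda>t. 2 * (\<Sum>i\<in>UNIV. cos ((k + t *\<^sub>R v) $ i))) has_real_derivative
     2 * (\<Sum>i\<in>UNIV. (- sin (k $ i)) * v $ i)) (at 0)"
    by (auto intro!: derivative_eq_intros)
  moreover have "2 * (\<Sum>i\<in>UNIV. (- sin (k $ i)) * v $ i) = inner v (grad_phi k)"
    by (auto simp: inner_vec_def grad_phi_def sum_distrib_left intro!: sum.cong)
  ultimately show ?thesis by (simp add: phi_def)
qed

text \<open>
  The function \<open>u \<mapsto> sqrt (1 - r + r * u\<^sup>2)\<close> is convex, being the norm of the vector
  \<open>(sqrt (1 - r), sqrt r * u)\<close>. This is its chord inequality between \<open>- 1\<close>, where its value is \<open>1\<close>, and \<open>v\<close>.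
\<close>

lemma sqrt_chord:
  fixes r t v :: real
  assumes "0 \<le> r" "r \<le> 1" "0 \<le> t" "t \<le> 1"
  shows "sqrt (1 - r + r * ((1-t) * (-1) + t * v)\<^sup>2) \<le> (1 - t) + t * sqrt (1 - r + r * v\<^sup>2)"
proof -
  define s where "s = sqrt (1 - r + r * v\<^sup>2)"
  have nn: "0 \<le> 1 - r + r * v\<^sup>2" using assms by simp
  have s2: "s\<^sup>2 = 1 - r + r * v\<^sup>2" and s0: "0 \<le> s" using nn by (auto simp: s_def)
  have "(1 - r - r * v)\<^sup>2 \<le> s\<^sup>2"
  proof -
    have "s\<^sup>2 - (1 - r - r * v)\<^sup>2 = (1 - r) * r * (1 + v)\<^sup>2"
      unfolding s2 by (simp add: power2_eq_square algebra_simps)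
    moreover have "\<dots> \<ge> 0" using assms by simp
    ultimately show ?thesis by linarith
  qed
  then have key: "1 - r - r * v \<le> s" using s0 by (rule power2_le_imp_le)
  have "((1 - t) + t * s)\<^sup>2 - (1 - r + r * ((1-t) * (-1) + t * v)\<^sup>2)
     = t\<^sup>2 * (s\<^sup>2 - (1 - r + r * v\<^sup>2)) + 2 * t * (1 - t) * (s - (1 - r - r * v))"
    by (simp add: power2_eq_square algebra_simps)
  also have "\<dots> \<ge> 0" using key s2 assms by simp
  finally have "1 - r + r * ((1-t) * (-1) + t * v)\<^sup>2 \<le> ((1 - t) + t * s)\<^sup>2" by simp
  then show ?thesis using s0 assms unfolding s_def[symmetric]
    by (intro real_le_lsqrt) auto
qed

text \<open>
  At energies above \<open>2 * CARD('n) - 4\<close> this bound forbids two nonpositive cosines.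
\<close>

lemma phi_le_pair:
  fixes k :: "real ^ 'n"
  assumes "i \<noteq> j"
  shows "phi k \<le> 2 * (cos (k $ i) + cos (k $ j)) + 2 * (real CARD('n) - 2)"
proof -
  have "(\<Sum>l\<in>UNIV. cos (k $ l)) = cos (k $ i) + (cos (k $ j) + (\<Sum>l\<in>UNIV - {i} - {j}. cos (k $ l)))"
    using assms by (simp add: sum.remove[of UNIV i] sum.remove[of "UNIV - {i}" j])
  moreover have "(\<Sum>l\<in>UNIV - {i} - {j}. cos (k $ l)) \<le> (\<Sum>l\<in>UNIV - {i} - {j}. 1)"
    by (rule sum_mono) simp
  moreover have "card (UNIV - {i} - {j} :: 'n set) = CARD('n) - 2"
    using assms by (simp add: card_Diff_singleton_if)
  moreover have "CARD('n) \<ge> 2"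
    using card_mono[of "UNIV :: 'n set" "{i, j}"] assms by simp
  ultimately show ?thesis by (simp add: phi_def of_nat_diff)
qed

lemma phi_le_single:
  fixes k :: "real ^ 'n"
  shows "phi k \<le> 2 * cos (k $ i) + 2 * (real CARD('n) - 1)"
proof -
  have "(\<Sum>l\<in>UNIV. cos (k $ l)) = cos (k $ i) + (\<Sum>l\<in>UNIV - {i}. cos (k $ l))"
    by (simp add: sum.remove[of UNIV i])
  moreover have "(\<Sum>l\<in>UNIV - {i}. cos (k $ l)) \<le> (\<Sum>l\<in>UNIV - {i}. 1)"
    by (rule sum_mono) simp
  moreover have "card (UNIV - {i} :: 'n set) = CARD('n) - 1"
    by (simp add: card_Diff_singleton_if)
  moreover have "CARD('n) \<ge> 1" by (simp add: Suc_leI)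
  ultimately show ?thesis by (simp add: phi_def of_nat_diff)
qed

text \<open>
  Points of a level surface with prescribed normal are determined by one cosine. The ratios of the sines
  are the ratios of the components of the normal, so the cosines are known up to sign; only the cosine that
  belongs to the largest sine can be negative, since otherwise two cosines would have a nonpositive sum.
\<close>

lemma level_point_formula:
  fixes k :: "real ^ 'n"
  assumes phi: "phi k > 2 * real CARD('n) - 4"
    and max: "\<And>i. \<bar>sin (k $ i)\<bar> \<le> \<bar>sin (k $ j)\<bar>" and j0: "sin (k $ j) \<noteq> 0"
    and r: "\<And>i. (sin (k $ i))\<^sup>2 = r i * (sin (k $ j))\<^sup>2" and ij: "i \<noteq> j"
  shows "cos (k $ i) = sqrt (1 - r i + r i * (cos (k $ j))\<^sup>2)"
proof -
  have "cos (k $ i) \<ge> 0"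
  proof (rule ccontr)
    assume neg: "\<not> ?thesis"
    have "2 * real CARD('n) - 4 < 2 * (cos (k $ i) + cos (k $ j)) + 2 * (real CARD('n) - 2)"
      by (rule less_le_trans[OF phi phi_le_pair[OF ij]])
    then have "cos (k $ i) + cos (k $ j) > 0" by (simp add: algebra_simps)
    then have "\<bar>cos (k $ i)\<bar> < \<bar>cos (k $ j)\<bar>" using neg by linarith
    then have "(cos (k $ i))\<^sup>2 < (cos (k $ j))\<^sup>2" by (metis abs_ge_zero power2_abs power_strict_mono zero_less_numeral)
    then have "(sin (k $ j))\<^sup>2 < (sin (k $ i))\<^sup>2" using sin_cos_squared_add[of "k$i"] sin_cos_squared_add[of "k$j"] by linarith
    moreover have "(sin (k $ i))\<^sup>2 \<le> (sin (k $ j))\<^sup>2" using max[of i] by (simp add: abs_le_square_iff)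
    ultimately show False by linarith
  qed
  moreover have "1 - r i + r i * (cos (k $ j))\<^sup>2 = (cos (k $ i))\<^sup>2"
  proof -
    have "1 - r i + r i * (cos (k $ j))\<^sup>2 = 1 - r i * (sin (k $ j))\<^sup>2"
      using cos_squared_eq[of "k $ j"] by (simp add: right_diff_distrib)
    also have "\<dots> = (cos (k $ i))\<^sup>2" using r[of i] cos_squared_eq[of "k$i"] by linarith
    finally show ?thesis .
  qed
  ultimately show ?thesis by simp
qed

text \<open>
  The left side is a convex function \<open>L\<close> of \<open>u\<close> with \<open>L (- 1) = CARD('n) - 2\<close>. A convex function takes
  a value larger than the one at the left end point of its interval at most once.
\<close>

lemma level_unique_scalar:
  fixes r :: "'n::finite \<Rightarrow> real"
  assumes r: "\<And>i. 0 \<le> r i \<and> r i \<le> 1" and u: "- 1 < u" "u \<le> v"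
    and L: "u + (\<Sum>i\<in>UNIV - {j}. sqrt (1 - r i + r i * u\<^sup>2)) = l"
      "v + (\<Sum>i\<in>UNIV - {j}. sqrt (1 - r i + r i * v\<^sup>2)) = l"
    and l: "l > real CARD('n) - 2"
  shows "u = v"
proof (rule ccontr)
  assume "u \<noteq> v"
  with u have uv: "u < v" by simp
  \<comment> \<open>the position of \<open>u\<close> on the chord from \<open>- 1\<close> to \<open>v\<close>\<close>
  define t where "t = (u + 1) / (v + 1)"
  have t: "0 < t" "t < 1" using u uv by (auto simp: t_def)
  have tu: "u = (1-t) * (-1) + t * v"
  proof -
    have "t * (v + 1) = u + 1" using u uv by (simp add: t_def)
    then show ?thesis by (simp add: algebra_simps)
  qed
  define A where "A = (\<Sum>i\<in>UNIV - {j}. sqrt (1 - r i + r i * u\<^sup>2))"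
  define B where "B = (\<Sum>i\<in>UNIV - {j}. sqrt (1 - r i + r i * v\<^sup>2))"
  have "A \<le> (\<Sum>i\<in>UNIV - {j}. (1 - t) + t * sqrt (1 - r i + r i * v\<^sup>2))"
    unfolding A_def by (rule sum_mono) (use r t sqrt_chord in \<open>auto simp: tu\<close>)
  also have "\<dots> = (1 - t) * real (CARD('n) - 1) + t * B"
    by (simp add: sum.distrib sum_distrib_left B_def)
  also have "real (CARD('n) - 1) = real CARD('n) - 1" by (simp add: of_nat_diff Suc_leI)
  finally have "A \<le> (1 - t) * (real CARD('n) - 1) + t * B" .
  moreover have "A = l - u" "B = l - v" using L by (simp_all add: A_def B_def)
  ultimately have "l - u \<le> (1 - t) * (real CARD('n) - 1) + t * (l - v)" by simp
  then have "l \<le> (1-t) * (real CARD('n) - 2) + t * l" using tu by (simp add: algebra_simps)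
  then have "(1 - t) * l \<le> (1 - t) * (real CARD('n) - 2)" by (simp add: algebra_simps)
  then show False using t l by simp
qed

lemma sin_cos_eq_torus:
  fixes a b :: real
  assumes "sin a = sin b" "cos a = cos b" "- pi < a" "a \<le> pi" "- pi < b" "b \<le> pi"
  shows "a = b"
proof -
  obtain n :: int where n: "a = b + 2 * pi * of_int n"
    using assms(1,2) sin_cos_eq_iff[of a b] by (auto simp: algebra_simps)
  have "\<bar>2 * pi * of_int n\<bar> < 2 * pi * 1" using assms n by linarith
  then have "\<bar>real_of_int n\<bar> < 1" by (simp add: abs_mult)
  then have "n = 0" by linarith
  with n show ?thesis by simp
qed

text \<open>
  A level surface has at most one point with a given normal direction. In the region
  \<open>phi > 2 * CARD('n) - 4\<close> the surface is strictly convex, but individual cosines can be negative there, so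
  that \<open>phi\<close> itself is not concave; the argument is the scalar convexity of \<open>level_unique_scalar\<close> instead.
\<close>

lemma level_unique:
  fixes k k' :: "real ^ 'n"
  assumes k: "k \<in> Gamma_surface lam" and k': "k' \<in> Gamma_surface lam"
    and lam: "lam > 2 * real CARD('n) - 4"
    and par: "\<And>i. sin (k $ i) = \<tau> * sin (k' $ i)" and \<tau>: "\<tau> > 0"
    and nz: "grad_phi k \<noteq> 0"
  shows "k = k'"
proof -
  obtain j where max: "\<And>i. \<bar>sin (k $ i)\<bar> \<le> \<bar>sin (k $ j)\<bar>"
  proof -
    have "finite (range (\<lambda>i. \<bar>sin (k $ i)\<bar>))" by simp
    then obtain j where "\<bar>sin (k $ j)\<bar> = Max (range (\<lambda>i. \<bar>sin (k $ i)\<bar>))"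
      by (metis (mono_tags, lifting) Max_in UNIV_I empty_iff image_iff)
    then show ?thesis using that[of j] by (simp add: Max_ge)
  qed
  have j0: "sin (k $ j) \<noteq> 0"
  proof
    assume "sin (k $ j) = 0"
    then have "sin (k $ i) = 0" for i using max[of i] by simp
    then show False using nz by (simp add: grad_phi_def vec_eq_iff)
  qed
  define r where "r i = (sin (k $ i) / sin (k $ j))\<^sup>2" for i
  have r01: "0 \<le> r i \<and> r i \<le> 1" for i
  proof -
    have "\<bar>sin (k $ i) / sin (k $ j)\<bar> \<le> 1" using max[of i] j0 by (simp add: abs_divide)
    then show ?thesis by (auto simp: r_def abs_square_le_1)
  qed
  have j0': "sin (k' $ j) \<noteq> 0" using par[of j] j0 by auto
  have max': "\<bar>sin (k' $ i)\<bar> \<le> \<bar>sin (k' $ j)\<bar>" for i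
    using max[of i] \<tau> by (simp add: par abs_mult)
  have ph: "phi k = lam" "phi k' = lam" using k k' by (auto simp: Gamma_surface_def)
  have f: "cos (k $ i) = sqrt (1 - r i + r i * (cos (k $ j))\<^sup>2)" if "i \<noteq> j" for i
    by (rule level_point_formula) (use ph lam max j0 that in \<open>auto simp: r_def power_divide\<close>)
  have f': "cos (k' $ i) = sqrt (1 - r i + r i * (cos (k' $ j))\<^sup>2)" if "i \<noteq> j" for i
    by (rule level_point_formula) (use ph lam max' j0' \<tau> that in \<open>auto simp: r_def power_divide par power_mult_distrib\<close>)
  have s: "cos (k $ j) + (\<Sum>i\<in>UNIV - {j}. sqrt (1 - r i + r i * (cos (k $ j))\<^sup>2)) = lam / 2"
  proof -
    have "(\<Sum>i\<in>UNIV - {j}. sqrt (1 - r i + r i * (cos (k $ j))\<^sup>2)) = (\<Sum>i\<in>UNIV - {j}. cos (k $ i))"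
      by (rule sum.cong) (use f in auto)
    then show ?thesis using ph(1) by (simp add: phi_def sum.remove[of UNIV j])
  qed
  have s': "cos (k' $ j) + (\<Sum>i\<in>UNIV - {j}. sqrt (1 - r i + r i * (cos (k' $ j))\<^sup>2)) = lam / 2"
  proof -
    have "(\<Sum>i\<in>UNIV - {j}. sqrt (1 - r i + r i * (cos (k' $ j))\<^sup>2)) = (\<Sum>i\<in>UNIV - {j}. cos (k' $ i))"
      by (rule sum.cong) (use f' in auto)
    then show ?thesis using ph(2) by (simp add: phi_def sum.remove[of UNIV j])
  qed
  have gt: "cos a > -1" if "sin a \<noteq> 0" for a :: real
  proof -
    have "(cos a)\<^sup>2 \<noteq> 1" using that sin_cos_squared_add[of a] by (metis add_cancel_left_left zero_eq_power2)
    then have "cos a \<noteq> -1" by auto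
    then show ?thesis using cos_ge_minus_one[of a] by linarith
  qed
  have cj: "cos (k $ j) = cos (k' $ j)"
  proof (cases "cos (k $ j) \<le> cos (k' $ j)")
    case True
    show ?thesis by (rule level_unique_scalar[OF r01 gt[OF j0] True s s']) (use lam in simp)
  next
    case False
    then have "cos (k' $ j) \<le> cos (k $ j)" by simp
    from level_unique_scalar[OF r01 gt[OF j0'] this s' s] lam show ?thesis by simp
  qed
  have c: "cos (k $ i) = cos (k' $ i)" for i
    using f f' cj by (cases "i = j") auto
  have "(sin (k $ j))\<^sup>2 = (sin (k' $ j))\<^sup>2" by (simp add: sin_squared_eq c)
  then have "\<tau>\<^sup>2 = 1" using j0' by (simp add: par power_mult_distrib)
  then have "\<tau> = 1" using \<tau> by (simp add: power2_eq_1_iff)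
  then have sn: "sin (k $ i) = sin (k' $ i)" for i by (simp add: par)
  have "k $ i = k' $ i" for i
    by (rule sin_cos_eq_torus[OF sn c]) (use k k' in \<open>auto simp: Gamma_surface_def torus_def\<close>)
  then show ?thesis by (simp add: vec_eq_iff)
qed

text \<open>
  The region that the level surface of a large \<open>lam\<close> encloses. The cube is closed to make the region
  compact; for \<open>lam > 2 * CARD('n) - 4\<close> the region does not meet the boundary of the cube.
\<close>

definition superlevel :: "real \<Rightarrow> (real ^ 'n) set" where
  "superlevel lam = {k. (\<forall>i. \<bar>k $ i\<bar> \<le> pi) \<and> lam \<le> phi k}"

lemma continuous_phi [continuous_intros]: "continuous_on A phi"
  unfolding phi_def by (intro continuous_intros)

lemma continuous_grad_phi [continuous_intros]: "continuous_on A grad_phi"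
  unfolding grad_phi_def by (intro continuous_intros)

lemma compact_superlevel: "compact (superlevel lam :: (real ^ 'n) set)"
proof -
  have "superlevel lam = cbox (\<chi> i. - pi) (\<chi> i. pi) \<inter> {k :: real^'n. lam \<le> phi k}"
    by (auto simp: superlevel_def mem_box_cart abs_le_iff) (smt (verit))+
  moreover have "closed {k :: real^'n. lam \<le> phi k}"
    by (intro closed_Collect_le continuous_intros)
  ultimately show ?thesis by (simp add: compact_Int_closed)
qed

lemma grad_phi_nz:
  fixes k :: "real ^ 'n"
  assumes "phi k < 2 * real CARD('n)" and "\<And>i. \<bar>k $ i\<bar> < pi"
  shows "grad_phi k \<noteq> 0"
proof
  assume "grad_phi k = 0"
  then have s: "sin (k $ i) = 0" for i by (simp add: grad_phi_def vec_eq_iff)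
  have "k $ i = 0" for i
    by (rule sin_eq_0_pi) (use s assms(2)[of i] in auto)
  then show False using assms(1) by (simp add: phi_def)
qed

lemma superlevel_interior:
  fixes k :: "real ^ 'n"
  assumes "k \<in> superlevel lam" "lam > 2 * real CARD('n) - 4"
  shows "\<bar>k $ i\<bar> < pi"
proof (rule ccontr)
  assume "\<not> ?thesis"
  moreover have "\<bar>k $ i\<bar> \<le> pi" using assms(1) by (simp add: superlevel_def)
  ultimately have "\<bar>k $ i\<bar> = pi" by linarith
  then have "cos \<bar>k $ i\<bar> = -1" by simp
  then have c: "cos (k $ i) = -1" by simp
  have "lam \<le> 2 * cos (k $ i) + 2 * (real CARD('n) - 1)"
    using assms(1) phi_le_single[of k i] unfolding superlevel_def by (auto intro: order_trans)
  then show False using c assms(2) by simp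
qed

text \<open>
  Lagrange multipliers by hand: if the unit vectors \<open>g\<close> along the gradient and \<open>\<omega>\<close> differed, moving the
  minimiser in the direction \<open>g - \<omega>\<close> would increase \<open>phi\<close> and decrease the objective.
\<close>

lemma minimizer_props:
  fixes k \<omega> :: "real ^ 'n"
  assumes lam: "2 * real CARD('n) - 4 < lam" "lam < 2 * real CARD('n)" and \<omega>: "norm \<omega> = 1"
    and k: "k \<in> superlevel lam" and min: "\<And>k'. k' \<in> superlevel lam \<Longrightarrow> k \<bullet> \<omega> \<le> k' \<bullet> \<omega>"
  shows "k \<in> Gamma_surface lam" "grad_phi k /\<^sub>R norm (grad_phi k) = \<omega>"
proof -
  have int: "\<bar>k $ i\<bar> < pi" for i by (rule superlevel_interior[OF k lam(1)])
  have dir: "v \<bullet> \<omega> \<ge> 0" if v: "\<forall>\<^sub>F t in at_right 0. phi (k + t *\<^sub>R v) \<ge> lam" for v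
  proof -
    have "((\<lambda>t. k + t *\<^sub>R v) \<longlongrightarrow> k + 0 *\<^sub>R v) (at_right 0)" by (intro tendsto_intros)
    moreover have "open {k :: real^'n. \<forall>i. \<bar>k $ i\<bar> < pi}"
    proof -
      have "{k :: real^'n. \<forall>i. \<bar>k $ i\<bar> < pi} = (\<Inter>i. {k. \<bar>k $ i\<bar> < pi})" by auto
      then show ?thesis by (auto intro!: open_INT open_Collect_less continuous_intros)
    qed
    ultimately have "\<forall>\<^sub>F t in at_right 0. k + t *\<^sub>R v \<in> {k :: real^'n. \<forall>i. \<bar>k $ i\<bar> < pi}"
      using int by (intro topological_tendstoD) auto
    with v have "\<forall>\<^sub>F t in at_right (0::real). k + t *\<^sub>R v \<in> superlevel lam"
      by eventually_elim (auto simp: superlevel_def less_imp_le)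
    moreover have "\<forall>\<^sub>F t in at_right (0::real). t > 0" by (rule eventually_at_right_less)
    ultimately have "\<forall>\<^sub>F t in at_right (0::real). k + t *\<^sub>R v \<in> superlevel lam \<and> t > 0"
      by eventually_elim auto
    then obtain t where t: "t > 0" "k + t *\<^sub>R v \<in> superlevel lam"
      using eventually_happens' trivial_limit_at_right_real by blast
    then have "0 \<le> t * (v \<bullet> \<omega>)" using min[OF t(2)] by (simp add: inner_add_left)
    then show ?thesis using t(1) by (simp add: zero_le_mult_iff)
  qed
  have "phi k \<le> lam"
  proof (rule ccontr)
    assume "\<not> ?thesis"
    then have gt: "phi k > lam" by simp
    have "isCont (\<lambda>t. phi (k + t *\<^sub>R (- \<omega>))) 0"
      using phi_line_deriv DERIV_isCont by blast
    then have "((\<lambda>t. phi (k + t *\<^sub>R (- \<omega>))) \<longlongrightarrow> phi k) (at_right 0)"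
      unfolding isCont_def by (auto intro: tendsto_within_subset)
    then have "\<forall>\<^sub>F t in at_right 0. phi (k + t *\<^sub>R (- \<omega>)) > lam"
      using gt by (rule order_tendstoD)
    then have "\<forall>\<^sub>F t in at_right 0. phi (k + t *\<^sub>R (- \<omega>)) \<ge> lam" by eventually_elim simp
    from dir[OF this] show False using \<omega> by (simp add: dot_square_norm)
  qed
  then have ph: "phi k = lam" using k by (simp add: superlevel_def)
  show G: "k \<in> Gamma_surface lam"
  proof -
    have "- pi < k $ i \<and> k $ i \<le> pi" for i using int[of i] by linarith
    then show ?thesis using ph by (simp add: Gamma_surface_def torus_def)
  qed
  have nz: "grad_phi k \<noteq> 0" by (rule grad_phi_nz) (use ph lam int in auto)
  define g where "g = grad_phi k /\<^sub>R norm (grad_phi k)"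
  have ng: "norm g = 1" using nz by (simp add: g_def)
  show "grad_phi k /\<^sub>R norm (grad_phi k) = \<omega>"
  proof (rule ccontr)
    assume "\<not> ?thesis"
    then have ne: "g \<noteq> \<omega>" by (simp add: g_def)
    have lt: "g \<bullet> \<omega> < 1"
    proof -
      have "0 < (norm (g - \<omega>))\<^sup>2" using ne by simp
      also have "(norm (g - \<omega>))\<^sup>2 = 2 - 2 * (g \<bullet> \<omega>)"
        using ng \<omega> by (simp add: power2_norm_eq_inner inner_diff_left inner_diff_right inner_commute norm_eq_1)
      finally show ?thesis by simp
    qed
    have gg: "grad_phi k = norm (grad_phi k) *\<^sub>R g" using nz by (simp add: g_def)
    have "(g - \<omega>) \<bullet> grad_phi k = norm (grad_phi k) * (1 - g \<bullet> \<omega>)"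
      by (subst gg) (use ng in \<open>simp add: inner_diff_left inner_commute norm_eq_1 algebra_simps\<close>)
    then have "(g - \<omega>) \<bullet> grad_phi k > 0" using lt nz by simp
    from DERIV_pos_inc_right[OF phi_line_deriv this]
    obtain d where d: "d > 0" "\<And>h. 0 < h \<Longrightarrow> h < d \<Longrightarrow> phi k < phi (k + h *\<^sub>R (g - \<omega>))" by auto
    have "\<forall>\<^sub>F t in at_right 0. phi (k + t *\<^sub>R (g - \<omega>)) \<ge> lam"
      unfolding eventually_at_right_field using d ph by (intro exI[of _ d]) (auto simp: less_imp_le)
    from dir[OF this] show False using lt \<omega> by (simp add: inner_diff_left dot_square_norm)
  qed
qed

lemma same_direction:
  fixes g h \<omega> :: "'a :: real_normed_vector"
  assumes "norm \<omega> = 1" "g /\<^sub>R norm g = \<omega>" "h /\<^sub>R norm h = \<omega>"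
  shows "g \<noteq> 0" "h \<noteq> 0" "g = (norm g / norm h) *\<^sub>R h"
proof -
  show g: "g \<noteq> 0" using assms(1,2) by auto
  show h: "h \<noteq> 0" using assms(1,3) by auto
  have "g = norm g *\<^sub>R (g /\<^sub>R norm g)" using g by simp
  also have "\<dots> = norm g *\<^sub>R (h /\<^sub>R norm h)" by (simp only: assms(2,3))
  also have "\<dots> = (norm g / norm h) *\<^sub>R h" by (simp add: divide_inverse)
  finally show "g = (norm g / norm h) *\<^sub>R h" .
qed

text \<open>
  Existence of \<open>kappa\<close> comes from compactness, uniqueness from \<open>level_unique\<close>. Both together show that
  \<open>kappa\<close> is the minimiser, which is the only property of it that the asymptotics of phases needs.
\<close>

lemma kappa_spec:
  fixes \<omega> :: "real ^ 'n"
  assumes lam: "2 * real CARD('n) - 4 < lam" "lam < 2 * real CARD('n)" and \<omega>: "norm \<omega> = 1"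
  shows "kappa \<omega> lam \<in> Gamma_surface lam"
    and "grad_phi (kappa \<omega> lam) /\<^sub>R norm (grad_phi (kappa \<omega> lam)) = \<omega>"
    and "kappa \<omega> lam \<in> superlevel lam"
    and "k' \<in> superlevel lam \<Longrightarrow> kappa \<omega> lam \<bullet> \<omega> \<le> k' \<bullet> \<omega>"
    and "k \<in> Gamma_surface lam \<Longrightarrow> grad_phi k /\<^sub>R norm (grad_phi k) = \<omega> \<Longrightarrow> k = kappa \<omega> lam"
proof -
  have "0 \<in> (superlevel lam :: (real^'n) set)"
    using lam by (simp add: superlevel_def phi_def)
  then have "(superlevel lam :: (real^'n) set) \<noteq> {}" by blast
  then obtain k0 :: "real^'n" where k0: "k0 \<in> superlevel lam" "\<And>k'. k' \<in> superlevel lam \<Longrightarrow> k0 \<bullet> \<omega> \<le> k' \<bullet> \<omega>"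
  proof -
    have "continuous_on (superlevel lam) (\<lambda>k::real^'n. k \<bullet> \<omega>)" by (intro continuous_intros)
    from continuous_attains_inf[OF compact_superlevel \<open>superlevel lam \<noteq> {}\<close> this] that
    show ?thesis by blast
  qed
  have k0p: "k0 \<in> Gamma_surface lam" "grad_phi k0 /\<^sub>R norm (grad_phi k0) = \<omega>"
    using minimizer_props[OF lam \<omega> k0(1)] k0(2) by blast+
  have uniq: "k = k0" if k: "k \<in> Gamma_surface lam" "grad_phi k /\<^sub>R norm (grad_phi k) = \<omega>" for k
  proof -
    define \<tau> where "\<tau> = norm (grad_phi k) / norm (grad_phi k0)"
    note par = same_direction[OF \<omega> k(2) k0p(2)]
    have nz: "grad_phi k \<noteq> 0" and t0: "\<tau> > 0"
      unfolding \<tau>_def using par(1,2) by simp_all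
    have e3: "grad_phi k = \<tau> *\<^sub>R grad_phi k0" unfolding \<tau>_def by (rule par(3))
    have "sin (k $ i) = \<tau> * sin (k0 $ i)" for i
    proof -
      have "grad_phi k $ i = \<tau> * grad_phi k0 $ i" by (subst e3) simp
      then show ?thesis by (simp add: grad_phi_def)
    qed
    from level_unique[OF k(1) k0p(1) lam(1) this t0 nz] show ?thesis .
  qed
  have "kappa \<omega> lam = k0"
    unfolding kappa_def gradient_phi using k0p uniq by (intro the_equality) blast+
  note eq = this
  show "kappa \<omega> lam \<in> Gamma_surface lam" unfolding eq by (rule k0p(1))
  show "grad_phi (kappa \<omega> lam) /\<^sub>R norm (grad_phi (kappa \<omega> lam)) = \<omega>" unfolding eq by (rule k0p(2))
  show "kappa \<omega> lam \<in> superlevel lam" unfolding eq by (rule k0(1))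
  show "kappa \<omega> lam \<bullet> \<omega> \<le> k' \<bullet> \<omega>" if "k' \<in> superlevel lam" unfolding eq by (rule k0(2)[OF that])
  show "k = kappa \<omega> lam" if "k \<in> Gamma_surface lam" "grad_phi k /\<^sub>R norm (grad_phi k) = \<omega>"
    unfolding eq by (rule uniq[OF that])
qed

lemma tendsto_unique_cluster:
  fixes X :: "nat \<Rightarrow> 'a :: metric_space"
  assumes C: "compact C" "\<And>n. X n \<in> C"
    and cl: "\<And>r l. strict_mono r \<Longrightarrow> (X \<circ> r) \<longlonglongrightarrow> l \<Longrightarrow> l \<in> C \<Longrightarrow> l = L"
  shows "X \<longlonglongrightarrow> L"
proof (rule ccontr)
  assume "\<not> ?thesis"
  then obtain e where e: "e > 0" "\<not> (\<forall>\<^sub>F n in sequentially. dist (X n) L < e)"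
    by (auto simp: tendsto_iff)
  then have "\<exists>\<^sub>F n in sequentially. dist (X n) L \<ge> e"
    by (simp add: frequently_def not_le)
  then have "infinite {n. dist (X n) L \<ge> e}" 
    by (simp add: frequently_cofinite flip: cofinite_eq_sequentially)
  then obtain r :: "nat \<Rightarrow> nat" where r: "strict_mono r" "\<And>n. dist (X (r n)) L \<ge> e"
    using infinite_enumerate by blast
  have "\<forall>n. (X \<circ> r) n \<in> C" using C(2) by simp
  then obtain l s where l: "l \<in> C" "strict_mono s" "((X \<circ> r) \<circ> s) \<longlonglongrightarrow> l"
    using C(1) unfolding compact_def by metis
  have "l = L" by (rule cl[of "r \<circ> s"]) (use l r in \<open>auto simp: strict_mono_o o_assoc\<close>)
  then have "\<forall>\<^sub>F n in sequentially. dist ((X \<circ> r \<circ> s) n) L < e"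
    using l(3) e(1) by (auto simp: tendsto_iff)
  then obtain n where "dist ((X \<circ> r \<circ> s) n) L < e" 
    using eventually_happens' sequentially_bot by blast
  then show False using r(2)[of "s n"] by simp
qed

text \<open>
  Every cluster point of the minimisers is a minimiser for the limiting direction.
\<close>

lemma kappa_tendsto:
  fixes \<omega> :: "real ^ 'n"
  assumes lam: "2 * real CARD('n) - 4 < lam" "lam < 2 * real CARD('n)" and \<omega>: "norm \<omega> = 1"
    and w: "\<And>m. norm (w m) = 1" "w \<longlonglongrightarrow> \<omega>"
  shows "(\<lambda>m. kappa (w m) lam) \<longlonglongrightarrow> kappa \<omega> lam"
proof (rule tendsto_unique_cluster[OF compact_superlevel])
  show "kappa (w m) lam \<in> superlevel lam" for m by (rule kappa_spec(3)[OF lam w(1)])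
  fix r l assume r: "strict_mono r" "((\<lambda>m. kappa (w m) lam) \<circ> r) \<longlonglongrightarrow> l" "l \<in> superlevel lam"
  have wr: "(\<lambda>n. w (r n)) \<longlonglongrightarrow> \<omega>" using w(2) r(1) LIMSEQ_subseq_LIMSEQ[of w \<omega> r] by (simp add: o_def)
  have min: "l \<bullet> \<omega> \<le> k' \<bullet> \<omega>" if k': "k' \<in> superlevel lam" for k'
  proof (rule LIMSEQ_le)
    show "(\<lambda>n. kappa (w (r n)) lam \<bullet> w (r n)) \<longlonglongrightarrow> l \<bullet> \<omega>"
      using r(2) wr by (intro tendsto_inner) (auto simp: o_def)
    show "(\<lambda>n. k' \<bullet> w (r n)) \<longlonglongrightarrow> k' \<bullet> \<omega>" using wr by (intro tendsto_intros)
    show "\<exists>N. \<forall>n\<ge>N. kappa (w (r n)) lam \<bullet> w (r n) \<le> k' \<bullet> w (r n)"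
      by (intro exI allI impI kappa_spec(4)[OF lam w(1) k'])
  qed
  show "l = kappa \<omega> lam"
    by (rule kappa_spec(5)[OF lam \<omega> minimizer_props[OF lam \<omega> r(3) min]])
qed

section \<open>Phases along lattice sequences\<close>

lemma lat_diff: "lat (x - y) = lat x - lat y"
  and lat_add: "lat (x + y) = lat x + lat y"
  and lat_uminus: "lat (- x) = - lat x"
  and lat_zero [simp]: "lat 0 = 0"
  by (simp_all add: lat_def vec_eq_iff)

lemma lat_eq_iff [simp]: "lat x = lat y \<longleftrightarrow> x = y"
  by (auto simp: lat_def vec_eq_iff)

lemma norm_direction: "lat x \<noteq> 0 \<Longrightarrow> norm (direction x) = 1"
  by (simp add: direction_def)

lemma norm_scale_direction: "norm (lat x) *\<^sub>R direction x = lat x"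
  by (cases "lat x = 0") (simp_all add: direction_def)

lemma direction_uminus: "direction (- x) = - direction x"
  by (simp add: direction_def lat_uminus)

abbreviation escapes :: "(nat \<Rightarrow> int ^ 'n) \<Rightarrow> bool" where
  "escapes x \<equiv> filterlim (\<lambda>m. norm (lat (x m))) at_top sequentially"

abbreviation phase :: "real \<Rightarrow> int ^ 'n \<Rightarrow> real" where
  "phase lam x \<equiv> kappa (direction x) lam \<bullet> lat x"

lemma eventually_direction_unit:
  assumes "escapes x"
  shows "\<forall>\<^sub>F m in sequentially. norm (direction (x m)) = 1"
proof -
  have "\<forall>\<^sub>F m in sequentially. norm (lat (x m)) > 0"
    using assms unfolding filterlim_at_top_dense by blast
  then show ?thesis by eventually_elim (auto intro: norm_direction)
qed

text \<open>
  Finite translations do not change the direction in which a sequence escapes.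
\<close>

lemma shifted_sequence:
  fixes x :: "nat \<Rightarrow> int ^ 'n"
  assumes x: "escapes x"
    and w: "(\<lambda>m. direction (x m)) \<longlonglongrightarrow> \<omega>"
  shows "escapes (\<lambda>m. x m - y)"
    and "(\<lambda>m. norm (lat (x m - y)) / norm (lat (x m))) \<longlonglongrightarrow> 1"
    and "(\<lambda>m. direction (x m - y)) \<longlonglongrightarrow> \<omega>"
proof -
  show a: "escapes (\<lambda>m. x m - y)"
  proof (rule filterlim_at_top_mono)
    show "filterlim (\<lambda>m. - norm (lat y) + norm (lat (x m))) at_top sequentially"
      by (rule filterlim_tendsto_add_at_top[OF tendsto_const x])
    show "\<forall>\<^sub>F m in sequentially. - norm (lat y) + norm (lat (x m)) \<le> norm (lat (x m - y))"
      using norm_triangle_ineq2 by (intro always_eventually allI) (simp add: lat_diff)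
  qed
  have pos: "\<forall>\<^sub>F m in sequentially. norm (lat (x m)) > 0"
    using x unfolding filterlim_at_top_dense by blast
  have pos': "\<forall>\<^sub>F m in sequentially. norm (lat (x m - y)) > 0"
    using a unfolding filterlim_at_top_dense by blast
  have inv: "(\<lambda>m. inverse (norm (lat (x m)))) \<longlonglongrightarrow> 0"
    by (rule tendsto_inverse_0_at_top[OF x])
  have d: "(\<lambda>m. direction (x m) - inverse (norm (lat (x m))) *\<^sub>R lat y) \<longlonglongrightarrow> \<omega> - 0 *\<^sub>R lat y"
    using w inv by (intro tendsto_intros)
  have dd: "direction (x m) - inverse (norm (lat (x m))) *\<^sub>R lat y = lat (x m - y) /\<^sub>R norm (lat (x m))" for m
    by (simp add: direction_def lat_diff scaleR_diff_right)
  have d2: "(\<lambda>m. lat (x m - y) /\<^sub>R norm (lat (x m))) \<longlonglongrightarrow> \<omega>" using d by (simp add: dd)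
  have n1: "norm \<omega> = 1"
  proof (rule LIMSEQ_unique)
    show "(\<lambda>m. norm (direction (x m))) \<longlonglongrightarrow> norm \<omega>" by (intro tendsto_norm w)
    show "(\<lambda>m. norm (direction (x m))) \<longlonglongrightarrow> 1"
      by (rule tendsto_eventually) (rule eventually_direction_unit[OF x])
  qed
  show b: "(\<lambda>m. norm (lat (x m - y)) / norm (lat (x m))) \<longlonglongrightarrow> 1"
    using tendsto_norm[OF d2] n1 by (simp add: divide_inverse mult.commute)
  have "(\<lambda>m. inverse (norm (lat (x m - y)) / norm (lat (x m))) *\<^sub>R (lat (x m - y) /\<^sub>R norm (lat (x m)))) \<longlonglongrightarrow> inverse 1 *\<^sub>R \<omega>"
    by (intro tendsto_intros b d2) simp
  then have "(\<lambda>m. inverse (norm (lat (x m - y)) / norm (lat (x m))) *\<^sub>R (lat (x m - y) /\<^sub>R norm (lat (x m)))) \<longlonglongrightarrow> \<omega>"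
    by simp
  then show "(\<lambda>m. direction (x m - y)) \<longlonglongrightarrow> \<omega>"
  proof (rule Lim_transform_eventually)
    show "\<forall>\<^sub>F m in sequentially. inverse (norm (lat (x m - y)) / norm (lat (x m))) *\<^sub>R (lat (x m - y) /\<^sub>R norm (lat (x m))) = direction (x m - y)"
      using pos pos' by eventually_elim (simp add: direction_def field_simps)
  qed
qed

lemma direction_limit_unit:
  assumes "escapes x" "(\<lambda>m. direction (x m)) \<longlonglongrightarrow> \<omega>"
  shows "norm \<omega> = 1"
proof (rule LIMSEQ_unique)
  show "(\<lambda>m. norm (direction (x m))) \<longlonglongrightarrow> norm \<omega>" by (intro tendsto_norm assms)
  show "(\<lambda>m. norm (direction (x m))) \<longlonglongrightarrow> 1"
    by (rule tendsto_eventually) (rule eventually_direction_unit[OF assms(1)])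
qed

lemma kappa_direction_tendsto:
  fixes x :: "nat \<Rightarrow> int ^ 'n"
  assumes lam: "2 * real CARD('n) - 4 < lam" "lam < 2 * real CARD('n)"
    and x: "escapes x"
    and w: "(\<lambda>m. direction (x m)) \<longlonglongrightarrow> \<omega>"
  shows "(\<lambda>m. kappa (direction (x m)) lam) \<longlonglongrightarrow> kappa \<omega> lam"
proof -
  note n = direction_limit_unit[OF x w]
  define v where "v m = (if norm (direction (x m)) = 1 then direction (x m) else \<omega>)" for m
  have ev: "\<forall>\<^sub>F m in sequentially. direction (x m) = v m"
    using eventually_direction_unit[OF x] by eventually_elim (simp add: v_def)
  have "v \<longlonglongrightarrow> \<omega>" by (rule Lim_transform_eventually[OF w ev])
  then have "(\<lambda>m. kappa (v m) lam) \<longlonglongrightarrow> kappa \<omega> lam"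
    by (rule kappa_tendsto[OF lam n, rotated]) (simp add: v_def n)
  then show ?thesis
    by (rule Lim_transform_eventually) (use ev in \<open>eventually_elim, simp\<close>)
qed

text \<open>
  Two applications of minimality give \<open>kappa (direction x) \<bullet> lat y\<close> as a lower bound and
  \<open>kappa (direction (x - y)) \<bullet> lat y\<close> as an upper bound for the difference of the phases.
\<close>

lemma phase_limit_real:
  fixes x :: "nat \<Rightarrow> int ^ 'n"
  assumes lam: "2 * real CARD('n) - 4 < lam" "lam < 2 * real CARD('n)"
    and x: "escapes x"
    and w: "(\<lambda>m. direction (x m)) \<longlonglongrightarrow> \<omega>"
  shows "(\<lambda>m. phase lam (x m) - phase lam (x m - y))
    \<longlonglongrightarrow> kappa \<omega> lam \<bullet> lat y"
proof (rule tendsto_sandwich)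
  note s = shifted_sequence[OF x w, of y]
  have min: "phase lam z \<le> k \<bullet> lat z" if "k \<in> superlevel lam" for k and z :: "int ^ 'n"
  proof (cases "lat z = 0")
    case False
    have "norm (lat z) * (kappa (direction z) lam \<bullet> direction z) \<le> norm (lat z) * (k \<bullet> direction z)"
      by (intro mult_left_mono kappa_spec(4)[OF lam norm_direction[OF False] that]) simp
    then show ?thesis by (metis inner_scaleR_right norm_scale_direction)
  qed simp
  note mem = kappa_spec(3)[OF lam norm_direction]
  show "\<forall>\<^sub>F m in sequentially. kappa (direction (x m)) lam \<bullet> lat y \<le> phase lam (x m) - phase lam (x m - y)"
    using eventually_direction_unit[OF x]
  proof eventually_elim
    case (elim m)
    have "kappa (direction (x m)) lam \<in> superlevel lam" by (rule kappa_spec(3)[OF lam elim])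
    from min[OF this, of "x m - y"] show ?case by (simp add: lat_diff inner_diff_right)
  qed
  show "\<forall>\<^sub>F m in sequentially. phase lam (x m) - phase lam (x m - y) \<le> kappa (direction (x m - y)) lam \<bullet> lat y"
    using eventually_direction_unit[OF s(1)]
  proof eventually_elim
    case (elim m)
    have "kappa (direction (x m - y)) lam \<in> superlevel lam" by (rule kappa_spec(3)[OF lam elim])
    from min[OF this, of "x m"] show ?case by (simp add: lat_diff inner_diff_right)
  qed
  show "(\<lambda>m. kappa (direction (x m)) lam \<bullet> lat y) \<longlonglongrightarrow> kappa \<omega> lam \<bullet> lat y"
    by (intro tendsto_intros kappa_direction_tendsto[OF lam x w])
  show "(\<lambda>m. kappa (direction (x m - y)) lam \<bullet> lat y) \<longlonglongrightarrow> kappa \<omega> lam \<bullet> lat y"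
    by (intro tendsto_intros kappa_direction_tendsto[OF lam s(1,3)])
qed

text \<open>
  Translation by \<open>(\<pi>, \<dots>, \<pi>)\<close> on the torus, in the coordinates of the cube \<open>(-\<pi>, \<pi>]\<close>. It changes the sign
  of \<open>phi\<close> and reduces negative energies to positive ones.
\<close>

definition half_shift :: "real ^ 'n \<Rightarrow> real ^ 'n" where
  "half_shift k = (\<chi> i. if k $ i \<le> 0 then k $ i + pi else k $ i - pi)"

lemma half_shift_torus: "k \<in> torus \<Longrightarrow> half_shift k \<in> torus"
  and half_shift_half_shift: "k \<in> torus \<Longrightarrow> half_shift (half_shift k) = k"
  and phi_half_shift: "phi (half_shift k) = - phi k"
  and grad_phi_half_shift: "grad_phi (half_shift k) = - grad_phi k"
  subgoal by (simp add: half_shift_def torus_def) (smt (verit) pi_gt_zero)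
  subgoal by (simp add: half_shift_def torus_def vec_eq_iff) (smt (verit) pi_gt_zero)
  subgoal
  proof -
    have "cos (half_shift k $ i) = - cos (k $ i)" for i
      by (simp add: half_shift_def cos_diff)
    then show ?thesis by (simp add: phi_def sum_negf)
  qed
  subgoal by (simp add: half_shift_def grad_phi_def vec_eq_iff sin_diff)
  done

text \<open>
  The plane waves of a wave vector and its translate differ by a sign that depends on the lattice
  point alone, whichever representatives modulo \<open>2\<pi>\<close> are used.
\<close>

lemma cis_half_shift:
  "cis (half_shift k \<bullet> lat x) = cis (k \<bullet> lat x) * (-1) powi (\<Sum>i\<in>UNIV. x $ i)"
proof -
  have one: "cis (half_shift k $ i * of_int (x $ i)) = cis (k $ i * of_int (x $ i)) * (-1) powi (x $ i)" for i
  proof -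
    have p: "cis (of_int n * pi) = (-1) powi n" for n
      by (metis cis_pi cis_power_int)
    have m: "(-1) powi n * (-1) powi n = (1::complex)" for n :: int
      by (simp flip: power_int_mult_distrib)
    show ?thesis
    proof (cases "k $ i \<le> 0")
      case True
      then have "half_shift k $ i * of_int (x $ i) = k $ i * of_int (x $ i) + of_int (x $ i) * pi"
        by (simp add: half_shift_def algebra_simps)
      then show ?thesis by (simp add: p flip: cis_mult)
    next
      case False
      then have "k $ i * of_int (x $ i) = half_shift k $ i * of_int (x $ i) + of_int (x $ i) * pi"
        by (simp add: half_shift_def algebra_simps)
      then show ?thesis by (simp add: p m mult.assoc flip: cis_mult)
    qed
  qed
  have pr: "cis (k \<bullet> lat x) = (\<Prod>i\<in>UNIV. cis (k $ i * of_int (x $ i)))" for k :: "real ^ 'a"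
  proof -
    have "cis (\<Sum>i\<in>A. f i) = (\<Prod>i\<in>A. cis (f i))" for A and f :: "'a \<Rightarrow> real"
      by (induction A rule: infinite_finite_induct) (simp_all flip: cis_mult)
    then show ?thesis by (simp add: inner_vec_def lat_def)
  qed
  have pw: "(\<Prod>i\<in>UNIV. (-1) powi (x $ i)) = ((-1) powi (\<Sum>i\<in>UNIV. x $ i) :: complex)"
  proof -
    have "(\<Prod>i\<in>A. (-1) powi (x $ i)) = ((-1) powi (\<Sum>i\<in>A. x $ i) :: complex)" for A
      by (induction A rule: infinite_finite_induct) (simp_all add: power_int_add)
    then show ?thesis .
  qed
  show ?thesis by (simp add: pr one prod.distrib pw)
qed

text \<open>
  In dimension one the two cases overlap.
\<close>

lemma Lambda_cases:
  fixes lam :: real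
  assumes "lam \<in> Lambda TYPE('n::finite)"
  obtains (pos) "2 * real CARD('n) - 4 < lam" "lam < 2 * real CARD('n)"
  | (neg) "2 * real CARD('n) - 4 < - lam" "- lam < 2 * real CARD('n)"
  using assms unfolding Lambda_def by (auto simp: abs_if split: if_splits)

lemma kappa_neg:
  fixes \<omega> :: "real ^ 'n"
  assumes lam: "2 * real CARD('n) - 4 < - lam" "- lam < 2 * real CARD('n)" and \<omega>: "norm \<omega> = 1"
  shows "kappa \<omega> lam = half_shift (kappa (- \<omega>) (- lam))"
    and "kappa \<omega> lam \<in> Gamma_surface lam"
    and "grad_phi (kappa \<omega> lam) /\<^sub>R norm (grad_phi (kappa \<omega> lam)) = \<omega>"
proof -
  define k0 where "k0 = half_shift (kappa (- \<omega>) (- lam))"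
  have n: "norm (- \<omega>) = 1" using \<omega> by simp
  note s = kappa_spec[OF lam n]
  have k0: "k0 \<in> Gamma_surface lam" "grad_phi k0 /\<^sub>R norm (grad_phi k0) = \<omega>"
    using s(1) arg_cong[OF s(2), of uminus]
    by (auto simp: k0_def Gamma_surface_def half_shift_torus phi_half_shift grad_phi_half_shift)
  have uniq: "k = k0" if k: "k \<in> Gamma_surface lam" "grad_phi k /\<^sub>R norm (grad_phi k) = \<omega>" for k
  proof -
    have "half_shift k = kappa (- \<omega>) (- lam)"
      by (rule s(5)) (use k in \<open>auto simp: Gamma_surface_def half_shift_torus phi_half_shift grad_phi_half_shift\<close>)
    then show ?thesis using k(1) half_shift_half_shift[of k] by (simp add: k0_def Gamma_surface_def)
  qed
  have eq: "kappa \<omega> lam = k0"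
    unfolding kappa_def gradient_phi using k0 uniq by (intro the_equality) blast+
  show "kappa \<omega> lam = half_shift (kappa (- \<omega>) (- lam))" using eq by (simp add: k0_def)
  show "kappa \<omega> lam \<in> Gamma_surface lam" unfolding eq by (rule k0(1))
  show "grad_phi (kappa \<omega> lam) /\<^sub>R norm (grad_phi (kappa \<omega> lam)) = \<omega>" unfolding eq by (rule k0(2))
qed

lemma kappa_Lambda:
  fixes \<omega> :: "real ^ 'n"
  assumes "lam \<in> Lambda TYPE('n)" and \<omega>: "norm \<omega> = 1"
  shows "kappa \<omega> lam \<in> Gamma_surface lam"
    and "grad_phi (kappa \<omega> lam) /\<^sub>R norm (grad_phi (kappa \<omega> lam)) = \<omega>"
  using assms(1) by (cases rule: Lambda_cases; simp add: kappa_spec(1,2) kappa_neg(2,3) \<omega>)+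

lemma tendsto_cis [tendsto_intros]: "(f \<longlongrightarrow> l) F \<Longrightarrow> ((\<lambda>x. cis (f x)) \<longlongrightarrow> cis l) F"
  unfolding cis_conv_exp by (intro tendsto_intros)

text \<open>
  For negative energies, \<open>kappa \<omega> lam\<close> is the half shift of \<open>kappa (- \<omega>) (- lam)\<close>. The sign characters
  of the shift combine to the one at \<open>y\<close>, and the rest is the positive case along the sequence \<open>- x\<close>.
\<close>

lemma phase_limit:
  fixes x :: "nat \<Rightarrow> int ^ 'n"
  assumes lam: "lam \<in> Lambda TYPE('n)"
    and x: "escapes x"
    and w: "(\<lambda>m. direction (x m)) \<longlonglongrightarrow> \<omega>"
  shows "(\<lambda>m. cis (phase lam (x m))
              * cis (- (phase lam (x m - y))))
    \<longlonglongrightarrow> cis (kappa \<omega> lam \<bullet> lat y)"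
  using lam
proof (cases rule: Lambda_cases)
  case pos
  from tendsto_cis[OF phase_limit_real[OF pos x w, of y]]
  show ?thesis by (simp add: cis_mult)
next
  case neg
  have x': "escapes (\<lambda>m. - x m)" using x by (simp add: lat_uminus)
  have w': "(\<lambda>m. direction (- x m)) \<longlonglongrightarrow> - \<omega>" unfolding direction_uminus by (intro tendsto_intros w)
  define S where "S z = ((-1) powi (\<Sum>i\<in>UNIV. z $ i) :: complex)" for z :: "int ^ 'n"
  have S_add: "S (u + v) = S u * S v" for u v by (simp add: S_def sum.distrib power_int_add)
  have SS: "S v * S v = 1" for v by (simp add: S_def flip: power_int_mult_distrib)
  have kap: "cis (kappa u lam \<bullet> lat z) = cis (kappa (- u) (- lam) \<bullet> lat z) * S z" if "norm u = 1" for u z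
    unfolding kappa_neg(1)[OF neg that] S_def by (rule cis_half_shift)
  have "(\<lambda>m. - (phase (- lam) (- x m) - phase (- lam) (- x m - - y)))
     \<longlonglongrightarrow> - (kappa (- \<omega>) (- lam) \<bullet> lat (- y))"
    by (intro tendsto_minus phase_limit_real[OF neg x' w'])
  then have "(\<lambda>m. kappa (- direction (x m)) (- lam) \<bullet> lat (x m) - kappa (- direction (x m - y)) (- lam) \<bullet> lat (x m - y))
     \<longlonglongrightarrow> kappa (- \<omega>) (- lam) \<bullet> lat y"
    by (simp add: direction_uminus[symmetric] lat_uminus lat_diff lat_add inner_diff_right inner_add_right algebra_simps)
  from tendsto_cis[OF this]
  have "(\<lambda>m. cis (kappa (- direction (x m)) (- lam) \<bullet> lat (x m) - kappa (- direction (x m - y)) (- lam) \<bullet> lat (x m - y)) * S y)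
     \<longlonglongrightarrow> cis (kappa (- \<omega>) (- lam) \<bullet> lat y) * S y" by (intro tendsto_mult tendsto_const)
  also have "cis (kappa (- \<omega>) (- lam) \<bullet> lat y) * S y = cis (kappa \<omega> lam \<bullet> lat y)"
    by (rule kap[symmetric]) (rule direction_limit_unit[OF x w])
  finally show ?thesis
  proof (rule Lim_transform_eventually)
    show "\<forall>\<^sub>F m in sequentially.
      cis (kappa (- direction (x m)) (- lam) \<bullet> lat (x m) - kappa (- direction (x m - y)) (- lam) \<bullet> lat (x m - y)) * S y
      = cis (phase lam (x m)) * cis (- (phase lam (x m - y)))"
      using eventually_direction_unit[OF x] eventually_direction_unit[OF shifted_sequence(1)[OF x w, of y]]
    proof eventually_elim
      case (elim m)
      have cS: "cnj (S z) = S z" for z by (simp add: S_def)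
      have m: "cis (- (phase lam (x m - y)))
         = cis (- (kappa (- direction (x m - y)) (- lam) \<bullet> lat (x m - y))) * S (x m - y)"
        using arg_cong[OF kap[OF elim(2), of "x m - y"], of cnj] by (simp add: cis_cnj cS)
      have s: "S (x m) * S (x m - y) = S y"
      proof -
        have "S (x m) = S (x m - y) * S y" using S_add[of "x m - y" y] by simp
        then show ?thesis using SS[of "x m - y"] by (simp add: mult.assoc mult.left_commute)
      qed
      have "cis (a - b) * S y = cis a * S (x m) * (cis (- b) * S (x m - y))" for a b
        by (simp add: s[symmetric] mult_ac flip: cis_mult cis_divide)
           (simp add: divide_inverse cis_inverse)
      then show ?case unfolding m kap[OF elim(1)] .
    qed
  qed
qed

section \<open>Integration over the torus\<close>

definition circle_measure :: "real measure" where
  "circle_measure = uniform_measure lborel {- pi..pi}"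

text \<open>
  Normalised Lebesgue measure on the cube, obtained from the product measure on functions so that Fubini's
  theorem in a single coordinate is available.
\<close>

definition torus_measure :: "(real ^ 'n) measure" where
  "torus_measure = distr (Pi\<^sub>M UNIV (\<lambda>_::'n. circle_measure)) borel vec_lambda"

lemma prob_space_circle: "prob_space circle_measure"
  unfolding circle_measure_def by (rule prob_space_uniform_measure) auto

lemma sets_circle [measurable_cong, simp]: "sets circle_measure = sets borel"
  and space_circle [simp]: "space circle_measure = UNIV"
  by (simp_all add: circle_measure_def)

lemma integral_circle:
  fixes f :: "real \<Rightarrow> 'b::{banach, second_countable_topology}"
  assumes [measurable]: "f \<in> borel_measurable borel"
  shows "integral\<^sup>L circle_measure f = (1 / (2 * pi)) *\<^sub>R (LINT x|lborel. indicator {- pi..pi} x *\<^sub>R f x)"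
proof -
  have "circle_measure = density lborel (\<lambda>x. ennreal (indicator {- pi..pi} x / (2 * pi)))"
    unfolding circle_measure_def uniform_measure_def
    by (intro arg_cong[where f = "density lborel"] ext) (auto simp: divide_ennreal[symmetric] split: split_indicator)
  then have "integral\<^sup>L circle_measure f = (LINT x|lborel. (indicator {- pi..pi} x / (2 * pi)) *\<^sub>R f x)"
    by (subst \<open>circle_measure = _\<close>) (intro integral_density; simp)
  also have "\<dots> = (LINT x|lborel. (1 / (2 * pi)) *\<^sub>R (indicator {- pi..pi} x *\<^sub>R f x))"
    by (intro Bochner_Integration.integral_cong) auto
  also have "\<dots> = (1 / (2 * pi)) *\<^sub>R (LINT x|lborel. indicator {- pi..pi} x *\<^sub>R f x)"
    by (rule integral_scaleR_right) 
  finally show ?thesis .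
qed

lemma integral_circle_deriv:
  fixes F :: "real \<Rightarrow> complex"
  assumes F: "\<And>x. (F has_vector_derivative f x) (at x)" and f: "continuous_on UNIV f"
    and per: "F pi = F (- pi)"
  shows "integral\<^sup>L circle_measure f = 0"
proof -
  have "(LINT x|lborel. indicator {- pi..pi} x *\<^sub>R f x) = F pi - F (- pi)"
    by (rule integral_FTC_Icc)
       (auto intro: has_vector_derivative_at_within F continuous_on_subset[OF f])
  moreover have "f \<in> borel_measurable borel" using f by (rule borel_measurable_continuous_onI)
  ultimately show ?thesis by (simp add: integral_circle per)
qed

interpretation circle: product_prob_space "\<lambda>_::'n::finite. circle_measure" UNIV
  by (intro product_prob_spaceI prob_space_circle)

lemma measurable_vec_lambda [measurable]:
  "(vec_lambda :: _ \<Rightarrow> real ^ 'n) \<in> borel_measurable (Pi\<^sub>M UNIV (\<lambda>_. circle_measure))"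
proof (subst borel_measurable_euclidean_space, rule ballI)
  fix b :: "real ^ 'n" assume "b \<in> Basis"
  then obtain i where b: "b = axis i 1" by (auto simp: Basis_vec_def)
  have "(\<lambda>x. x i) \<in> borel_measurable (Pi\<^sub>M (UNIV :: 'n set) (\<lambda>_. circle_measure))"
    by measurable
  then show "(\<lambda>x. vec_lambda x \<bullet> b) \<in> borel_measurable (Pi\<^sub>M (UNIV :: 'n set) (\<lambda>_. circle_measure))"
    by (simp add: b inner_axis)
qed

lemma sets_torus [measurable_cong, simp]: "sets torus_measure = sets borel"
  and space_torus [simp]: "space torus_measure = UNIV"
  by (simp_all add: torus_measure_def)

lemma prob_space_torus: "prob_space torus_measure"
  unfolding torus_measure_def by (rule prob_space.prob_space_distr) (auto intro: prob_space_PiM prob_space_circle)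

interpretation torus: prob_space "torus_measure :: (real ^ 'n) measure" by (rule prob_space_torus)

lemma integrable_torus_bounded:
  fixes h :: "real ^ 'n \<Rightarrow> 'b::{banach, second_countable_topology}"
  assumes "h \<in> borel_measurable borel" "bounded (range h)"
  shows "integrable torus_measure h"
proof -
  from assms(2) obtain B where "\<And>k. norm (h k) \<le> B" by (auto simp: bounded_iff)
  then show ?thesis using assms(1) by (intro torus.integrable_const_bound[of _ B]) auto
qed

text \<open>
  Integrate over the \<open>i\<close>-th coordinate first; the inner integral is the difference of two values that
  agree by periodicity.
\<close>

lemma integral_torus_deriv:
  fixes H :: "real ^ 'n \<Rightarrow> complex"
  assumes H: "\<And>k. ((\<lambda>t. H (k + t *\<^sub>R axis i 1)) has_vector_derivative D k) (at 0)"
    and D: "continuous_on UNIV D" "bounded (range D)"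
    and per: "\<And>k. H (k + (2 * pi) *\<^sub>R axis i 1) = H k"
  shows "(LINT k|torus_measure. D k) = 0"
proof -
  let ?M = "\<lambda>_::'n. circle_measure"
  have [measurable]: "D \<in> borel_measurable borel" using D(1) by (rule borel_measurable_continuous_onI)
  obtain B where B: "\<And>k. norm (D k) \<le> B" using D(2) by (auto simp: bounded_iff)
  have ins: "insert i (UNIV - {i}) = (UNIV :: 'n set)" by auto
  have int: "integrable (Pi\<^sub>M (insert i (UNIV - {i})) ?M) (\<lambda>x. D (vec_lambda x))"
    unfolding ins by (intro circle.integrable_const_bound[of _ B]) (auto simp: B)
  have "(LINT k|torus_measure. D k) = (LINT x|Pi\<^sub>M UNIV ?M. D (vec_lambda x))"
    unfolding torus_measure_def by (rule integral_distr) auto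
  also have "\<dots> = (LINT x|Pi\<^sub>M (insert i (UNIV - {i})) ?M. D (vec_lambda x))" by (simp add: ins)
  also have "\<dots> = (LINT x|Pi\<^sub>M (UNIV - {i}) ?M. (LINT y|circle_measure. D (vec_lambda (x(i := y)))))"
    by (rule circle.product_integral_insert[OF _ _ int]) auto
  also have "(\<lambda>x. LINT y|circle_measure. D (vec_lambda (x(i := y)))) = (\<lambda>x. 0)"
  proof
    fix x
    have upd: "vec_lambda (x(i := y + t)) = vec_lambda (x(i := y)) + t *\<^sub>R axis i 1" for y t :: real
      by (simp add: vec_eq_iff axis_def)
    show "(LINT y|circle_measure. D (vec_lambda (x(i := y)))) = 0"
    proof (rule integral_circle_deriv[where F = "\<lambda>y. H (vec_lambda (x(i := y)))"])
      fix y
      have "((\<lambda>t. H (vec_lambda (x(i := y + t)))) has_vector_derivative D (vec_lambda (x(i := y)))) (at 0)"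
        unfolding upd by (rule H)
      then have t: "((\<lambda>t. H (vec_lambda (x(i := y + t)))) has_vector_derivative D (vec_lambda (x(i := y)))) (at (y - y))"
        by simp
      have u: "((\<lambda>u. u - y) has_vector_derivative 1) (at y)" by (auto intro!: derivative_eq_intros)
      from vector_diff_chain_at[OF u t]
      show "((\<lambda>y. H (vec_lambda (x(i := y)))) has_vector_derivative D (vec_lambda (x(i := y)))) (at y)"
        by (simp add: o_def)
    next
      have "continuous_on UNIV (\<lambda>y. (x(i := y)) j)" for j :: 'n by (cases "j = i") auto
      then have "continuous_on UNIV (\<lambda>y. vec_lambda (x(i := y)) :: real ^ 'n)"
        by (rule continuous_on_vec_lambda)
      then show "continuous_on UNIV (\<lambda>y. D (vec_lambda (x(i := y))))"
        by (rule continuous_on_compose2[OF D(1)]) auto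
    next
      show "H (vec_lambda (x(i := pi))) = H (vec_lambda (x(i := - pi)))"
        using per[of "vec_lambda (x(i := - pi))"] upd[of "- pi" "2 * pi"] by simp
    qed
  qed
  finally show ?thesis by simp
qed

lemma torus_pos:
  fixes k0 :: "real ^ 'n"
  assumes k0: "\<And>i. \<bar>k0 $ i\<bar> < pi" and e: "e > 0"
    and P: "AE k in torus_measure. k \<notin> ball k0 e"
  shows False
proof -
  define r where "r = e / (real CARD('n))"
  have r: "r > 0" using e by (simp add: r_def)
  define S where "S i = {k0 $ i - r<..<k0 $ i + r}" for i
  define A where "A = {k :: real ^ 'n. \<forall>i. k $ i \<in> S i}"
  have sub: "A \<subseteq> ball k0 e"
  proof
    fix k assume k: "k \<in> A"
    have "norm (k - k0) \<le> (\<Sum>i\<in>UNIV. \<bar>(k - k0) $ i\<bar>)" by (rule norm_le_l1_cart)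
    also have "\<dots> < (\<Sum>i\<in>(UNIV::'n set). r)"
    proof (intro sum_strict_mono)
      fix i
      have "k $ i \<in> S i" using k by (simp add: A_def)
      then show "\<bar>(k - k0) $ i\<bar> < r" by (auto simp: S_def abs_less_iff)
    qed auto
    also have "\<dots> = e" by (simp add: r_def)
    finally show "k \<in> ball k0 e" by (simp add: dist_norm norm_minus_commute)
  qed
  from P have "AE k in torus_measure. k \<notin> A" by eventually_elim (use sub in blast)
  then have "AE x in Pi\<^sub>M UNIV (\<lambda>_::'n. circle_measure). vec_lambda x \<notin> A"
    unfolding torus_measure_def by (rule AE_distrD[rotated]) measurable
  then have ae: "AE x in Pi\<^sub>M UNIV (\<lambda>_::'n. circle_measure). x \<notin> Pi\<^sub>E UNIV S"
    by eventually_elim (auto simp: A_def)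
  have "Pi\<^sub>E UNIV S \<in> sets (Pi\<^sub>M UNIV (\<lambda>_::'n. circle_measure))"
    by (rule sets_PiM_I_finite) (auto simp: S_def)
  then have "emeasure (Pi\<^sub>M UNIV (\<lambda>_::'n. circle_measure)) (Pi\<^sub>E UNIV S) = 0"
    using ae by (subst (asm) AE_iff_measurable[where N = "Pi\<^sub>E UNIV S"]) (auto dest: sets.sets_into_space)
  moreover have "emeasure (Pi\<^sub>M UNIV (\<lambda>_::'n. circle_measure)) (Pi\<^sub>E UNIV S) = (\<Prod>i\<in>UNIV. emeasure circle_measure (S i))"
    by (rule circle.emeasure_PiM) (auto simp: S_def)
  ultimately have "(\<Prod>i\<in>UNIV. emeasure circle_measure (S i)) = 0" by simp
  then obtain i where i: "emeasure circle_measure (S i) = 0" by (auto simp: prod_zero_iff)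
  define a where "a = max (- pi) (k0 $ i - r)"
  define b where "b = min pi (k0 $ i + r)"
  have ab: "a < b" using k0[of i] r by (auto simp: a_def b_def abs_less_iff)
  have "{a<..<b} \<subseteq> {- pi..pi} \<inter> S i" by (auto simp: a_def b_def S_def)
  then have "emeasure lborel {a<..<b} \<le> emeasure lborel ({- pi..pi} \<inter> S i)"
    by (intro emeasure_mono) (auto simp: S_def)
  moreover have "emeasure lborel ({- pi..pi} \<inter> S i) = 0"
    using i unfolding circle_measure_def by (subst (asm) emeasure_uniform_measure) (auto simp: S_def)
  ultimately show False using ab by simp
qed

text \<open>
  These are the continuously differentiable functions on the torus; \<open>D\<close> collects the partial derivatives.
\<close>

definition C1per :: "(real ^ 'n \<Rightarrow> complex) \<Rightarrow> ('n \<Rightarrow> real ^ 'n \<Rightarrow> complex) \<Rightarrow> bool" where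
  "C1per h D \<longleftrightarrow>
     (\<forall>i k. ((\<lambda>t. h (k + t *\<^sub>R axis i 1)) has_vector_derivative D i k) (at 0)) \<and>
     continuous_on UNIV h \<and> (\<forall>i. continuous_on UNIV (D i)) \<and>
     bounded (range h) \<and> (\<forall>i. bounded (range (D i))) \<and>
     (\<forall>i k. h (k + (2 * pi) *\<^sub>R axis i 1) = h k)"

lemma bounded_range_mult:
  fixes f g :: "'a \<Rightarrow> 'b::real_normed_algebra"
  assumes "bounded (range f)" "bounded (range g)"
  shows "bounded (range (\<lambda>x. f x * g x))"
proof -
  from assms obtain A B where "\<And>x. norm (f x) \<le> A" "\<And>x. norm (g x) \<le> B" by (auto simp: bounded_iff)
  then have "norm (f x * g x) \<le> A * B" for x
    by (intro order_trans[OF norm_mult_ineq] mult_mono) (auto intro: order_trans[OF norm_ge_zero])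
  then show ?thesis by (auto simp: bounded_iff)
qed

lemma bounded_range_add:
  fixes f g :: "'a \<Rightarrow> 'b::real_normed_vector"
  assumes "bounded (range f)" "bounded (range g)"
  shows "bounded (range (\<lambda>x. f x + g x))"
proof -
  from assms obtain A B where "\<And>x. norm (f x) \<le> A" "\<And>x. norm (g x) \<le> B" by (auto simp: bounded_iff)
  then have "norm (f x + g x) \<le> A + B" for x by (intro norm_triangle_le add_mono)
  then show ?thesis by (auto simp: bounded_iff)
qed

lemma C1per_mult:
  assumes "C1per h D" "C1per g E"
  shows "C1per (\<lambda>k. h k * g k) (\<lambda>i k. D i k * g k + h k * E i k)"
proof -
  have "((\<lambda>t. h (k + t *\<^sub>R axis i 1) * g (k + t *\<^sub>R axis i 1)) has_vector_derivative
      D i k * g k + h k * E i k) (at 0)" for i k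
    using assms has_vector_derivative_mult[of "\<lambda>t. h (k + t *\<^sub>R axis i 1)" "D i k" 0 UNIV
        "\<lambda>t. g (k + t *\<^sub>R axis i 1)" "E i k"]
    by (simp add: C1per_def add.commute)
  then show ?thesis using assms
    unfolding C1per_def by (auto intro!: continuous_intros bounded_range_mult bounded_range_add)
qed

lemma C1per_add:
  assumes "C1per h D" "C1per g E"
  shows "C1per (\<lambda>k. h k + g k) (\<lambda>i k. D i k + E i k)"
  using assms unfolding C1per_def
  by (auto intro!: continuous_intros bounded_range_add derivative_intros)

lemma C1per_const: "C1per (\<lambda>k. c) (\<lambda>i k. 0)"
  unfolding C1per_def by auto

lemma C1per_sum:
  assumes "\<And>y. y \<in> A \<Longrightarrow> C1per (h y) (D y)"
  shows "C1per (\<lambda>k. \<Sum>y\<in>A. h y k) (\<lambda>i k. \<Sum>y\<in>A. D y i k)"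
  using assms
  by (induction A rule: infinite_finite_induct) (auto intro: C1per_const C1per_add)

lemma phi_periodic: "phi (k + (2 * pi) *\<^sub>R axis i 1) = phi k"
  unfolding phi_def by (auto intro!: sum.cong simp: axis_def)

lemma grad_phi_periodic: "grad_phi (k + (2 * pi) *\<^sub>R axis i 1) = grad_phi k"
  unfolding grad_phi_def by (auto simp: vec_eq_iff axis_def)

lemma cis_has_vector_derivative:
  assumes "(f has_real_derivative d) (at t)"
  shows "((\<lambda>t. cis (f t)) has_vector_derivative (\<i> * of_real d * cis (f t))) (at t)"
proof -
  have "((\<lambda>t. \<i> * complex_of_real (f t)) has_vector_derivative \<i> * of_real d) (at t)"
    using assms by (auto intro!: has_vector_derivative_mult_right has_vector_derivative_of_real)
  from field_vector_diff_chain_at[OF this DERIV_exp]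
  have "((\<lambda>t. exp (\<i> * of_real (f t))) has_vector_derivative (\<i> * of_real d * exp (\<i> * of_real (f t)))) (at t)"
    by (simp add: o_def)
  then show ?thesis by (simp add: cis_conv_exp mult_ac)
qed

lemma continuous_cis [continuous_intros]: "continuous_on A f \<Longrightarrow> continuous_on A (\<lambda>x. cis (f x))"
  unfolding cis_conv_exp by (intro continuous_intros)

lemma C1per_cis_phi: "C1per (\<lambda>k. cis (s * phi k)) (\<lambda>i k. \<i> * of_real (s * grad_phi k $ i) * cis (s * phi k))"
proof -
  have d: "((\<lambda>t. cis (s * phi (k + t *\<^sub>R axis i 1))) has_vector_derivative
      \<i> * of_real (s * grad_phi k $ i) * cis (s * phi k)) (at 0)" for i k
    using cis_has_vector_derivative[OF DERIV_cmult[OF phi_line_deriv[of k "axis i 1"]], of s]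
    by (simp add: inner_axis')
  have b: "\<bar>s * grad_phi k $ i\<bar> \<le> \<bar>s\<bar> * 2" for i and k :: "real ^ 'a"
    using mult_left_mono[OF abs_sin_le_one[of "k $ i"], of "\<bar>s\<bar>"] by (auto simp: grad_phi_def abs_mult)
  have "bounded (range (\<lambda>k. \<i> * of_real (s * grad_phi k $ i) * cis (s * phi k)))" for i :: 'a
    unfolding bounded_iff using b[of _ i, unfolded abs_mult]
    by (intro exI[of _ "\<bar>s\<bar> * 2"]) (auto simp: norm_mult)
  then show ?thesis unfolding C1per_def
    using d by (auto intro!: continuous_intros simp: phi_periodic bounded_iff)
qed

lemma cis_lat_periodic: "cis ((k + (2 * pi) *\<^sub>R axis i 1) \<bullet> lat x) = cis (k \<bullet> lat x)"
proof -
  have "cis (2 * pi * of_int n) = 1" for n by (simp add: cis_multiple_2pi)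
  then show ?thesis by (simp add: inner_add_left inner_axis' lat_def flip: cis_mult)
qed

lemma C1per_wave: "C1per (\<lambda>k. cis (k \<bullet> lat y)) (\<lambda>i k. \<i> * of_int (y $ i) * cis (k \<bullet> lat y))"
proof -
  have d: "((\<lambda>t. cis ((k + t *\<^sub>R axis i 1) \<bullet> lat y)) has_vector_derivative
      \<i> * of_int (y $ i) * cis (k \<bullet> lat y)) (at 0)" for i k
  proof -
    have "((\<lambda>t. (k + t *\<^sub>R axis i 1) \<bullet> lat y) has_real_derivative real_of_int (y $ i)) (at 0)"
      by (auto intro!: derivative_eq_intros simp: inner_add_left inner_axis' lat_def)
    from cis_has_vector_derivative[OF this] show ?thesis by simp
  qed
  show ?thesis unfolding C1per_def
    using d by (auto intro!: continuous_intros simp: cis_lat_periodic bounded_iff norm_mult)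
qed

lemma C1per_resolvent_grad:
  assumes z: "Im z \<noteq> 0"
  shows "\<exists>D. C1per (\<lambda>k::real^'n. inverse (of_real (grad_phi k $ i) - z)) D"
proof -
  have nz: "of_real t - z \<noteq> 0" for t using z by (metis Im_complex_of_real complex_eq_iff eq_iff_diff_eq_0 minus_complex.sel(2) zero_complex.sel(2))
  have nb: "norm (inverse (of_real t - z)) \<le> 1 / \<bar>Im z\<bar>" for t
  proof -
    have "\<bar>Im z\<bar> \<le> norm (of_real t - z)" using abs_Im_le_cmod[of "of_real t - z"] by simp
    from le_imp_inverse_le[OF this] z show ?thesis by (simp add: norm_inverse inverse_eq_divide norm_divide)
  qed
  define D where "D j k = (if j = i then - (inverse (of_real (grad_phi k $ i) - z) * of_real (- 2 * cos (k $ i)) * inverse (of_real (grad_phi k $ i) - z)) else 0)"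
    for j and k :: "real ^ 'n"
  have d: "((\<lambda>t. inverse (of_real (grad_phi (k + t *\<^sub>R axis j 1) $ i) - z)) has_vector_derivative D j k) (at 0)" for j and k :: "real ^ 'n"
  proof (cases "j = i")
    case True
    have g: "((\<lambda>t. complex_of_real (- 2 * sin (k $ i + t)) - z) has_vector_derivative of_real (- 2 * cos (k $ i))) (at 0)"
      by (auto intro!: derivative_eq_intros simp: has_real_derivative_iff_has_vector_derivative[symmetric])
    have "((\<lambda>t. inverse (complex_of_real (- 2 * sin (k $ i + t)) - z)) has_vector_derivative 
       - (inverse (of_real (- 2 * sin (k $ i)) - z) * of_real (- 2 * cos (k $ i)) * inverse (of_real (- 2 * sin (k $ i)) - z))) (at 0)"
      unfolding has_vector_derivative_def
      by (rule has_derivative_eq_rhs[OF Deriv.has_derivative_inverse[OF _ g[unfolded has_vector_derivative_def]]])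
         (use nz[of "- 2 * sin (k $ i)"] in \<open>auto simp: fun_eq_iff\<close>)
    then show ?thesis using True by (simp add: D_def grad_phi_def axis_def)
  next
    case False
    then show ?thesis by (simp add: D_def grad_phi_def axis_def)
  qed
  have cg: "continuous_on UNIV (\<lambda>k::real^'n. inverse (of_real (grad_phi k $ i) - z))"
    by (intro continuous_intros) (use nz in auto)
  have bg: "bounded (range (\<lambda>k::real^'n. inverse (of_real (grad_phi k $ i) - z)))"
    using nb by (auto simp: bounded_iff)
  have bc: "bounded (range (\<lambda>k::real^'n. complex_of_real (- 2 * cos (k $ i))))"
    unfolding bounded_iff by (intro exI[of _ 2]) (auto simp: norm_mult)
  have "continuous_on UNIV (D j)" for j
    unfolding D_def by (cases "j = i") (auto intro!: continuous_intros cg simp del: of_real_mult of_real_minus of_real_numeral)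
  moreover have "bounded (range (D j))" for j
  proof (cases "j = i")
    case True
    show ?thesis unfolding D_def using True bounded_range_mult[OF bounded_range_mult[OF bg bc] bg]
      by (auto simp: bounded_iff)
  qed (auto simp: D_def)
  ultimately show ?thesis
    using d cg bg by (intro exI[of _ D]) (auto simp: C1per_def grad_phi_periodic)
qed

section \<open>Fourier coefficients and finitely supported functions\<close>

lemma measurable_cnj [measurable]: "cnj \<in> borel_measurable borel"
  by (intro borel_measurable_continuous_onI continuous_intros)

lemma torus_measure_UNIV [simp]: "measure torus_measure UNIV = 1"
  using torus.prob_space by simp

text \<open>
  Expand the integral of \<open>\<bar>h - (\<Sum>i\<in>X. c i * e i)\<bar>\<^sup>2\<close>, where \<open>c\<close> are the coefficients of \<open>h\<close>. The inequality is
  used for plane waves on the torus and for characters in the energy variable.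
\<close>

lemma bessel_inequality:
  fixes e :: "'i \<Rightarrow> 'a \<Rightarrow> complex"
  assumes fin: "finite_measure M" and h: "h \<in> borel_measurable M" "\<And>k. norm (h k) \<le> B"
    and e: "\<And>i. e i \<in> borel_measurable M" "\<And>i k. norm (e i k) \<le> 1"
    and on: "\<And>i j. i \<in> X \<Longrightarrow> j \<in> X \<Longrightarrow> (LINT k|M. e i k * cnj (e j k)) = (if i = j then 1 else 0)"
    and X: "finite X"
  shows "(\<Sum>i\<in>X. (cmod (LINT k|M. h k * cnj (e i k)))\<^sup>2) \<le> (LINT k|M. (cmod (h k))\<^sup>2)"
proof -
  interpret finite_measure M by fact
  note [measurable] = h(1) e(1)
  have B: "0 \<le> B" using h(2) norm_ge_zero order_trans by blast
  define c where "c i = (LINT k|M. h k * cnj (e i k))" for i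
  have I1: "integrable M (\<lambda>k. h k * cnj (e i k))" for i
    by (rule integrable_const_bound[of _ B])
       (use mult_mono[OF h(2) e(2) B] in \<open>auto simp: norm_mult\<close>)
  have I2: "integrable M (\<lambda>k. e i k * cnj (e j k))" for i j
    by (rule integrable_const_bound[of _ 1])
       (use mult_mono[OF e(2) e(2)] in \<open>auto simp: norm_mult\<close>)
  have I3: "integrable M (\<lambda>k. h k * cnj (h k))"
    by (rule integrable_const_bound[of _ "B * B"])
       (use mult_mono[OF h(2) h(2) B] in \<open>auto simp: norm_mult\<close>)
  have I4: "integrable M (\<lambda>k. e i k * cnj (h k))" for i
    using integrable_cnj[OF I1[of i]] by (simp add: mult.commute)
  have e4: "(LINT k|M. e i k * cnj (h k)) = cnj (c i)" for i
  proof -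
    have "(LINT k|M. cnj (h k * cnj (e i k))) = cnj (c i)" unfolding c_def by (rule Bochner_Integration.integral_cnj)
    then show ?thesis by (simp add: mult.commute)
  qed
  define S where "S k = (\<Sum>i\<in>X. c i * e i k)" for k
  have Sh: "S k * cnj (h k) = (\<Sum>i\<in>X. c i * (e i k * cnj (h k)))" for k
    by (simp add: S_def sum_distrib_right mult.assoc)
  have hS: "h k * cnj (S k) = (\<Sum>i\<in>X. cnj (c i) * (h k * cnj (e i k)))" for k
    by (simp add: S_def sum_distrib_left mult.left_commute)
  have SS: "S k * cnj (S k) = (\<Sum>i\<in>X. \<Sum>j\<in>X. c i * cnj (c j) * (e i k * cnj (e j k)))" for k
    unfolding S_def cnj_sum sum_product by (simp add: mult_ac)
  define Q where "Q = (\<Sum>i\<in>X. c i * cnj (c i))"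
  have J1: "(LINT k|M. S k * cnj (h k)) = Q" and K1: "integrable M (\<lambda>k. S k * cnj (h k))"
    unfolding Sh by (simp_all add: Bochner_Integration.integral_sum I4 e4 Q_def)
  have J2: "(LINT k|M. h k * cnj (S k)) = Q" and K2: "integrable M (\<lambda>k. h k * cnj (S k))"
    unfolding hS by (simp_all add: Bochner_Integration.integral_sum I1 c_def[symmetric] Q_def mult.commute)
  have K3: "integrable M (\<lambda>k. S k * cnj (S k))" unfolding SS by (simp add: I2)
  have J3: "(LINT k|M. S k * cnj (S k)) = Q"
  proof -
    have "(LINT k|M. S k * cnj (S k)) = (\<Sum>i\<in>X. \<Sum>j\<in>X. c i * cnj (c j) * (if i = j then 1 else 0))"
      unfolding SS by (simp add: Bochner_Integration.integral_sum I2 on cong: sum.cong)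
    also have "\<dots> = Q" using X by (simp add: Q_def if_distrib sum.delta cong: if_cong)
    finally show ?thesis .
  qed
  have "(LINT k|M. (h k - S k) * cnj (h k - S k)) = (LINT k|M. h k * cnj (h k) - h k * cnj (S k) - S k * cnj (h k) + S k * cnj (S k))"
    by (intro Bochner_Integration.integral_cong) (auto simp: algebra_simps)
  also have "\<dots> = (LINT k|M. h k * cnj (h k)) - Q"
    by (simp add: I3 K1 K2 K3 J1 J2 J3)
  finally have eq: "(LINT k|M. (h k - S k) * cnj (h k - S k)) = (LINT k|M. h k * cnj (h k)) - Q" .
  then have "(LINT k|M. (cmod (h k - S k))\<^sup>2) = (LINT k|M. (cmod (h k))\<^sup>2) - (\<Sum>i\<in>X. (cmod (c i))\<^sup>2)"
    unfolding Q_def complex_norm_square[symmetric]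
    by (simp only: integral_complex_of_real of_real_sum[symmetric] of_real_diff[symmetric] of_real_eq_iff)
  moreover have "0 \<le> (LINT k|M. (cmod (h k - S k))\<^sup>2)" by (rule Bochner_Integration.integral_nonneg) simp
  ultimately show ?thesis by (simp add: c_def)
qed

definition fcoef :: "(real ^ 'n \<Rightarrow> complex) \<Rightarrow> int ^ 'n \<Rightarrow> complex" where
  "fcoef h x = (LINT k|torus_measure. h k * cis (- (k \<bullet> lat x)))"

definition bmeas :: "(real ^ 'n \<Rightarrow> complex) \<Rightarrow> bool" where
  "bmeas h \<longleftrightarrow> h \<in> borel_measurable borel \<and> bounded (range h)"

lemma measurable_wave [measurable]: "(\<lambda>k. cis (k \<bullet> lat y)) \<in> borel_measurable borel"
  by (intro borel_measurable_continuous_onI continuous_intros)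

lemma bmeas_mult: "bmeas h \<Longrightarrow> bmeas g \<Longrightarrow> bmeas (\<lambda>k. h k * g k)"
  unfolding bmeas_def by (auto intro: bounded_range_mult)

lemma bmeas_add: "bmeas h \<Longrightarrow> bmeas g \<Longrightarrow> bmeas (\<lambda>k. h k + g k)"
  unfolding bmeas_def by (auto intro: bounded_range_add)

lemma bmeas_const: "bmeas (\<lambda>k. c)" unfolding bmeas_def by auto

lemma bmeas_diff: "bmeas h \<Longrightarrow> bmeas g \<Longrightarrow> bmeas (\<lambda>k. h k - g k)"
  using bmeas_add[of h "\<lambda>k. - 1 * g k"] bmeas_mult[OF bmeas_const[of "-1"], of g] by simp

lemma bmeas_sum: "(\<And>y. y \<in> A \<Longrightarrow> bmeas (h y)) \<Longrightarrow> bmeas (\<lambda>k. \<Sum>y\<in>A. h y k)"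
  by (induction A rule: infinite_finite_induct) (auto intro: bmeas_const bmeas_add)

lemma bmeas_cnj: "bmeas h \<Longrightarrow> bmeas (\<lambda>k. cnj (h k))"
  unfolding bmeas_def by (auto simp: bounded_iff intro: measurable_compose[OF _ measurable_cnj])

lemma bmeas_wave: "bmeas (\<lambda>k. cis (k \<bullet> lat y))"
  unfolding bmeas_def by (auto simp: bounded_iff)

lemma C1per_bmeas: "C1per h D \<Longrightarrow> bmeas h" "C1per h D \<Longrightarrow> bmeas (D i)"
  unfolding C1per_def bmeas_def by (auto intro: borel_measurable_continuous_onI)

lemma bmeas_integrable: "bmeas h \<Longrightarrow> integrable torus_measure h"
  unfolding bmeas_def by (auto intro: integrable_torus_bounded)

lemma bmeas_wave_minus: "bmeas (\<lambda>k. cis (- (k \<bullet> lat y)))"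
  using bmeas_wave[of "- y"] by (simp add: lat_uminus)

lemma fcoef_integrable: "bmeas h \<Longrightarrow> integrable torus_measure (\<lambda>k. h k * cis (- (k \<bullet> lat x)))"
  by (intro bmeas_integrable bmeas_mult bmeas_wave_minus)

lemma fcoef_add: "bmeas h \<Longrightarrow> bmeas g \<Longrightarrow> fcoef (\<lambda>k. h k + g k) x = fcoef h x + fcoef g x"
  unfolding fcoef_def distrib_right by (intro Bochner_Integration.integral_add fcoef_integrable)

lemma fcoef_diff: "bmeas h \<Longrightarrow> bmeas g \<Longrightarrow> fcoef (\<lambda>k. h k - g k) x = fcoef h x - fcoef g x"
  unfolding fcoef_def left_diff_distrib by (intro Bochner_Integration.integral_diff fcoef_integrable)

lemma fcoef_cmult: "fcoef (\<lambda>k. c * h k) x = c * fcoef h x"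
  unfolding fcoef_def by (simp add: mult.assoc)

lemma fcoef_sum: "(\<And>y. y \<in> A \<Longrightarrow> bmeas (h y)) \<Longrightarrow> fcoef (\<lambda>k. \<Sum>y\<in>A. h y k) x = (\<Sum>y\<in>A. fcoef (h y) x)"
  unfolding fcoef_def sum_distrib_right by (intro Bochner_Integration.integral_sum fcoef_integrable)

lemma fcoef_mult_wave: "fcoef (\<lambda>k. cis (k \<bullet> lat y) * h k) x = fcoef h (x - y)"
  unfolding fcoef_def
  by (intro Bochner_Integration.integral_cong)
     (auto simp: lat_diff inner_diff_right cis_mult mult_ac simp flip: cis_divide) 

text \<open>
  Integration by parts: differentiation in \<open>k\<close> becomes multiplication by the position. All information
  on where a wave packet sits in space comes from this identity.
\<close>

lemma fcoef_deriv:
  assumes "C1per h D"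
  shows "fcoef (D i) x = \<i> * of_int (x $ i) * fcoef h x"
proof -
  have w: "C1per (\<lambda>k. cis (- (k \<bullet> lat x))) (\<lambda>i k. - \<i> * of_int (x $ i) * cis (- (k \<bullet> lat x)))"
    using C1per_wave[of "- x"] by (simp add: lat_uminus)
  note p = C1per_mult[OF assms w]
  have "(LINT k|torus_measure. D i k * cis (- (k \<bullet> lat x)) + h k * (- \<i> * of_int (x $ i) * cis (- (k \<bullet> lat x)))) = 0"
    by (rule integral_torus_deriv[where H = "\<lambda>k. h k * cis (- (k \<bullet> lat x))" and i = i]) (use p in \<open>auto simp: C1per_def\<close>)
  moreover have "integrable torus_measure (\<lambda>k. h k * (- \<i> * of_int (x $ i) * cis (- (k \<bullet> lat x))))"
    by (intro bmeas_integrable bmeas_mult bmeas_const bmeas_wave_minus C1per_bmeas[OF assms])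
  ultimately have "fcoef (D i) x + (LINT k|torus_measure. h k * (- \<i> * of_int (x $ i) * cis (- (k \<bullet> lat x)))) = 0"
    by (subst (asm) Bochner_Integration.integral_add) (auto simp: fcoef_def intro!: fcoef_integrable C1per_bmeas[OF assms])
  moreover have "(LINT k|torus_measure. h k * (- \<i> * of_int (x $ i) * cis (- (k \<bullet> lat x)))) = - \<i> * of_int (x $ i) * fcoef h x"
    unfolding fcoef_def by (subst integral_mult_right_zero[symmetric]) (simp add: mult_ac)
  ultimately show ?thesis by (simp add: eq_neg_iff_add_eq_0)
qed

lemma fcoef_one: "fcoef (\<lambda>k. 1) x = (if x = 0 then 1 else 0)"
proof (cases "x = 0")
  case True
  then show ?thesis by (simp add: fcoef_def)
next
  case False
  then obtain i where "x $ i \<noteq> 0" by (auto simp: vec_eq_iff)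
  moreover have "fcoef (\<lambda>k. 0) x = \<i> * of_int (x $ i) * fcoef (\<lambda>k. 1) x"
    by (rule fcoef_deriv[OF C1per_const])
  ultimately show ?thesis using False by (simp add: fcoef_def)
qed

lemma fcoef_wave: "fcoef (\<lambda>k. cis (k \<bullet> lat y)) x = (if x = y then 1 else 0)"
  using fcoef_mult_wave[of y "\<lambda>k. 1" x] by (simp add: fcoef_one)

lemma fcoef_bessel:
  fixes h :: "real ^ 'n \<Rightarrow> complex"
  assumes h: "bmeas h" "\<And>k. cmod (h k) \<le> B" and X: "finite X"
  shows "(\<Sum>x\<in>X. (cmod (fcoef h x))\<^sup>2) \<le> B\<^sup>2"
proof -
  have "(\<Sum>x\<in>X. (cmod (LINT k|torus_measure. h k * cnj (cis (k \<bullet> lat x))))\<^sup>2) \<le> (LINT k|torus_measure. (cmod (h k))\<^sup>2)"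
  proof (rule bessel_inequality[where B = B])
    show "(LINT k|torus_measure. cis (k \<bullet> lat i) * cnj (cis (k \<bullet> lat j))) = (if i = j then 1 else 0)" for i j :: "int ^ 'n"
      using fcoef_wave[of i j] by (simp add: fcoef_def cis_cnj eq_commute[of i j])
  qed (use h X torus.finite_measure_axioms in \<open>auto simp: bmeas_def\<close>)
  also have "\<dots> \<le> (LINT k|(torus_measure :: (real ^ 'n) measure). B\<^sup>2)"
  proof (rule Bochner_Integration.integral_mono)
    have le: "(cmod (h k))\<^sup>2 \<le> B\<^sup>2" for k using h(2) by (simp add: power_mono)
    show "integrable torus_measure (\<lambda>k. (cmod (h k))\<^sup>2)"
      using h(1) le unfolding bmeas_def
      by (intro integrable_torus_bounded) (auto simp: bounded_iff intro!: exI[of _ "B\<^sup>2"])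
    show "(cmod (h k))\<^sup>2 \<le> B\<^sup>2" for k by (rule le)
  qed simp
  also have "\<dots> = B\<^sup>2" by simp
  finally show ?thesis by (simp add: fcoef_def cis_cnj)
qed

definition fsupp :: "('a \<Rightarrow> complex) \<Rightarrow> bool" where
  "fsupp u \<longleftrightarrow> finite {y. u y \<noteq> 0}"

text \<open>
  The sign of the exponent is opposite to the one in \<open>fcoef\<close>, which makes \<open>fcoef\<close> the inverse of \<open>ft\<close>.
\<close>

definition ft :: "(int ^ 'n \<Rightarrow> complex) \<Rightarrow> real ^ 'n \<Rightarrow> complex" where
  "ft u k = (\<Sum>y | u y \<noteq> 0. u y * cis (k \<bullet> lat y))"

definition conv :: "(int ^ 'n \<Rightarrow> complex) \<Rightarrow> (int ^ 'n \<Rightarrow> complex) \<Rightarrow> int ^ 'n \<Rightarrow> complex" where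
  "conv h u x = (\<Sum>y | h y \<noteq> 0. h y * u (x - y))"

lemma ft_superset: "finite A \<Longrightarrow> {y. u y \<noteq> 0} \<subseteq> A \<Longrightarrow> ft u k = (\<Sum>y\<in>A. u y * cis (k \<bullet> lat y))"
  unfolding ft_def by (rule sum.mono_neutral_left) auto

lemma bmeas_ft: "bmeas (ft u)"
  unfolding ft_def by (intro bmeas_sum bmeas_mult bmeas_const bmeas_wave)

lemma continuous_ft: "continuous_on A (ft u)"
  unfolding ft_def by (intro continuous_intros)

lemma fcoef_ft_mult:
  assumes "bmeas H"
  shows "fcoef (\<lambda>k. ft u k * H k) x = conv u (fcoef H) x"
proof -
  have "fcoef (\<lambda>k. ft u k * H k) x = fcoef (\<lambda>k. \<Sum>y | u y \<noteq> 0. u y * (cis (k \<bullet> lat y) * H k)) x"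
    by (simp add: ft_def sum_distrib_right mult.assoc)
  also have "\<dots> = (\<Sum>y | u y \<noteq> 0. u y * fcoef H (x - y))"
    by (subst fcoef_sum) (auto simp: fcoef_cmult fcoef_mult_wave intro!: bmeas_mult bmeas_const bmeas_wave assms)
  finally show ?thesis by (simp add: conv_def)
qed

lemma fcoef_ft:
  assumes "fsupp u"
  shows "fcoef (ft u) x = u x"
proof -
  have "fcoef (\<lambda>k. ft u k * 1) x = conv u (fcoef (\<lambda>k. 1)) x" by (rule fcoef_ft_mult[OF bmeas_const])
  also have "\<dots> = (\<Sum>y | u y \<noteq> 0. if y = x then u y else 0)"
    unfolding conv_def by (intro sum.cong) (auto simp: fcoef_one)
  also have "\<dots> = u x" using assms by (simp add: fsupp_def)
  finally show ?thesis by simp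
qed

lemma ft_inject:
  assumes "fsupp u" "fsupp v" "\<And>k. ft u k = ft v k"
  shows "u = v"
proof
  fix x
  have "ft u = ft v" using assms(3) by auto
  then show "u x = v x" using fcoef_ft[OF assms(1), of x] fcoef_ft[OF assms(2), of x] by simp
qed

lemma fsupp_conv:
  assumes "fsupp u" "fsupp v"
  shows "fsupp (conv u v)"
proof -
  have "{x. conv u v x \<noteq> 0} \<subseteq> (\<lambda>(a, b). a + b) ` ({y. u y \<noteq> 0} \<times> {y. v y \<noteq> 0})"
  proof
    fix x assume "x \<in> {x. conv u v x \<noteq> 0}"
    then obtain y where "u y \<noteq> 0" "v (x - y) \<noteq> 0"
      unfolding conv_def by (metis (mono_tags, lifting) mem_Collect_eq mult_eq_0_iff sum.neutral)
    then show "x \<in> (\<lambda>(a, b). a + b) ` ({y. u y \<noteq> 0} \<times> {y. v y \<noteq> 0})"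
      by (intro image_eqI[of _ _ "(y, x - y)"]) auto
  qed
  then show ?thesis using assms unfolding fsupp_def by (meson finite_SigmaI finite_imageI finite_subset)
qed

lemma ft_conv:
  assumes "fsupp u" "fsupp v"
  shows "ft (conv u v) k = ft u k * ft v k"
proof -
  define A where "A = {y. u y \<noteq> 0}"
  define V where "V = {y. v y \<noteq> 0}"
  define S where "S = (\<lambda>(a, b). a + b) ` (A \<times> V)"
  have fin: "finite A" "finite V" "finite S" using assms by (auto simp: A_def V_def S_def fsupp_def)
  have sub: "{x. conv u v x \<noteq> 0} \<subseteq> S"
  proof
    fix x assume "x \<in> {x. conv u v x \<noteq> 0}"
    then obtain y where "u y \<noteq> 0" "v (x - y) \<noteq> 0"
      unfolding conv_def by (metis (mono_tags, lifting) mem_Collect_eq mult_eq_0_iff sum.neutral)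
    then show "x \<in> S" unfolding S_def A_def V_def
      by (intro image_eqI[of _ _ "(y, x - y)"]) auto
  qed
  have inner: "(\<Sum>x\<in>S. v (x - y) * cis (k \<bullet> lat x)) = cis (k \<bullet> lat y) * ft v k" if y: "y \<in> A" for y
  proof -
    have "(\<Sum>x\<in>S. v (x - y) * cis (k \<bullet> lat x)) = (\<Sum>x\<in>(\<lambda>z. y + z) ` V. v (x - y) * cis (k \<bullet> lat x))"
    proof (rule sum.mono_neutral_right)
      show "(\<lambda>z. y + z) ` V \<subseteq> S" using y by (auto simp: S_def)
      show "\<forall>x\<in>S - (\<lambda>z. y + z) ` V. v (x - y) * cis (k \<bullet> lat x) = 0"
      proof
        fix x assume x: "x \<in> S - (\<lambda>z. y + z) ` V"
        have "x = y + (x - y)" by simp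
        then have "x - y \<notin> V" using x by blast
        then show "v (x - y) * cis (k \<bullet> lat x) = 0" by (simp add: V_def)
      qed
    qed (rule fin)
    also have "\<dots> = (\<Sum>z\<in>V. v z * cis (k \<bullet> lat (y + z)))" by (subst sum.reindex) (auto simp: inj_on_def)
    also have "\<dots> = cis (k \<bullet> lat y) * ft v k"
      by (simp add: ft_def V_def sum_distrib_left lat_add inner_add_right mult_ac flip: cis_mult)
    finally show ?thesis .
  qed
  have "ft (conv u v) k = (\<Sum>x\<in>S. (\<Sum>y\<in>A. u y * v (x - y)) * cis (k \<bullet> lat x))"
    by (subst ft_superset[OF fin(3) sub]) (simp add: conv_def A_def)
  also have "\<dots> = (\<Sum>y\<in>A. u y * (\<Sum>x\<in>S. v (x - y) * cis (k \<bullet> lat x)))"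
    by (simp add: sum_distrib_right sum_distrib_left mult.assoc) (rule sum.swap)
  also have "\<dots> = (\<Sum>y\<in>A. u y * (cis (k \<bullet> lat y) * ft v k))" by (intro sum.cong) (auto simp: inner)
  also have "\<dots> = ft u k * ft v k" by (simp add: ft_def A_def sum_distrib_right mult.assoc)
  finally show ?thesis .
qed

lemma conv_commute: "fsupp u \<Longrightarrow> fsupp v \<Longrightarrow> conv u v = conv v u"
  by (rule ft_inject) (auto simp: fsupp_conv ft_conv mult.commute)

lemma C1per_ft: "\<exists>D. C1per (ft u) D"
proof -
  have "C1per (\<lambda>k. \<Sum>y | u y \<noteq> 0. u y * cis (k \<bullet> lat y))
     (\<lambda>i k. \<Sum>y | u y \<noteq> 0. 0 * cis (k \<bullet> lat y) + u y * (\<i> * of_int (y $ i) * cis (k \<bullet> lat y)))"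
    by (intro C1per_sum C1per_mult C1per_const C1per_wave)
  then show ?thesis unfolding ft_def[abs_def] by blast
qed

section \<open>Uniform limits of trigonometric polynomials\<close>

definition is_trig :: "(real ^ 'n \<Rightarrow> complex) \<Rightarrow> bool" where
  "is_trig h \<longleftrightarrow> (\<exists>u. fsupp u \<and> h = ft u)"

lemma is_trig_add:
  assumes "is_trig h" "is_trig g"
  shows "is_trig (\<lambda>k. h k + g k)"
proof -
  from assms obtain u v where u: "fsupp u" "h = ft u" and v: "fsupp v" "g = ft v"
    by (auto simp: is_trig_def)
  define A where "A = {y. u y \<noteq> 0} \<union> {y. v y \<noteq> 0}"
  have A: "finite A" using u v by (simp add: A_def fsupp_def)
  have "ft u k = (\<Sum>y\<in>A. u y * cis (k \<bullet> lat y))" "ft v k = (\<Sum>y\<in>A. v y * cis (k \<bullet> lat y))" 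
    "ft (\<lambda>y. u y + v y) k = (\<Sum>y\<in>A. (u y + v y) * cis (k \<bullet> lat y))" for k
    by (rule ft_superset[OF A]; auto simp: A_def)+
  then have "(\<lambda>k. h k + g k) = ft (\<lambda>y. u y + v y)"
    by (simp add: fun_eq_iff u v distrib_right sum.distrib)
  moreover have "fsupp (\<lambda>y. u y + v y)"
    unfolding fsupp_def by (rule finite_subset[OF _ A]) (auto simp: A_def)
  ultimately show ?thesis by (auto simp: is_trig_def)
qed

lemma is_trig_mult: "is_trig h \<Longrightarrow> is_trig g \<Longrightarrow> is_trig (\<lambda>k. h k * g k)"
  unfolding is_trig_def by (metis (no_types, lifting) ext fsupp_conv ft_conv)

lemma is_trig_cwave: "is_trig (\<lambda>k. c * cis (k \<bullet> lat y))"
proof -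
  have "ft (\<lambda>x. if x = y then c else 0) k = c * cis (k \<bullet> lat y)" for k
    by (subst ft_superset[of "{y}"]) auto
  moreover have "fsupp (\<lambda>x. if x = y then c else 0)" by (auto simp: fsupp_def)
  ultimately show ?thesis unfolding is_trig_def by (intro exI[of _ "\<lambda>x. if x = y then c else 0"]) auto
qed

lemma is_trig_const: "is_trig (\<lambda>k. c)"
  using is_trig_cwave[of c 0] by simp

lemma is_trig_sum: "(\<And>i. i \<in> A \<Longrightarrow> is_trig (h i)) \<Longrightarrow> is_trig (\<lambda>k. \<Sum>i\<in>A. h i k)"
  by (induction A rule: infinite_finite_induct) (auto intro: is_trig_const is_trig_add)

lemma inner_lat_axis: "k \<bullet> lat (axis i c) = k $ i * of_int c"
proof -
  have "lat (axis i c) = axis i (of_int c)" by (auto simp: lat_def axis_def vec_eq_iff)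
  then show ?thesis by (simp add: inner_axis)
qed

lemma is_trig_phi: "is_trig (\<lambda>k::real^'n. of_real (phi k))"
proof -
  have "(\<lambda>k::real^'n. complex_of_real (phi k)) = (\<lambda>k. \<Sum>i\<in>UNIV. 1 * cis (k \<bullet> lat (axis i 1)) + 1 * cis (k \<bullet> lat (axis i (-1))))"
    by (simp add: fun_eq_iff phi_def inner_lat_axis complex_eq_iff sum_distrib_left)
  then show ?thesis by (simp only:) (intro is_trig_sum is_trig_add is_trig_cwave)
qed

lemma is_trig_grad: "is_trig (\<lambda>k::real^'n. of_real (grad_phi k $ i))"
proof -
  have "(\<lambda>k::real^'n. complex_of_real (grad_phi k $ i)) = (\<lambda>k. \<i> * cis (k \<bullet> lat (axis i 1)) + (- \<i>) * cis (k \<bullet> lat (axis i (-1))))"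
    by (simp add: fun_eq_iff grad_phi_def inner_lat_axis complex_eq_iff)
  then show ?thesis by (simp only:) (intro is_trig_add is_trig_cwave)
qed

text \<open>
  Membership in the uniform closure of the trigonometric polynomials is the form in which completeness of
  the plane waves enters.
\<close>

definition unif_trig :: "(real ^ 'n \<Rightarrow> complex) \<Rightarrow> bool" where
  "unif_trig h \<longleftrightarrow> (\<forall>e>0. \<exists>u. fsupp u \<and> (\<forall>k. cmod (h k - ft u k) \<le> e))"

lemma unif_trig_trig: "is_trig h \<Longrightarrow> unif_trig h"
  unfolding is_trig_def unif_trig_def by (metis cancel_comm_monoid_add_class.diff_cancel less_imp_le norm_zero)

lemma unif_trig_ft: "fsupp u \<Longrightarrow> unif_trig (ft u)"
  by (rule unif_trig_trig) (auto simp: is_trig_def)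

lemma ft_bounded: obtains B where "B \<ge> 0" "\<And>k. cmod (ft u k) \<le> B"
proof -
  have "cmod (ft u k) \<le> (\<Sum>y | u y \<noteq> 0. cmod (u y))" for k
    unfolding ft_def by (rule order_trans[OF norm_sum]) (simp add: norm_mult)
  then show ?thesis using that[of "\<Sum>y | u y \<noteq> 0. cmod (u y)"] by (simp add: sum_nonneg)
qed

lemma unif_trig_bounded:
  assumes "unif_trig h" obtains B where "B \<ge> 0" "\<And>k. cmod (h k) \<le> B"
proof -
  obtain u where u: "fsupp u" "\<And>k. cmod (h k - ft u k) \<le> 1"
    using assms unfolding unif_trig_def by (meson zero_less_one)
  obtain B where B: "B \<ge> 0" "\<And>k. cmod (ft u k) \<le> B" using ft_bounded by blast
  have "cmod (h k) \<le> B + 1" for k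
    using u(2)[of k] B(2)[of k] norm_triangle_ineq2[of "h k" "ft u k"] by linarith
  then show ?thesis using that[of "B + 1"] B(1) by simp
qed

lemma unif_trig_mult:
  assumes "unif_trig h" "unif_trig g"
  shows "unif_trig (\<lambda>k. h k * g k)"
  unfolding unif_trig_def
proof (intro allI impI)
  fix e :: real assume e: "e > 0"
  obtain B where B: "B \<ge> 0" "\<And>k. cmod (h k) \<le> B" using unif_trig_bounded[OF assms(1)] by blast
  \<comment> \<open>\<open>g\<close> is approximated first, since the accuracy for \<open>h\<close> depends on a bound for its approximation\<close>
  define e1 where "e1 = e / (2 * (B + 1))"
  have e1: "e1 > 0" using e B by (simp add: e1_def)
  obtain v where v: "fsupp v" "\<And>k. cmod (g k - ft v k) \<le> e1"
    using assms(2) e1 unfolding unif_trig_def by meson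
  obtain C where C: "C \<ge> 0" "\<And>k. cmod (ft v k) \<le> C" using ft_bounded by blast
  define e2 where "e2 = e / (2 * (C + 1))"
  have e2: "e2 > 0" using e C by (simp add: e2_def)
  obtain u where u: "fsupp u" "\<And>k. cmod (h k - ft u k) \<le> e2"
    using assms(1) e2 unfolding unif_trig_def by meson
  have "cmod (h k * g k - ft (conv u v) k) \<le> e" for k
  proof -
    have "h k * g k - ft (conv u v) k = h k * (g k - ft v k) + (h k - ft u k) * ft v k"
      by (simp add: ft_conv u v algebra_simps)
    also have "cmod \<dots> \<le> B * e1 + e2 * C"
      by (intro norm_triangle_le add_mono) (auto simp: norm_mult intro!: mult_mono B C u v less_imp_le[OF e2])
    also have "B * e1 \<le> e / 2" using B e by (simp add: e1_def field_simps)
    also have "e2 * C \<le> e / 2" using C e by (simp add: e2_def field_simps)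
    finally show ?thesis by simp
  qed
  then show "\<exists>u. fsupp u \<and> (\<forall>k. cmod (h k * g k - ft u k) \<le> e)"
    by (intro exI[of _ "conv u v"]) (auto simp: fsupp_conv u v)
qed

lemma is_trig_polynomial:
  assumes "real_polynomial_function p" "is_trig (\<lambda>k. of_real (\<tau> k))"
  shows "is_trig (\<lambda>k. of_real (p (\<tau> k)))"
  using assms(1)
proof (induction rule: real_polynomial_function.induct)
  case (linear f)
  have "f x = x * f 1" for x
    using linear_scale[OF bounded_linear.linear[OF linear], of x 1] by simp
  then have "(\<lambda>k. complex_of_real (f (\<tau> k))) = (\<lambda>k. of_real (\<tau> k) * of_real (f 1))" by (metis of_real_mult)
  then show ?case by (simp only:) (intro is_trig_mult assms is_trig_const)
next
  case (const c)
  show ?case by (rule is_trig_const)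
next
  case (add f g)
  then show ?case by (simp add: is_trig_add)
next
  case (mult f g)
  then show ?case by (simp add: is_trig_mult)
qed

text \<open>
  The theorem of Weierstrass on an interval suffices, because all functions that occur are products
  of functions of one of the real trigonometric polynomials \<open>phi\<close> and \<open>grad_phi k $ i\<close>.
\<close>

lemma unif_trig_compose:
  fixes G :: "real \<Rightarrow> complex"
  assumes \<tau>: "is_trig (\<lambda>k. of_real (\<tau> k))" "\<And>k. \<tau> k \<in> {a..b}" and G: "continuous_on {a..b} G"
  shows "unif_trig (\<lambda>k. G (\<tau> k))"
  unfolding unif_trig_def
proof (intro allI impI)
  fix e :: real assume e: "e > 0"
  obtain g where g: "polynomial_function g" "\<And>t. t \<in> {a..b} \<Longrightarrow> cmod (G t - g t) < e"
    using Stone_Weierstrass_polynomial_function[OF compact_Icc G e] by blast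
  have rp: "real_polynomial_function (\<lambda>t. Re (g t))" "real_polynomial_function (\<lambda>t. Im (g t))"
    using g(1) bounded_linear_Re bounded_linear_Im unfolding polynomial_function_def o_def by blast+
  have "is_trig (\<lambda>k. of_real (Re (g (\<tau> k))) + \<i> * of_real (Im (g (\<tau> k))))"
    by (intro is_trig_add is_trig_mult is_trig_const is_trig_polynomial[OF rp(1) \<tau>(1)] is_trig_polynomial[OF rp(2) \<tau>(1)])
  then obtain u where u: "fsupp u" "(\<lambda>k. g (\<tau> k)) = ft u"
    unfolding is_trig_def by (auto simp: complex_eq_iff fun_eq_iff)
  have "cmod (G (\<tau> k) - ft u k) \<le> e" for k
    using g(2)[OF \<tau>(2)[of k]] fun_cong[OF u(2), of k] by simp
  then show "\<exists>u. fsupp u \<and> (\<forall>k. cmod (G (\<tau> k) - ft u k) \<le> e)" using u(1) by blast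
qed

lemma phi_range: "phi k \<in> {- 2 * real CARD('n)..2 * real CARD('n)}" for k :: "real ^ 'n"
proof -
  have "\<bar>\<Sum>i\<in>UNIV. cos (k $ i)\<bar> \<le> (\<Sum>i\<in>(UNIV::'n set). 1)"
    by (rule order_trans[OF sum_abs]) (rule sum_mono, simp)
  then show ?thesis by (simp add: phi_def abs_le_iff)
qed

lemma unif_trig_cis_phi: "unif_trig (\<lambda>k::real^'n. cis (s * phi k))"
  by (rule unif_trig_compose[OF is_trig_phi phi_range, where G = "\<lambda>t. cis (s * t)"]) (intro continuous_intros)

lemma grad_phi_range: "grad_phi k $ i \<in> {-2..2}"
  using sin_ge_minus_one[of "k $ i"] sin_le_one[of "k $ i"] unfolding grad_phi_def vec_lambda_beta atLeastAtMost_iff by linarith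

lemma unif_trig_resolvent:
  assumes "Im z \<noteq> 0"
  shows "unif_trig (\<lambda>k. inverse (of_real (grad_phi k $ i) - z))"
proof (rule unif_trig_compose[OF is_trig_grad grad_phi_range, where G = "\<lambda>t. inverse (of_real t - z)"])
  have "of_real t \<noteq> z" for t using assms by auto
  then show "continuous_on {- 2..2} (\<lambda>t. inverse (of_real t - z))" by (intro continuous_intros) simp
qed

abbreviation l2 :: "(int ^ 'n \<Rightarrow> complex) \<Rightarrow> (int ^ 'n) set \<Rightarrow> real" where
  "l2 a X \<equiv> L2_set (\<lambda>x. cmod (a x)) X"

lemma l2_cauchy_schwarz: "cmod (\<Sum>x\<in>X. a x * cnj (b x)) \<le> l2 a X * l2 b X"
proof -
  have "cmod (\<Sum>x\<in>X. a x * cnj (b x)) \<le> (\<Sum>x\<in>X. \<bar>cmod (a x)\<bar> * \<bar>cmod (b x)\<bar>)"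
    by (rule order_trans[OF norm_sum]) (simp add: norm_mult)
  also have "\<dots> \<le> l2 a X * l2 b X" by (rule L2_set_mult_ineq)
  finally show ?thesis .
qed

lemma l2_triangle: "l2 (\<lambda>x. a x + b x) X \<le> l2 a X + l2 b X"
  by (rule order_trans[OF L2_set_mono L2_set_triangle_ineq]) (auto intro: norm_triangle_ineq)

lemma l2_le:
  assumes "\<And>x. x \<in> X \<Longrightarrow> cmod (a x) \<le> r * cmod (b x)" "0 \<le> r" "l2 b X \<le> s"
  shows "l2 a X \<le> r * s"
proof -
  have "l2 a X \<le> L2_set (\<lambda>x. r * cmod (b x)) X" by (rule L2_set_mono) (auto simp: assms)
  also have "\<dots> = r * l2 b X" by (rule L2_set_right_distrib[OF assms(2), symmetric])
  also have "\<dots> \<le> r * s" by (rule mult_left_mono[OF assms(3,2)])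
  finally show ?thesis .
qed

lemma l2_fcoef:
  assumes "bmeas h" "\<And>k. cmod (h k) \<le> B" "finite X"
  shows "l2 (fcoef h) X \<le> B"
proof -
  have "0 \<le> B" using assms(2) norm_ge_zero order_trans by blast
  then show ?thesis unfolding L2_set_def
    using fcoef_bessel[OF assms] by (simp add: real_le_lsqrt sum_nonneg)
qed

text \<open>
  A quantitative form of the identity of Parseval in which only one factor has to be a uniform limit of
  trigonometric polynomials; the other one may be merely bounded and measurable. The sum over the lattice is
  split into a finite set \<open>A\<close>, on which the coefficients of \<open>B\<close> will be small, and its complement, on which
  those of \<open>h\<close> will be small.
\<close>

lemma parseval_pairing:
  fixes B :: "real ^ 'n \<Rightarrow> complex"
  assumes B: "bmeas B" "\<And>k. cmod (B k) \<le> \<beta>"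
    and h: "bmeas h" "unif_trig h" "\<And>k. cmod (h k) \<le> \<eta>"
    and A: "finite A" and S: "\<And>X. finite X \<Longrightarrow> X \<inter> A = {} \<Longrightarrow> l2 (fcoef h) X \<le> S"
  shows "cmod (LINT k|torus_measure. B k * cnj (h k)) \<le> l2 (fcoef B) A * \<eta> + \<beta> * S"
proof (rule field_le_epsilon)
  fix e :: real assume e: "e > 0"
  have \<beta>: "0 \<le> \<beta>" using B(2) norm_ge_zero order_trans by blast
  define e1 where "e1 = e / (2 * (\<beta> + 1))"
  have e1: "e1 > 0" using e \<beta> by (simp add: e1_def)
  obtain u where u: "fsupp u" "\<And>k. cmod (h k - ft u k) \<le> e1"
    using h(2) e1 unfolding unif_trig_def by meson
  define X where "X = A \<union> {y. u y \<noteq> 0}"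
  have X: "finite X" using A u by (simp add: X_def fsupp_def)
  define g where "g k = h k - ft u k" for k
  have g: "bmeas g" "\<And>k. cmod (g k) \<le> e1" unfolding g_def using h(1) u(2) by (auto intro: bmeas_diff bmeas_ft)
  have I: "integrable torus_measure (\<lambda>k. B k * cnj (f k))" if "bmeas f" for f
    by (intro bmeas_integrable bmeas_mult bmeas_cnj B that)
  have "(LINT k|torus_measure. B k * cnj (h k)) = (LINT k|torus_measure. B k * cnj (g k) + B k * cnj (ft u k))"
    by (intro Bochner_Integration.integral_cong) (auto simp: g_def algebra_simps)
  also have "\<dots> = (LINT k|torus_measure. B k * cnj (g k)) + (LINT k|torus_measure. B k * cnj (ft u k))"
    by (intro Bochner_Integration.integral_add I g bmeas_ft)
  also have "(LINT k|torus_measure. B k * cnj (ft u k)) = (\<Sum>y\<in>X. fcoef B y * cnj (u y))"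
  proof -
    have "(LINT k|torus_measure. B k * cnj (ft u k)) = (LINT k|torus_measure. (\<Sum>y\<in>X. cnj (u y) * (B k * cis (- (k \<bullet> lat y)))))"
      by (intro Bochner_Integration.integral_cong)
         (auto simp: ft_superset[OF X, of u] X_def sum_distrib_left cis_cnj mult_ac)
    also have "\<dots> = (\<Sum>y\<in>X. cnj (u y) * fcoef B y)"
      unfolding fcoef_def by (subst Bochner_Integration.integral_sum) (auto intro!: fcoef_integrable B)
    finally show ?thesis by (simp add: mult.commute)
  qed
  also have "(\<Sum>y\<in>X. fcoef B y * cnj (u y)) = (\<Sum>y\<in>A. fcoef B y * cnj (fcoef h y))
      + (\<Sum>y\<in>X - A. fcoef B y * cnj (fcoef h y)) - (\<Sum>y\<in>X. fcoef B y * cnj (fcoef g y))"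
  proof -
    have "u y = fcoef h y - fcoef g y" for y
      using fcoef_diff[OF h(1) bmeas_ft, of u y] fcoef_ft[OF u(1), of y] by (simp add: g_def[abs_def])
    moreover have "(\<Sum>y\<in>X. fcoef B y * cnj (fcoef h y)) = (\<Sum>y\<in>A. fcoef B y * cnj (fcoef h y)) + (\<Sum>y\<in>X - A. fcoef B y * cnj (fcoef h y))"
      using sum.subset_diff[of A X "\<lambda>y. fcoef B y * cnj (fcoef h y)"] X by (simp add: X_def add.commute)
    ultimately show ?thesis by (simp add: right_diff_distrib sum_subtractf)
  qed
  finally have eq: "(LINT k|torus_measure. B k * cnj (h k)) = (LINT k|torus_measure. B k * cnj (g k)) + 
     ((\<Sum>y\<in>A. fcoef B y * cnj (fcoef h y))
      + (\<Sum>y\<in>X - A. fcoef B y * cnj (fcoef h y)) - (\<Sum>y\<in>X. fcoef B y * cnj (fcoef g y)))" .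
  have b1: "cmod (LINT k|torus_measure. B k * cnj (g k)) \<le> \<beta> * e1"
  proof -
    have "cmod (LINT k|torus_measure. B k * cnj (g k)) \<le> (LINT k|(torus_measure :: (real ^ 'n) measure). \<beta> * e1)"
      by (intro integral_norm_bound[THEN order_trans] Bochner_Integration.integral_mono integrable_norm I g)
         (auto simp: norm_mult intro!: mult_mono B g \<beta>)
    then show ?thesis by simp
  qed
  have b2: "cmod (\<Sum>y\<in>A. fcoef B y * cnj (fcoef h y)) \<le> l2 (fcoef B) A * \<eta>"
    by (rule order_trans[OF l2_cauchy_schwarz]) (intro mult_left_mono l2_fcoef h A L2_set_nonneg)
  have b3: "cmod (\<Sum>y\<in>X - A. fcoef B y * cnj (fcoef h y)) \<le> \<beta> * S"
    by (rule order_trans[OF l2_cauchy_schwarz]) (intro mult_mono l2_fcoef B S L2_set_nonneg \<beta>; use X in auto)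
  have b4: "cmod (\<Sum>y\<in>X. fcoef B y * cnj (fcoef g y)) \<le> \<beta> * e1"
    by (rule order_trans[OF l2_cauchy_schwarz]) (intro mult_mono l2_fcoef B g L2_set_nonneg \<beta> X)
  have "\<beta> * e1 \<le> e / 2" using e \<beta> by (simp add: e1_def field_simps)
  moreover have "cmod (LINT k|torus_measure. B k * cnj (h k)) \<le> \<beta> * e1 + (l2 (fcoef B) A * \<eta> + \<beta> * S + \<beta> * e1)"
    unfolding eq by (intro norm_triangle_le add_mono norm_triangle_le_diff b1 b2 b3 b4)
  ultimately show "cmod (LINT k|torus_measure. B k * cnj (h k)) \<le> l2 (fcoef B) A * \<eta> + \<beta> * S + e" by linarith
qed

section \<open>Propagation of wave packets\<close>

text \<open>
  The symbol of the unitary group generated by the Laplacian, at integer times.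
\<close>

definition evol :: "nat \<Rightarrow> real ^ 'n \<Rightarrow> complex" where
  "evol n k = cis (real n * phi k)"

lemma C1per_evol: "C1per (evol n) (\<lambda>i k. \<i> * of_real (real n * grad_phi k $ i) * evol n k)"
  using C1per_cis_phi[of "real n"] by (simp add: evol_def[abs_def])

lemma bmeas_evol: "bmeas (evol n)" by (rule C1per_bmeas(1)[OF C1per_evol])

lemma norm_evol [simp]: "cmod (evol n k) = 1" by (simp add: evol_def)

text \<open>
  The functions \<open>g\<close> of the velocity for which applying \<open>g\<close> to the group velocity \<open>grad_phi k\<close> in Fourier
  space agrees with applying it to the average velocity \<open>x / n\<close> in position space, up to \<open>O(1 / n)\<close> in the
  norm of square summable functions. The class is closed under multiplication, so resolvents of coordinates
  generate as much of it as is needed, and for these one integration by parts is enough.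
\<close>

definition localizes :: "(real ^ 'n \<Rightarrow> complex) \<Rightarrow> bool" where
  "localizes g \<longleftrightarrow> (\<forall>y. cmod (g y) \<le> 1) \<and> unif_trig (\<lambda>k. g (grad_phi k)) \<and>
     (\<forall>b D. C1per b D \<longrightarrow> (\<exists>D'. C1per (\<lambda>k. g (grad_phi k) * b k) D') \<and>
       (\<exists>C\<ge>0. \<forall>n\<ge>1. \<forall>X. finite X \<longrightarrow>
          l2 (\<lambda>x. fcoef (\<lambda>k. evol n k * (g (grad_phi k) * b k)) x
                - g (lat x /\<^sub>R real n) * fcoef (\<lambda>k. evol n k * b k) x) X \<le> C / real n))"

lemma localizes_const_one: "localizes (\<lambda>y. 1)"
  unfolding localizes_def by (auto intro!: unif_trig_trig is_trig_const exI[of _ 0] simp: L2_set_def)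

lemma localizes_mult:
  assumes f: "localizes f" and g: "localizes g"
  shows "localizes (\<lambda>y. f y * g y)"
  unfolding localizes_def
proof (intro conjI allI impI)
  have f1: "cmod (f y) \<le> 1" for y using f by (simp add: localizes_def)
  have g1: "cmod (g y) \<le> 1" for y using g by (simp add: localizes_def)
  show "cmod (f y * g y) \<le> 1" for y
    using mult_mono[OF f1 g1, of y y] by (simp add: norm_mult)
  show "unif_trig (\<lambda>k. f (grad_phi k) * g (grad_phi k))"
    using f g by (intro unif_trig_mult) (auto simp: localizes_def)
  fix b :: "real ^ 'a \<Rightarrow> complex" and D assume b: "C1per b D"
  obtain D' C where D': "C1per (\<lambda>k. g (grad_phi k) * b k) D'" and C: "C \<ge> 0"
    "\<And>n X. n \<ge> 1 \<Longrightarrow> finite X \<Longrightarrow> l2 (\<lambda>x. fcoef (\<lambda>k. evol n k * (g (grad_phi k) * b k)) x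
                - g (lat x /\<^sub>R real n) * fcoef (\<lambda>k. evol n k * b k) x) X \<le> C / real n"
    using g b unfolding localizes_def by meson
  obtain D'' C' where D'': "C1per (\<lambda>k. f (grad_phi k) * (g (grad_phi k) * b k)) D''" and C': "C' \<ge> 0"
    "\<And>n X. n \<ge> 1 \<Longrightarrow> finite X \<Longrightarrow> l2 (\<lambda>x. fcoef (\<lambda>k. evol n k * (f (grad_phi k) * (g (grad_phi k) * b k))) x
                - f (lat x /\<^sub>R real n) * fcoef (\<lambda>k. evol n k * (g (grad_phi k) * b k)) x) X \<le> C' / real n"
    using f D' unfolding localizes_def by meson
  show "\<exists>D'. C1per (\<lambda>k. f (grad_phi k) * g (grad_phi k) * b k) D'"
    using D'' by (auto simp: mult.assoc)
  show "\<exists>C\<ge>0. \<forall>n\<ge>1. \<forall>X. finite X \<longrightarrow>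
          l2 (\<lambda>x. fcoef (\<lambda>k. evol n k * (f (grad_phi k) * g (grad_phi k) * b k)) x
                - f (lat x /\<^sub>R real n) * g (lat x /\<^sub>R real n) * fcoef (\<lambda>k. evol n k * b k) x) X \<le> C / real n"
  proof (intro exI[of _ "C' + C"] conjI allI impI)
    fix n :: nat and X :: "(int ^ 'a) set" assume n: "n \<ge> 1" and X: "finite X"
    let ?u = "\<lambda>x. fcoef (\<lambda>k. evol n k * (f (grad_phi k) * (g (grad_phi k) * b k))) x"
    let ?v = "\<lambda>x. fcoef (\<lambda>k. evol n k * (g (grad_phi k) * b k)) x"
    let ?w = "\<lambda>x. fcoef (\<lambda>k. evol n k * b k) x"
    have "l2 (\<lambda>x. (?u x - f (lat x /\<^sub>R real n) * ?v x) + f (lat x /\<^sub>R real n) * (?v x - g (lat x /\<^sub>R real n) * ?w x)) X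
      \<le> C' / real n + 1 * (C / real n)"
      by (intro order_trans[OF l2_triangle] add_mono C'(2) n X
           l2_le[where b = "\<lambda>x. ?v x - g (lat x /\<^sub>R real n) * ?w x"] C(2))
         (auto simp: norm_mult intro!: mult_right_mono[OF f1, of _ , simplified])
    then show "l2 (\<lambda>x. fcoef (\<lambda>k. evol n k * (f (grad_phi k) * g (grad_phi k) * b k)) x
                - f (lat x /\<^sub>R real n) * g (lat x /\<^sub>R real n) * ?w x) X \<le> (C' + C) / real n"
      by (simp add: algebra_simps add_divide_distrib)
  qed (use C C' in auto)
qed

lemma norm_inverse_le_one:
  assumes "\<bar>Im z\<bar> = 1"
  shows "cmod (inverse (of_real t - z)) \<le> 1"
proof -
  have "1 \<le> cmod (of_real t - z)" using abs_Im_le_cmod[of "of_real t - z"] assms by simp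
  then show ?thesis by (simp add: norm_inverse inverse_le_1_iff)
qed

text \<open>
  Put \<open>h = b / (grad_phi k $ i - z)\<close>. Integration by parts turns \<open>x $ i / n - z\<close>, acting on the
  coefficients of \<open>evol n * h\<close>, into \<open>grad_phi k $ i - z\<close> acting on \<open>h\<close>, that is into \<open>b\<close>, plus the
  derivative of \<open>h\<close> divided by \<open>n\<close>. Dividing by \<open>x $ i / n - z\<close> loses nothing, because its modulus
  is at least \<open>\<bar>Im z\<bar> = 1\<close>.
\<close>

lemma localizes_resolvent:
  assumes z: "\<bar>Im z\<bar> = 1"
  shows "localizes (\<lambda>y :: real ^ 'n. inverse (of_real (y $ i) - z))"
  unfolding localizes_def
proof (intro conjI allI impI)
  show "cmod (inverse (of_real (y $ i) - z)) \<le> 1" for y :: "real ^ 'n"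
    by (rule norm_inverse_le_one[OF z])
  have z0: "Im z \<noteq> 0" using z by auto
  have nz: "of_real t - z \<noteq> 0" for t using z0 by auto
  show "unif_trig (\<lambda>k :: real ^ 'n. inverse (of_real (grad_phi k $ i) - z))"
    by (rule unif_trig_resolvent[OF z0])
  fix b :: "real ^ 'n \<Rightarrow> complex" and D assume b: "C1per b D"
  obtain E where E: "C1per (\<lambda>k::real^'n. inverse (of_real (grad_phi k $ i) - z)) E"
    using C1per_resolvent_grad[OF z0] by blast
  define h where "h k = inverse (of_real (grad_phi k $ i) - z) * b k" for k
  obtain H where H: "C1per h H" unfolding h_def using C1per_mult[OF E b] by blast
  show "\<exists>D'. C1per (\<lambda>k. inverse (of_real (grad_phi k $ i) - z) * b k) D'"
    using H unfolding h_def by blast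
  obtain C where C: "\<And>k. cmod (H i k) \<le> C" using H unfolding C1per_def bounded_iff by blast
  then have C0: "C \<ge> 0" using norm_ge_zero order_trans by blast
  have bh: "b k = of_real (grad_phi k $ i) * h k - z * h k" for k
  proof -
    have "b k = (of_real (grad_phi k $ i) - z) * h k"
      using nz[of "grad_phi k $ i"] by (simp add: h_def mult.assoc[symmetric])
    then show ?thesis by (simp add: left_diff_distrib)
  qed
  have bm: "bmeas b" "bmeas h" "bmeas (H i)" by (rule C1per_bmeas[OF b] C1per_bmeas[OF H])+
  show "\<exists>C\<ge>0. \<forall>n\<ge>1. \<forall>X. finite X \<longrightarrow>
      l2 (\<lambda>x. fcoef (\<lambda>k. evol n k * (inverse (of_real (grad_phi k $ i) - z) * b k)) x
         - inverse (of_real ((lat x /\<^sub>R real n) $ i) - z) * fcoef (\<lambda>k. evol n k * b k) x) X \<le> C / real n"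
  proof (intro exI[of _ C] conjI C0 allI impI)
    fix n :: nat and X :: "(int ^ 'n) set" assume n: "n \<ge> 1" and X: "finite X"
    have key: "fcoef (\<lambda>k. evol n k * h k) x - inverse (of_real ((lat x /\<^sub>R real n) $ i) - z) * fcoef (\<lambda>k. evol n k * b k) x
       = - (\<i> / real n) * inverse (of_real ((lat x /\<^sub>R real n) $ i) - z) * fcoef (\<lambda>k. evol n k * H i k) x" for x
    proof -
      define p where "p = fcoef (\<lambda>k. evol n k * h k) x"
      define q where "q = fcoef (\<lambda>k. evol n k * b k) x"
      define r where "r = fcoef (\<lambda>k. evol n k * H i k) x"
      have "\<i> * of_int (x $ i) * p = fcoef (\<lambda>k. \<i> * of_real (real n * grad_phi k $ i) * evol n k * h k + evol n k * H i k) x"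
        unfolding p_def by (rule fcoef_deriv[OF C1per_mult[OF C1per_evol H], symmetric])
      also have "(\<lambda>k. \<i> * of_real (real n * grad_phi k $ i) * evol n k * h k + evol n k * H i k)
        = (\<lambda>k. (\<i> * of_nat n) * (evol n k * b k) + ((\<i> * of_nat n * z) * (evol n k * h k) + evol n k * H i k))"
        by (simp add: fun_eq_iff bh algebra_simps)
      also have "fcoef \<dots> x = (\<i> * of_nat n) * q + ((\<i> * of_nat n * z) * p + r)"
        unfolding p_def q_def r_def
        by (subst fcoef_add fcoef_cmult | intro bmeas_mult bmeas_add bmeas_const bmeas_evol bm)+ simp
      finally have e: "\<i> * of_int (x $ i) * p = (\<i> * of_nat n) * q + ((\<i> * of_nat n * z) * p + r)" .
      define t where "t = complex_of_real ((lat x /\<^sub>R real n) $ i) - z"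
      have t0: "t \<noteq> 0" unfolding t_def by (rule nz)
      have n0: "complex_of_nat n \<noteq> 0" using n by simp
      have t: "of_nat n * t = of_int (x $ i) - of_nat n * z"
        using n by (simp add: t_def lat_def right_diff_distrib)
      have "\<i> * (of_nat n * t * p) = \<i> * of_nat n * q + r"
        unfolding t using e by (simp add: algebra_simps)
      then have "of_nat n * t * p = of_nat n * q - \<i> * r"
        by (metis (no_types, lifting) add_diff_cancel_left' complex_i_mult_minus diff_minus_eq_add mult.assoc mult_minus_right right_diff_distrib uminus_add_conv_diff add.commute)
      then have "p = inverse t * q - (\<i> / of_nat n) * inverse t * r"
        using t0 n0 by (simp add: field_simps)
      then show ?thesis unfolding p_def q_def r_def t_def by simp
    qed
    have "l2 (\<lambda>x. - (\<i> / real n) * inverse (of_real ((lat x /\<^sub>R real n) $ i) - z) * fcoef (\<lambda>k. evol n k * H i k) x) X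
       \<le> (1 / real n) * C"
    proof (rule l2_le)
      show "l2 (fcoef (\<lambda>k. evol n k * H i k)) X \<le> C"
        by (rule l2_fcoef) (auto simp: norm_mult C intro!: bmeas_mult bmeas_evol bm X)
      fix x :: "int ^ 'n"
      have "cmod (- (\<i> / real n) * inverse (of_real ((lat x /\<^sub>R real n) $ i) - z) * fcoef (\<lambda>k. evol n k * H i k) x)
        = (1 / real n * cmod (inverse (of_real ((lat x /\<^sub>R real n) $ i) - z))) * cmod (fcoef (\<lambda>k. evol n k * H i k) x)"
        by (simp add: norm_mult norm_divide)
      also have "\<dots> \<le> (1 / real n * 1) * cmod (fcoef (\<lambda>k. evol n k * H i k) x)"
        by (intro mult_right_mono mult_left_mono norm_inverse_le_one[OF z]) auto
      finally show "cmod (- (\<i> / real n) * inverse (of_real ((lat x /\<^sub>R real n) $ i) - z) * fcoef (\<lambda>k. evol n k * H i k) x)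
        \<le> 1 / real n * cmod (fcoef (\<lambda>k. evol n k * H i k) x)" by simp
    qed simp
    then show "l2 (\<lambda>x. fcoef (\<lambda>k. evol n k * (inverse (of_real (grad_phi k $ i) - z) * b k)) x
         - inverse (of_real ((lat x /\<^sub>R real n) $ i) - z) * fcoef (\<lambda>k. evol n k * b k) x) X \<le> C / real n"
      using key unfolding h_def by simp
  qed
qed

text \<open>
  A function that equals \<open>1\<close> at \<open>v\<close> and is smaller elsewhere, of the kind that products of resolvents of
  coordinates can produce: \<open>1 / (1 + t\<^sup>2) = 1 / ((t - \<i>) * (t + \<i>))\<close>. Its powers concentrate at \<open>v\<close>.
\<close>

definition bump :: "real ^ 'n \<Rightarrow> real ^ 'n \<Rightarrow> real" where
  "bump v y = (\<Prod>i\<in>UNIV. inverse (1 + (y $ i - v $ i)\<^sup>2))"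

lemma bump_pos: "0 < bump v y" and bump_le_one: "bump v y \<le> 1"
proof -
  show "0 < bump v y" unfolding bump_def by (intro prod_pos) (auto intro: add_pos_nonneg)
  show "bump v y \<le> 1" unfolding bump_def
    by (intro prod_le_1) (auto intro!: inverse_le_1_iff[THEN iffD2])
qed

lemma bump_upper: "bump v y \<le> inverse (1 + (dist y v)\<^sup>2)"
proof -
  have "1 + (\<Sum>i\<in>A. (y $ i - v $ i)\<^sup>2) \<le> (\<Prod>i\<in>A. 1 + (y $ i - v $ i)\<^sup>2)" for A
  proof (induction A rule: infinite_finite_induct)
    case (insert i A)
    let ?a = "(y $ i - v $ i)\<^sup>2" and ?s = "\<Sum>i\<in>A. (y $ i - v $ i)\<^sup>2"
    have "1 + (?a + ?s) \<le> (1 + ?a) * (1 + ?s)" by (simp add: algebra_simps sum_nonneg)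
    also have "\<dots> \<le> (1 + ?a) * (\<Prod>i\<in>A. 1 + (y $ i - v $ i)\<^sup>2)"
      by (rule mult_left_mono[OF insert.IH]) simp
    finally show ?case using insert by simp
  qed auto
  moreover have "(dist y v)\<^sup>2 = (\<Sum>i\<in>UNIV. (y $ i - v $ i)\<^sup>2)"
    unfolding dist_norm power2_norm_eq_inner by (simp add: inner_vec_def power2_eq_square)
  ultimately have "1 + (dist y v)\<^sup>2 \<le> (\<Prod>i\<in>UNIV. 1 + (y $ i - v $ i)\<^sup>2)" by metis
  then have "inverse (\<Prod>i\<in>UNIV. 1 + (y $ i - v $ i)\<^sup>2) \<le> inverse (1 + (dist y v)\<^sup>2)"
    by (intro le_imp_inverse_le) (auto intro: add_pos_nonneg)
  then show ?thesis by (simp add: bump_def prod_inversef[symmetric])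
qed

lemma continuous_bump [continuous_intros]:
  "continuous_on A f \<Longrightarrow> continuous_on A (\<lambda>x. bump v (f x))"
  unfolding bump_def
  by (intro continuous_intros) (auto simp: add_nonneg_eq_0_iff)

lemma localizes_bump: "localizes (\<lambda>y. of_real (bump v y ^ m))"
proof -
  have f: "complex_of_real (inverse (1 + (y $ i - v $ i)\<^sup>2))
     = inverse (of_real (y $ i) - Complex (v $ i) 1) * inverse (of_real (y $ i) - Complex (v $ i) (-1))" for y i
  proof -
    have "(complex_of_real (y $ i) - Complex (v $ i) 1) * (of_real (y $ i) - Complex (v $ i) (-1)) = of_real (1 + (y $ i - v $ i)\<^sup>2)"
      by (simp add: complex_eq_iff power2_eq_square algebra_simps)
    then show ?thesis by (metis inverse_mult_distrib of_real_inverse)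
  qed
  have "localizes (\<lambda>y. complex_of_real (inverse (1 + (y $ i - v $ i)\<^sup>2)))" for i
    unfolding f by (intro localizes_mult localizes_resolvent) simp_all
  then have "localizes (\<lambda>y. \<Prod>i\<in>A. complex_of_real (inverse (1 + (y $ i - v $ i)\<^sup>2)))" for A
    by (induction A rule: infinite_finite_induct) (auto intro: localizes_const_one localizes_mult)
  then have b: "localizes (\<lambda>y. of_real (bump v y))" by (simp add: bump_def)
  show ?thesis
    by (induction m) (auto intro: localizes_const_one localizes_mult b)
qed

text \<open>
  Pair \<open>B\<close> with the part of \<open>ft F\<close> whose velocity is close to \<open>v\<close>. The pairing does not change when both
  functions evolve, and at time \<open>n\<close> the second one is concentrated where \<open>x / n\<close> is close to \<open>v\<close>. So the
  pairing is bounded by the mass of \<open>B\<close> at time \<open>n\<close> in this region, up to errors that are small for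
  large \<open>m\<close> and \<open>n\<close>.
\<close>

theorem propagation:
  fixes B :: "real ^ 'n \<Rightarrow> complex"
  assumes F: "fsupp F" "\<And>k. cmod (ft F k) \<le> \<eta>" and B: "bmeas B" "\<And>k. cmod (B k) \<le> \<beta>" and \<delta>: "\<delta> > 0"
  shows "\<exists>C\<ge>0. \<forall>n\<ge>1. \<forall>A. finite A \<longrightarrow> (\<forall>x. x \<notin> A \<longrightarrow> \<delta> \<le> dist (lat x /\<^sub>R real n) v) \<longrightarrow>
     cmod (LINT k|torus_measure. B k * cnj (of_real (bump v (grad_phi k) ^ m) * ft F k))
       \<le> l2 (fcoef (\<lambda>k. evol n k * B k)) A * \<eta> + \<beta> * (inverse (1 + \<delta>\<^sup>2) ^ m * \<eta> + C / real n)"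
proof -
  define b where "b = ft F"
  define w where "w k = complex_of_real (bump v (grad_phi k) ^ m) * b k" for k
  have \<eta>: "\<eta> \<ge> 0" using F(2) norm_ge_zero order_trans by blast
  obtain D where D: "C1per b D" unfolding b_def using C1per_ft by blast
  obtain D' C where D': "C1per w D'" and C: "C \<ge> 0"
    "\<And>n X. n \<ge> 1 \<Longrightarrow> finite X \<Longrightarrow> l2 (\<lambda>x. fcoef (\<lambda>k. evol n k * w k) x
                - of_real (bump v (lat x /\<^sub>R real n) ^ m) * fcoef (\<lambda>k. evol n k * b k) x) X \<le> C / real n"
    and uw: "unif_trig (\<lambda>k. complex_of_real (bump v (grad_phi k) ^ m))"
    using localizes_bump[of v m] D unfolding localizes_def w_def by meson
  have wb: "cmod (w k) \<le> \<eta>" for k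
  proof -
    have "cmod (w k) = bump v (grad_phi k) ^ m * cmod (b k)"
      using bump_pos[of v "grad_phi k"] by (simp add: w_def norm_mult norm_power)
    also have "\<dots> \<le> 1 * \<eta>"
      using bump_pos[of v "grad_phi k"] bump_le_one[of v "grad_phi k"] F(2)[of k]
      by (intro mult_mono power_le_one) (auto simp: b_def)
    finally show ?thesis by simp
  qed
  show ?thesis
  proof (intro exI[of _ C] conjI C(1) allI impI)
    fix n :: nat and A :: "(int ^ 'n) set"
    assume n: "1 \<le> n" and A: "finite A" "\<forall>x. x \<notin> A \<longrightarrow> \<delta> \<le> dist (lat x /\<^sub>R real n) v"
    have "cmod (LINT k|torus_measure. (evol n k * B k) * cnj (evol n k * w k))
       \<le> l2 (fcoef (\<lambda>k. evol n k * B k)) A * \<eta> + \<beta> * (inverse (1 + \<delta>\<^sup>2) ^ m * \<eta> + C / real n)"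
    proof (rule parseval_pairing)
      show "unif_trig (\<lambda>k. evol n k * w k)"
        unfolding w_def evol_def b_def by (intro unif_trig_mult unif_trig_cis_phi unif_trig_ft F uw)
      show "bmeas (\<lambda>k. evol n k * w k)" "bmeas (\<lambda>k. evol n k * B k)"
        by (intro bmeas_mult bmeas_evol C1per_bmeas(1)[OF D'] B)+
      fix X :: "(int ^ 'n) set" assume X: "finite X" "X \<inter> A = {}"
      have "l2 (fcoef (\<lambda>k. evol n k * w k)) X =
         l2 (\<lambda>x. of_real (bump v (lat x /\<^sub>R real n) ^ m) * fcoef (\<lambda>k. evol n k * b k) x
           + (fcoef (\<lambda>k. evol n k * w k) x - of_real (bump v (lat x /\<^sub>R real n) ^ m) * fcoef (\<lambda>k. evol n k * b k) x)) X"
        by simp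
      also have "\<dots> \<le> inverse (1 + \<delta>\<^sup>2) ^ m * \<eta> + C / real n"
      proof (intro order_trans[OF l2_triangle] add_mono C(2) n X(1) l2_le)
        show "l2 (fcoef (\<lambda>k. evol n k * b k)) X \<le> \<eta>"
          by (rule l2_fcoef) (auto simp: norm_mult F b_def X intro!: bmeas_mult bmeas_evol bmeas_ft)
        fix x assume "x \<in> X"
        then have d: "\<delta> \<le> dist (lat x /\<^sub>R real n) v" using A X by blast
        have "bump v (lat x /\<^sub>R real n) \<le> inverse (1 + \<delta>\<^sup>2)"
          by (rule order_trans[OF bump_upper], rule le_imp_inverse_le)
             (use d \<delta> in \<open>auto intro!: power_mono add_pos_nonneg\<close>)
        then have "bump v (lat x /\<^sub>R real n) ^ m \<le> inverse (1 + \<delta>\<^sup>2) ^ m"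
          using bump_pos less_imp_le by (intro power_mono) blast+
        then show "cmod (of_real (bump v (lat x /\<^sub>R real n) ^ m) * fcoef (\<lambda>k. evol n k * b k) x)
          \<le> inverse (1 + \<delta>\<^sup>2) ^ m * cmod (fcoef (\<lambda>k. evol n k * b k) x)"
          using bump_pos[of v "lat x /\<^sub>R real n"] by (simp add: norm_mult norm_power mult_right_mono)
      qed simp
      finally show "l2 (fcoef (\<lambda>k. evol n k * w k)) X \<le> inverse (1 + \<delta>\<^sup>2) ^ m * \<eta> + C / real n" .
    qed (auto simp: norm_mult A B wb)
    moreover have "(evol n k * B k) * cnj (evol n k * w k) = B k * cnj (w k)" for k
    proof -
      have "evol n k * cnj (evol n k) = 1" by (simp add: evol_def cis_cnj cis_mult)
      then have "(evol n k * cnj (evol n k)) * (B k * cnj (w k)) = B k * cnj (w k)" by simp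
      then show ?thesis by (simp add: mult_ac)
    qed
    ultimately have "cmod (LINT k|torus_measure. B k * cnj (w k))
       \<le> l2 (fcoef (\<lambda>k. evol n k * B k)) A * \<eta> + \<beta> * (inverse (1 + \<delta>\<^sup>2) ^ m * \<eta> + C / real n)"
      by (simp only:)
    then show "cmod (LINT k|torus_measure. B k * cnj (of_real (bump v (grad_phi k) ^ m) * ft F k))
       \<le> l2 (fcoef (\<lambda>k. evol n k * B k)) A * \<eta> + \<beta> * (inverse (1 + \<delta>\<^sup>2) ^ m * \<eta> + C / real n)"
      unfolding w_def b_def .
  qed
qed

section \<open>The resolvent\<close>

lemma unit_lattice_points:
  "{z :: int ^ 'n. norm (lat z) = 1} = range (\<lambda>i. axis i 1) \<union> range (\<lambda>i. axis i (-1))"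
proof (intro equalityI subsetI)
  fix z :: "int ^ 'n" assume "z \<in> {z. norm (lat z) = 1}"
  then have "(norm (lat z))\<^sup>2 = 1" by simp
  then have "real_of_int (\<Sum>i\<in>UNIV. (z $ i)\<^sup>2) = 1"
    unfolding power2_norm_eq_inner by (simp add: inner_vec_def lat_def power2_eq_square)
  then have s: "(\<Sum>i\<in>UNIV. (z $ i)\<^sup>2) = 1" by linarith
  then obtain i where i: "z $ i \<noteq> 0" by (metis (no_types, lifting) power_zero_numeral sum.neutral zero_neq_one)
  have "(\<Sum>j\<in>UNIV. (z $ j)\<^sup>2) = (z $ i)\<^sup>2 + (\<Sum>j\<in>UNIV - {i}. (z $ j)\<^sup>2)" by (simp add: sum.remove[of UNIV i])
  moreover have "(z $ i)\<^sup>2 \<ge> 1" using i by (metis int_one_le_iff_zero_less zero_less_power2)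
  moreover have "(\<Sum>j\<in>UNIV - {i}. (z $ j)\<^sup>2) \<ge> 0" by (simp add: sum_nonneg)
  ultimately have a: "(z $ i)\<^sup>2 = 1" "(\<Sum>j\<in>UNIV - {i}. (z $ j)\<^sup>2) = 0" using s by auto
  then have "z $ j = 0" if "j \<noteq> i" for j using that by (auto simp: sum_nonneg_eq_0_iff)
  moreover have "z $ i = 1 \<or> z $ i = -1" using a(1) by (simp add: power2_eq_1_iff)
  ultimately have "z = axis i 1 \<or> z = axis i (-1)" by (auto simp: vec_eq_iff axis_def)
  then show "z \<in> range (\<lambda>i. axis i 1) \<union> range (\<lambda>i. axis i (-1))" by auto
next
  have l: "lat (axis i c) = axis i (of_int c)" for i :: 'n and c by (auto simp: lat_def axis_def vec_eq_iff)
  fix z :: "int ^ 'n" assume "z \<in> range (\<lambda>i. axis i 1) \<union> range (\<lambda>i. axis i (-1))"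
  then show "z \<in> {z. norm (lat z) = 1}" by (auto simp: l norm_eq_sqrt_inner inner_axis)
qed

lemma laplacian_eq:
  "laplacian u x = (\<Sum>i\<in>UNIV. u (x + axis i 1) + u (x + axis i (-1)))"
proof -
  have "laplacian u x = (\<Sum>z | norm (lat z) = 1. u (x + z))"
    unfolding laplacian_def
    by (rule sum.reindex_bij_witness[of _ "\<lambda>z. x + z" "\<lambda>y. y - x"]) auto
  also have "\<dots> = (\<Sum>z\<in>range (\<lambda>i. axis i 1). u (x + z)) + (\<Sum>z\<in>range (\<lambda>i. axis i (-1)). u (x + z))"
    unfolding unit_lattice_points
    by (rule sum.union_disjoint) (auto simp: axis_eq_axis)
  also have "\<dots> = (\<Sum>i\<in>UNIV. u (x + axis i 1)) + (\<Sum>i\<in>UNIV. u (x + axis i (-1)))"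
    by (subst (1 2) sum.reindex) (auto simp: inj_on_def axis_eq_axis)
  finally show ?thesis by (simp add: sum.distrib)
qed

lemma laplacian_fcoef:
  assumes "bmeas h"
  shows "laplacian (fcoef h) x = fcoef (\<lambda>k. of_real (phi k) * h k) x"
proof -
  have s: "fcoef h (x + y) = fcoef (\<lambda>k. cis (k \<bullet> lat (- y)) * h k) x" for y
    using fcoef_mult_wave[of "- y" h x] by simp
  have ax: "- axis i c = axis i (- c)" for i :: 'a and c :: int by (simp add: axis_def vec_eq_iff)
  have p: "complex_of_real (phi k) = (\<Sum>i\<in>UNIV. cis (k \<bullet> lat (- axis i 1)) + cis (k \<bullet> lat (- axis i (-1))))" for k :: "real ^ 'a"
    unfolding ax inner_lat_axis by (simp add: phi_def complex_eq_iff sum_distrib_left)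
  have "fcoef (\<lambda>k. of_real (phi k) * h k) x
     = fcoef (\<lambda>k. \<Sum>i\<in>UNIV. cis (k \<bullet> lat (- axis i 1)) * h k + cis (k \<bullet> lat (- axis i (-1))) * h k) x"
    by (simp only: p sum_distrib_right distrib_right)
  also have "\<dots> = laplacian (fcoef h) x"
    by (simp only: fcoef_sum fcoef_add bmeas_add bmeas_mult bmeas_wave assms laplacian_eq s)
  finally show ?thesis by simp
qed

lemma fcoef_ell2:
  assumes "bmeas h"
  shows "fcoef h \<in> ell2"
proof -
  obtain B where B: "\<And>k. cmod (h k) \<le> B" using assms by (auto simp: bmeas_def bounded_iff)
  have "eventually (\<lambda>X. sum (\<lambda>x. (cmod (fcoef h x))\<^sup>2) X \<le> B\<^sup>2) (finite_subsets_at_top UNIV)"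
    by (rule eventually_finite_subsets_at_top_weakI) (auto intro: fcoef_bessel assms B)
  then show ?thesis unfolding ell2_def
    by (auto intro: nonneg_bounded_partial_sums_imp_summable_on[of _ _ "B\<^sup>2"])
qed

lemma ell2_diff:
  assumes "u \<in> ell2" "v \<in> ell2"
  shows "(\<lambda>x. u x - v x) \<in> ell2"
proof -
  have le: "(cmod (u x - v x))\<^sup>2 \<le> 2 * (cmod (u x))\<^sup>2 + 2 * (cmod (v x))\<^sup>2" for x
  proof -
    have "(cmod (u x - v x))\<^sup>2 \<le> (cmod (u x) + cmod (v x))\<^sup>2"
      by (intro power_mono norm_triangle_ineq4) simp
    also have "\<dots> \<le> 2 * (cmod (u x))\<^sup>2 + 2 * (cmod (v x))\<^sup>2"
      using sum_squares_bound[of "cmod (u x)" "cmod (v x)"] by (simp add: power2_sum)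
    finally show ?thesis .
  qed
  have "(\<lambda>x. 2 * (cmod (u x))\<^sup>2 + 2 * (cmod (v x))\<^sup>2) summable_on UNIV"
    using assms unfolding ell2_def by (intro summable_on_add summable_on_cmult_right) auto
  then show ?thesis unfolding ell2_def mem_Collect_eq
    by (rule summable_on_comparison_test) (use le in auto)
qed

text \<open>
  The Laplacian is symmetric: the correlations \<open>\<Sum>x. cnj (u x) * u (x + y)\<close> for \<open>y\<close> and \<open>- y\<close> are conjugate,
  so the quadratic form of the Laplacian is real, and \<open>\<nu>\<close> times the square of the norm is real.
\<close>

lemma ell2_eigen_zero:
  fixes u :: "int ^ 'n \<Rightarrow> complex"
  assumes u: "u \<in> ell2" and eq: "\<And>x. laplacian u x = \<nu> * u x" and \<nu>: "Im \<nu> \<noteq> 0"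
  shows "u x = 0"
proof -
  have sq: "(\<lambda>x. (cmod (u x))\<^sup>2) summable_on UNIV" using u by (simp add: ell2_def)
  have bij: "bij (\<lambda>x :: int ^ 'n. x + y)" for y
    by (rule bij_betw_byWitness[where f' = "\<lambda>x. x - y"]) auto
  have sqs: "(\<lambda>x. (cmod (u (x + y)))\<^sup>2) summable_on UNIV" for y
    using summable_on_reindex_bij_betw[OF bij, of "\<lambda>x. (cmod (u x))\<^sup>2" y] sq by simp
  have sm: "(\<lambda>x. cnj (u x) * u (x + y)) summable_on UNIV" for y
  proof (rule Infinite_Sum.abs_summable_summable, rule Infinite_Sum.abs_summable_on_comparison_test')
    show "(\<lambda>x. (cmod (u x))\<^sup>2 + (cmod (u (x + y)))\<^sup>2) summable_on UNIV"
      by (intro summable_on_add sq sqs)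
    show "cmod (cnj (u x) * u (x + y)) \<le> (cmod (u x))\<^sup>2 + (cmod (u (x + y)))\<^sup>2" for x
    proof -
      have "0 \<le> cmod (u x) * cmod (u (x + y))" by simp
      moreover have "2 * cmod (u x) * cmod (u (x + y)) \<le> (cmod (u x))\<^sup>2 + (cmod (u (x + y)))\<^sup>2"
        by (rule sum_squares_bound)
      ultimately show ?thesis unfolding norm_mult complex_mod_cnj mult.assoc by linarith
    qed
  qed
  define S where "S y = (\<Sum>\<^sub>\<infinity>x. cnj (u x) * u (x + y))" for y
  have Sc: "cnj (S y) = S (- y)" for y
  proof -
    have "cnj (S y) = (\<Sum>\<^sub>\<infinity>x. u x * cnj (u (x + y)))"
      unfolding S_def by (subst infsum_cnj[symmetric]) simp
    also have "\<dots> = (\<Sum>\<^sub>\<infinity>x. (\<lambda>x. cnj (u x) * u (x + - y)) (x + y))"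
      by (intro infsum_cong) (simp add: mult.commute)
    also have "\<dots> = S (- y)" unfolding S_def by (rule infsum_reindex_bij_betw[OF bij])
    finally show ?thesis .
  qed
  have sm0: "(\<lambda>x. cnj (u x) * u x) summable_on UNIV" using sm[of 0] by simp
  have "\<nu> * (\<Sum>\<^sub>\<infinity>x. cnj (u x) * u x) = (\<Sum>\<^sub>\<infinity>x. \<nu> * (cnj (u x) * u x))"
    by (rule infsum_cmult_right'[symmetric])
  also have "\<dots> = (\<Sum>\<^sub>\<infinity>x. \<Sum>i\<in>UNIV. cnj (u x) * u (x + axis i 1) + cnj (u x) * u (x + axis i (-1)))"
  proof (intro infsum_cong)
    fix x
    have "\<nu> * (cnj (u x) * u x) = cnj (u x) * laplacian u x" using eq[of x] by (simp add: mult_ac)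
    then show "\<nu> * (cnj (u x) * u x) = (\<Sum>i\<in>UNIV. cnj (u x) * u (x + axis i 1) + cnj (u x) * u (x + axis i (-1)))"
      by (simp add: laplacian_eq sum_distrib_left distrib_left)
  qed
  also have "\<dots> = (\<Sum>i\<in>UNIV. S (axis i 1) + S (axis i (-1)))"
  proof -
    have "(\<lambda>x. \<Sum>i\<in>A. cnj (u x) * u (x + axis i 1) + cnj (u x) * u (x + axis i (-1))) summable_on UNIV \<and>
      (\<Sum>\<^sub>\<infinity>x. \<Sum>i\<in>A. cnj (u x) * u (x + axis i 1) + cnj (u x) * u (x + axis i (-1))) = (\<Sum>i\<in>A. S (axis i 1) + S (axis i (-1)))" for A
    proof (induction A rule: infinite_finite_induct)
      case (insert i A)
      have "(\<lambda>x. cnj (u x) * u (x + axis i 1) + cnj (u x) * u (x + axis i (-1))) summable_on UNIV"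
        by (intro summable_on_add sm)
      moreover have "(\<Sum>\<^sub>\<infinity>x. cnj (u x) * u (x + axis i 1) + cnj (u x) * u (x + axis i (-1))) = S (axis i 1) + S (axis i (-1))"
        unfolding S_def by (intro infsum_add sm)
      ultimately show ?case using insert by (simp add: summable_on_add infsum_add)
    qed auto
    then show ?thesis by blast
  qed
  finally have e: "\<nu> * (\<Sum>\<^sub>\<infinity>x. cnj (u x) * u x) = (\<Sum>i\<in>UNIV. S (axis i 1) + S (axis i (-1)))" .
  have ax: "axis i (-1) = - (axis i 1 :: int ^ 'n)" for i by (simp add: axis_def vec_eq_iff)
  have im: "Im (\<nu> * (\<Sum>\<^sub>\<infinity>x. cnj (u x) * u x)) = 0"
    unfolding e by (simp add: ax Sc[symmetric])
  have "cnj (u x) * u x = of_real ((cmod (u x))\<^sup>2)" for x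
    by (subst complex_norm_square) (simp add: mult.commute)
  then have "(\<Sum>\<^sub>\<infinity>x. cnj (u x) * u x) = of_real (\<Sum>\<^sub>\<infinity>x. (cmod (u x))\<^sup>2)"
    using infsumI[OF has_sum_of_real[OF has_sum_infsum[OF sq]]] by simp
  with im \<nu> have "(\<Sum>\<^sub>\<infinity>x. (cmod (u x))\<^sup>2) = 0" by simp
  then have "(cmod (u x))\<^sup>2 = 0"
    by (intro nonneg_infsum_le_0D[OF _ sq]) auto
  then show ?thesis by simp
qed

lemma resolvent_denominator:
  assumes "Im \<nu> \<noteq> 0"
  shows "of_real t - \<nu> \<noteq> 0" "cmod (inverse (of_real t - \<nu>)) \<le> 1 / \<bar>Im \<nu>\<bar>"
proof -
  show "of_real t - \<nu> \<noteq> 0" using assms by auto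
  have "\<bar>Im \<nu>\<bar> \<le> norm (of_real t - \<nu>)" using abs_Im_le_cmod[of "of_real t - \<nu>"] by simp
  from le_imp_inverse_le[OF this] assms show "cmod (inverse (of_real t - \<nu>)) \<le> 1 / \<bar>Im \<nu>\<bar>"
    by (simp add: norm_inverse inverse_eq_divide norm_divide)
qed

lemma bmeas_resolvent:
  assumes "Im \<nu> \<noteq> 0"
  shows "bmeas (\<lambda>k. inverse (of_real (phi k) - \<nu>))"
proof -
  have "continuous_on UNIV (\<lambda>k :: real^'a. inverse (of_real (phi k) - \<nu>))"
    by (intro continuous_intros) (use resolvent_denominator(1)[OF assms] in auto)
  then show ?thesis unfolding bmeas_def bounded_iff
    using resolvent_denominator(2)[OF assms]
    by (auto intro: borel_measurable_continuous_onI)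
qed

lemma laplacian_diff: "laplacian (\<lambda>x. u x - v x) x = laplacian u x - laplacian v x"
  by (simp add: laplacian_def sum_subtractf)

lemma resolvent_unique:
  assumes \<nu>: "Im \<nu> \<noteq> 0" and "u \<in> ell2" "v \<in> ell2"
    and "\<And>x. laplacian u x - \<nu> * u x = f x" "\<And>x. laplacian v x - \<nu> * v x = f x"
  shows "u = v"
proof
  fix x
  have "u x - v x = 0"
  proof (rule ell2_eigen_zero[OF ell2_diff[OF assms(2,3)] _ \<nu>])
    fix x show "laplacian (\<lambda>x. u x - v x) x = \<nu> * (u x - v x)"
      using assms(4)[of x] assms(5)[of x] by (simp add: laplacian_diff algebra_simps)
  qed
  then show "u x = v x" by simp
qed

lemma fcoef_resolvent_solves:
  assumes f: "fsupp f" and \<nu>: "Im \<nu> \<noteq> 0"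
  shows "laplacian (fcoef (\<lambda>k. ft f k * inverse (of_real (phi k) - \<nu>))) x
     - \<nu> * fcoef (\<lambda>k. ft f k * inverse (of_real (phi k) - \<nu>)) x = f x"
proof -
  let ?h = "\<lambda>k. ft f k * inverse (of_real (phi k) - \<nu>)"
  have h: "bmeas ?h" by (intro bmeas_mult bmeas_ft bmeas_resolvent \<nu>)
  have eq: "of_real (phi k) * ?h k = ft f k + \<nu> * ?h k" for k
    using resolvent_denominator(1)[OF \<nu>, of "phi k"] by (simp add: field_simps)
  have "laplacian (fcoef ?h) x = fcoef (\<lambda>k. ft f k + \<nu> * ?h k) x"
    by (simp only: laplacian_fcoef[OF h] eq)
  also have "\<dots> = fcoef (ft f) x + \<nu> * fcoef ?h x"
    by (subst fcoef_add) (auto intro!: bmeas_ft bmeas_mult[OF bmeas_const h] simp: fcoef_cmult)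
  finally show ?thesis by (simp add: fcoef_ft[OF f])
qed

text \<open>
  The resolvent divides by \<open>phi - \<nu>\<close> in Fourier space; uniqueness of square summable solutions is what
  identifies the inverse chosen in the definition.
\<close>

lemma resolvent_fcoef:
  assumes f: "fsupp f" and \<nu>: "Im \<nu> \<noteq> 0"
  shows "resolvent \<nu> f = fcoef (\<lambda>k. ft f k * inverse (of_real (phi k) - \<nu>))" (is "_ = ?u")
proof -
  have inj: "inj_on (\<lambda>u x. laplacian u x - \<nu> * u x) ell2"
    by (rule inj_onI, rule resolvent_unique[OF \<nu>]) (auto dest: fun_cong)
  have u: "?u \<in> ell2" by (intro fcoef_ell2 bmeas_mult bmeas_ft bmeas_resolvent \<nu>)
  have "(\<lambda>x. laplacian ?u x - \<nu> * ?u x) = f" using fcoef_resolvent_solves[OF f \<nu>] by auto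
  then show ?thesis unfolding resolvent_def using inv_into_f_f[OF inj u] by simp
qed

lemma resolvent_conv:
  assumes "fsupp f" "fsupp h" "Im \<nu> \<noteq> 0"
  shows "resolvent \<nu> (conv h f) x = conv h (resolvent \<nu> f) x"
proof -
  have "resolvent \<nu> (conv h f) x = fcoef (\<lambda>k. ft h k * (ft f k * inverse (of_real (phi k) - \<nu>))) x"
    by (simp add: resolvent_fcoef fsupp_conv assms ft_conv mult.assoc)
  also have "\<dots> = conv h (fcoef (\<lambda>k. ft f k * inverse (of_real (phi k) - \<nu>))) x"
    by (intro fcoef_ft_mult bmeas_mult bmeas_ft bmeas_resolvent assms)
  finally show ?thesis by (simp add: resolvent_fcoef assms)
qed

lemma ft_diff_add:
  assumes "fsupp f" "fsupp g"
  shows "fsupp (\<lambda>x. f x - g x)" "ft (\<lambda>x. f x - g x) k = ft f k - ft g k"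
    "fsupp (\<lambda>x. f x + g x)" "ft (\<lambda>x. f x + g x) k = ft f k + ft g k"
proof -
  define A where "A = {y. f y \<noteq> 0} \<union> {y. g y \<noteq> 0}"
  have A: "finite A" using assms by (simp add: A_def fsupp_def)
  have e: "ft f k = (\<Sum>y\<in>A. f y * cis (k \<bullet> lat y))" "ft g k = (\<Sum>y\<in>A. g y * cis (k \<bullet> lat y))"
    "ft (\<lambda>x. f x - g x) k = (\<Sum>y\<in>A. (f y - g y) * cis (k \<bullet> lat y))"
    "ft (\<lambda>x. f x + g x) k = (\<Sum>y\<in>A. (f y + g y) * cis (k \<bullet> lat y))"
    by (rule ft_superset[OF A]; auto simp: A_def)+
  then show "ft (\<lambda>x. f x - g x) k = ft f k - ft g k" "ft (\<lambda>x. f x + g x) k = ft f k + ft g k"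
    by (simp_all add: left_diff_distrib distrib_right sum_subtractf sum.distrib)
  show "fsupp (\<lambda>x. f x - g x)" "fsupp (\<lambda>x. f x + g x)"
    unfolding fsupp_def by (rule finite_subset[OF _ A]; auto simp: A_def)+
qed

abbreviation spectral_point :: "real \<Rightarrow> real \<Rightarrow> complex" where
  "spectral_point lam \<epsilon> \<equiv> complex_of_real lam - \<i> * complex_of_real \<epsilon>"

lemma psi_minus_unique:
  assumes "is_psi_minus f lam \<psi>" "is_psi_minus f lam \<psi>'"
  shows "\<psi> = \<psi>'"
proof
  fix x show "\<psi> x = \<psi>' x"
    using assms unfolding is_psi_minus_def
    by (meson tendsto_unique trivial_limit_at_right_real)
qed

lemma psi_minus_conv:
  assumes p: "is_psi_minus f lam \<psi>" and f: "fsupp f" and h: "fsupp h"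
  shows "is_psi_minus (conv h f) lam (conv h \<psi>)"
  unfolding is_psi_minus_def
proof
  fix x
  have "((\<lambda>\<epsilon>. conv h (resolvent (spectral_point lam \<epsilon>) f) x) \<longlongrightarrow> conv h \<psi> x) (at_right 0)"
    using p unfolding conv_def is_psi_minus_def by (intro tendsto_intros) auto
  then show "((\<lambda>\<epsilon>. resolvent (spectral_point lam \<epsilon>) (conv h f) x) \<longlongrightarrow> conv h \<psi> x) (at_right 0)"
  proof (rule Lim_transform_eventually)
    show "\<forall>\<^sub>F \<epsilon> in at_right 0. conv h (resolvent (spectral_point lam \<epsilon>) f) x = resolvent (spectral_point lam \<epsilon>) (conv h f) x"
      using eventually_at_right_less[of 0] by eventually_elim (simp add: resolvent_conv f h)
  qed
qed

lemma psi_minus_diff: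
  assumes p: "is_psi_minus f lam \<psi>" "is_psi_minus g lam \<psi>'" and f: "fsupp f" "fsupp g"
  shows "is_psi_minus (\<lambda>x. f x - g x) lam (\<lambda>x. \<psi> x - \<psi>' x)"
  unfolding is_psi_minus_def
proof
  fix x
  have "((\<lambda>\<epsilon>. resolvent (spectral_point lam \<epsilon>) f x - resolvent (spectral_point lam \<epsilon>) g x) \<longlongrightarrow> \<psi> x - \<psi>' x) (at_right 0)"
    using p unfolding is_psi_minus_def by (intro tendsto_intros) auto
  then show "((\<lambda>\<epsilon>. resolvent (spectral_point lam \<epsilon>) (\<lambda>x. f x - g x) x) \<longlongrightarrow> \<psi> x - \<psi>' x) (at_right 0)"
  proof (rule Lim_transform_eventually)
    show "\<forall>\<^sub>F \<epsilon> in at_right 0. resolvent (spectral_point lam \<epsilon>) f x - resolvent (spectral_point lam \<epsilon>) g x = resolvent (spectral_point lam \<epsilon>) (\<lambda>x. f x - g x) x"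
      using eventually_at_right_less[of 0]
    proof eventually_elim
      case (elim \<epsilon>)
      have n: "Im (spectral_point lam \<epsilon>) \<noteq> 0" using elim by simp
      show ?case
        by (simp only: resolvent_fcoef[OF _ n] f ft_diff_add left_diff_distrib
              fcoef_diff bmeas_mult bmeas_ft bmeas_resolvent[OF n])
    qed
  qed
qed

text \<open>
  For a real source, conjugation exchanges the resolvents at \<open>\<nu>\<close> and \<open>cnj \<nu>\<close>. Their difference, which is
  twice \<open>\<i>\<close> times the imaginary part, has the Poisson kernel as its symbol.
\<close>

lemma fcoef_poisson:
  assumes F: "fsupp F" "\<And>x. cnj (F x) = F x" and \<epsilon>: "\<epsilon> > 0"
  shows "fcoef (\<lambda>k. ft F k * of_real (\<epsilon> / ((phi k - lam)\<^sup>2 + \<epsilon>\<^sup>2))) x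
    = - of_real (Im (resolvent (spectral_point lam \<epsilon>) F x))"
proof -
  let ?n = "spectral_point lam \<epsilon>"
  have n: "Im ?n \<noteq> 0" "Im (cnj ?n) \<noteq> 0" using \<epsilon> by auto
  \<comment> \<open>the resolvents below and above the real axis\<close>
  define u where "u = resolvent ?n F"
  define v where "v = resolvent (cnj ?n) F"
  have u: "u = fcoef (\<lambda>k. ft F k * inverse (of_real (phi k) - ?n))" unfolding u_def by (rule resolvent_fcoef[OF F(1) n(1)])
  have v: "v = fcoef (\<lambda>k. ft F k * inverse (of_real (phi k) - cnj ?n))" unfolding v_def by (rule resolvent_fcoef[OF F(1) n(2)])
  have "(\<lambda>x. cnj (u x)) = v"
  proof (rule resolvent_unique[OF n(2), where f = F])
    have "u \<in> ell2" "v \<in> ell2" unfolding u v by (intro fcoef_ell2 bmeas_mult bmeas_ft bmeas_resolvent n)+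
    then show "(\<lambda>x. cnj (u x)) \<in> ell2" "v \<in> ell2" by (auto simp: ell2_def)
    show "laplacian v x - cnj ?n * v x = F x" for x unfolding v by (rule fcoef_resolvent_solves[OF F(1) n(2)])
    fix x
    have "laplacian u x - ?n * u x = F x" unfolding u by (rule fcoef_resolvent_solves[OF F(1) n(1)])
    from arg_cong[OF this, of cnj] show "laplacian (\<lambda>x. cnj (u x)) x - cnj ?n * cnj (u x) = F x"
      by (simp add: F(2) laplacian_def)
  qed
  then have "u x - v x = u x - cnj (u x)" by auto
  also have "\<dots> = 2 * \<i> * of_real (Im (u x))" by (simp add: complex_eq_iff)
  finally have 1: "u x - v x = 2 * \<i> * of_real (Im (u x))" .
  have id: "ft F k * inverse (of_real (phi k) - ?n) - ft F k * inverse (of_real (phi k) - cnj ?n)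
     = (- 2 * \<i>) * (ft F k * of_real (\<epsilon> / ((phi k - lam)\<^sup>2 + \<epsilon>\<^sup>2)))" for k
  proof -
    let ?a = "complex_of_real (phi k) - ?n" and ?b = "complex_of_real (phi k) - cnj ?n"
    have nz: "?a \<noteq> 0" "?b \<noteq> 0" using resolvent_denominator(1)[OF n(1)] resolvent_denominator(1)[OF n(2)] by blast+
    have ab: "?a * ?b = of_real ((phi k - lam)\<^sup>2 + \<epsilon>\<^sup>2)"
      by (simp add: complex_eq_iff power2_eq_square algebra_simps)
    have "inverse ?a - inverse ?b = (?b - ?a) / (?a * ?b)" using nz by (simp add: field_simps)
    also have "?b - ?a = - 2 * \<i> * of_real \<epsilon>" by (simp add: complex_eq_iff)
    finally have "inverse ?a - inverse ?b = (- 2 * \<i>) * of_real (\<epsilon> / ((phi k - lam)\<^sup>2 + \<epsilon>\<^sup>2))"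
      unfolding ab by simp
    then have "ft F k * (inverse ?a - inverse ?b) = ft F k * ((- 2 * \<i>) * of_real (\<epsilon> / ((phi k - lam)\<^sup>2 + \<epsilon>\<^sup>2)))"
      by (rule arg_cong)
    then show ?thesis by (simp only: right_diff_distrib mult_ac)
  qed
  have "u x - v x = fcoef (\<lambda>k. ft F k * inverse (of_real (phi k) - ?n) - ft F k * inverse (of_real (phi k) - cnj ?n)) x"
    unfolding u v by (intro fcoef_diff[symmetric] bmeas_mult bmeas_ft bmeas_resolvent n)
  also have "\<dots> = (- 2 * \<i>) * fcoef (\<lambda>k. ft F k * of_real (\<epsilon> / ((phi k - lam)\<^sup>2 + \<epsilon>\<^sup>2))) x"
    by (simp only: id fcoef_cmult)
  finally have "2 * \<i> * of_real (Im (u x)) = (- 2 * \<i>) * fcoef (\<lambda>k. ft F k * of_real (\<epsilon> / ((phi k - lam)\<^sup>2 + \<epsilon>\<^sup>2))) x"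
    using 1 by simp
  then have "(2 * \<i>) * fcoef (\<lambda>k. ft F k * of_real (\<epsilon> / ((phi k - lam)\<^sup>2 + \<epsilon>\<^sup>2))) x = (2 * \<i>) * (- of_real (Im (u x)))"
    by simp
  then show ?thesis unfolding u_def[symmetric] by (subst (asm) mult_cancel_left) simp
qed

section \<open>The Poisson kernel in the energy variable\<close>

definition poisson :: "real \<Rightarrow> real \<Rightarrow> real" where
  "poisson \<epsilon> t = \<epsilon> / (t\<^sup>2 + \<epsilon>\<^sup>2)"

lemma poisson_nonneg: "\<epsilon> > 0 \<Longrightarrow> 0 \<le> poisson \<epsilon> t"
  by (simp add: poisson_def)

lemma poisson_le: "\<epsilon> > 0 \<Longrightarrow> poisson \<epsilon> t \<le> 1 / \<epsilon>"
  using divide_left_mono[of "\<epsilon>\<^sup>2" "t\<^sup>2 + \<epsilon>\<^sup>2" \<epsilon>]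
  by (simp add: poisson_def power2_eq_square add_nonneg_pos)

lemma continuous_poisson: 
  assumes "\<epsilon> > 0" "continuous_on A f" shows "continuous_on A (\<lambda>x. poisson \<epsilon> (f x))"
proof -
  have "(f x)\<^sup>2 + \<epsilon>\<^sup>2 \<noteq> 0" for x using assms(1) by (metis add_nonneg_eq_0_iff less_irrefl zero_eq_power2 zero_le_power2)
  then show ?thesis unfolding poisson_def by (intro continuous_intros assms(2)) auto
qed

lemma borel_measurable_poisson [measurable]: "poisson \<epsilon> \<in> borel_measurable borel"
  unfolding poisson_def[abs_def] by measurable

lemma cauchy_density: 
  "integrable lborel (\<lambda>t::real. inverse (1 + t\<^sup>2))" "(LINT t|lborel. inverse (1 + t\<^sup>2)) = pi"
proof -
  have e: "einterval (-\<infinity>) \<infinity> = UNIV" by (auto simp: einterval_def)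
  show "integrable lborel (\<lambda>t::real. inverse (1 + t\<^sup>2))"
    using integrable_inverse_1_plus_square by (simp add: set_integrable_def e)
  show "(LINT t|lborel. inverse (1 + t\<^sup>2)) = pi"
    using LBINT_inverse_1_plus_square by (simp add: interval_lebesgue_integral_def set_lebesgue_integral_def e)
qed

lemma poisson_integral_subst:
  fixes s :: "real \<Rightarrow> complex"
  assumes "\<epsilon> > 0"
  shows "(LINT l|lborel. s l * of_real (poisson \<epsilon> (y - l))) = (LINT t|lborel. s (y + \<epsilon> * t) * of_real (inverse (1 + t\<^sup>2)))"
proof -
  have "(LINT l|lborel. s l * of_real (poisson \<epsilon> (y - l)))
     = \<bar>\<epsilon>\<bar> *\<^sub>R (LINT t|lborel. s (y + \<epsilon> * t) * of_real (poisson \<epsilon> (y - (y + \<epsilon> * t))))"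
    by (rule lborel_integral_real_affine) (use assms in simp)
  also have "\<dots> = (LINT t|lborel. \<bar>\<epsilon>\<bar> *\<^sub>R (s (y + \<epsilon> * t) * of_real (poisson \<epsilon> (y - (y + \<epsilon> * t)))))"
    by (rule integral_scaleR_right[symmetric])
  also have "\<dots> = (LINT t|lborel. s (y + \<epsilon> * t) * of_real (inverse (1 + t\<^sup>2)))"
  proof (intro Bochner_Integration.integral_cong refl)
    fix t
    have "\<epsilon> * poisson \<epsilon> (y - (y + \<epsilon> * t)) = (\<epsilon> * \<epsilon>) / (\<epsilon> * \<epsilon> * (t\<^sup>2 + 1))"
      by (simp add: poisson_def power2_eq_square algebra_simps)
    also have "\<dots> = inverse (1 + t\<^sup>2)" using assms by (simp add: inverse_eq_divide add.commute)
    finally have e: "\<epsilon> * poisson \<epsilon> (y - (y + \<epsilon> * t)) = inverse (1 + t\<^sup>2)" .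
    show "\<bar>\<epsilon>\<bar> *\<^sub>R (s (y + \<epsilon> * t) * of_real (poisson \<epsilon> (y - (y + \<epsilon> * t)))) = s (y + \<epsilon> * t) * of_real (inverse (1 + t\<^sup>2))"
      using assms unfolding e[symmetric] by (simp add: scaleR_conv_of_real mult_ac)
  qed
  finally show ?thesis .
qed

lemma poisson_integral_bound:
  fixes s :: "real \<Rightarrow> complex"
  assumes s: "s \<in> borel_measurable borel" "\<And>l. cmod (s l) \<le> M" and \<epsilon>: "\<epsilon> > 0"
  shows "cmod (LINT l|lborel. s l * of_real (poisson \<epsilon> (y - l))) \<le> pi * M"
proof -
  note [measurable] = s(1)
  have M: "0 \<le> M" using s(2) norm_ge_zero order_trans by blast
  have "cmod (LINT t|lborel. s (y + \<epsilon> * t) * of_real (inverse (1 + t\<^sup>2))) \<le> (LINT t|lborel. M * inverse (1 + t\<^sup>2))"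
  proof (rule integral_norm_bound[THEN order_trans], rule Bochner_Integration.integral_mono)
    have b: "cmod (s (y + \<epsilon> * t) * of_real (inverse (1 + t\<^sup>2))) \<le> M * inverse (1 + t\<^sup>2)" for t
      using s(2) M unfolding norm_mult norm_of_real by (intro mult_mono) auto
    show "integrable lborel (\<lambda>t. M * inverse (1 + t\<^sup>2))" by (intro integrable_mult_right cauchy_density)
    from this show "integrable lborel (\<lambda>t. cmod (s (y + \<epsilon> * t) * of_real (inverse (1 + t\<^sup>2))))"
      by (rule Bochner_Integration.integrable_bound) (use b in \<open>auto intro!: AE_I2 order_trans[OF _ abs_ge_self]\<close>)
    show "cmod (s (y + \<epsilon> * t) * of_real (inverse (1 + t\<^sup>2))) \<le> M * inverse (1 + t\<^sup>2)" for t by (rule b)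
  qed
  then show ?thesis by (simp add: poisson_integral_subst[OF \<epsilon>] cauchy_density mult.commute)
qed

text \<open>
  After the substitution \<open>l = y + \<epsilon> * t\<close> the kernel no longer depends on \<open>\<epsilon>\<close>, and dominated convergence
  applies.
\<close>

lemma poisson_integral_limit:
  fixes s :: "real \<Rightarrow> complex"
  assumes s: "continuous_on UNIV s" "\<And>l. cmod (s l) \<le> M" and \<epsilon>: "\<And>n. \<epsilon> n > 0" "\<epsilon> \<longlonglongrightarrow> 0"
  shows "(\<lambda>n. LINT l|lborel. s l * of_real (poisson (\<epsilon> n) (y - l))) \<longlonglongrightarrow> pi * s y"
proof -
  have [measurable]: "s \<in> borel_measurable borel" using s(1) by (rule borel_measurable_continuous_onI)
  have M: "0 \<le> M" using s(2) norm_ge_zero order_trans by blast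
  have "(\<lambda>n. LINT t|lborel. s (y + \<epsilon> n * t) * of_real (inverse (1 + t\<^sup>2))) \<longlonglongrightarrow> (LINT t|lborel. s y * of_real (inverse (1 + t\<^sup>2)))"
  proof (rule integral_dominated_convergence[where w = "\<lambda>t. M * inverse (1 + t\<^sup>2)"])
    show "integrable lborel (\<lambda>t. M * inverse (1 + t\<^sup>2))" by (intro integrable_mult_right cauchy_density)
    show "AE t in lborel. (\<lambda>n. s (y + \<epsilon> n * t) * of_real (inverse (1 + t\<^sup>2))) \<longlonglongrightarrow> s y * of_real (inverse (1 + t\<^sup>2))"
    proof (rule AE_I2)
      fix t
      have "(\<lambda>n. y + \<epsilon> n * t) \<longlonglongrightarrow> y + 0 * t" by (intro tendsto_intros \<epsilon>)
      then have l: "(\<lambda>n. y + \<epsilon> n * t) \<longlonglongrightarrow> y" by simp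
      have "isCont s y" using s(1) by (simp add: continuous_on_eq_continuous_at)
      from isCont_tendsto_compose[OF this l] show "(\<lambda>n. s (y + \<epsilon> n * t) * of_real (inverse (1 + t\<^sup>2))) \<longlonglongrightarrow> s y * of_real (inverse (1 + t\<^sup>2))"
        by (intro tendsto_intros)
    qed
    show "AE t in lborel. cmod (s (y + \<epsilon> n * t) * of_real (inverse (1 + t\<^sup>2))) \<le> M * inverse (1 + t\<^sup>2)" for n
      using s(2) M unfolding norm_mult norm_of_real by (intro AE_I2 mult_mono) auto
  qed measurable
  moreover have "(LINT t|lborel. s y * of_real (inverse (1 + t\<^sup>2))) = pi * s y"
    by (simp only: integral_mult_right_zero integral_complex_of_real cauchy_density mult.commute)
  ultimately show ?thesis by (simp only: poisson_integral_subst[OF \<epsilon>(1)])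
qed

text \<open>
  Normalised Lebesgue measure on an interval of length \<open>2\<pi>\<close> of energies, on which the characters with
  integer times are orthonormal.
\<close>

definition window :: "real \<Rightarrow> real measure" where
  "window c = distr circle_measure borel (\<lambda>t. c + t)"

lemma sets_window [measurable_cong, simp]: "sets (window c) = sets borel"
  and space_window [simp]: "space (window c) = UNIV"
  by (simp_all add: window_def)

lemma prob_space_window: "prob_space (window c)"
  unfolding window_def by (rule prob_space.prob_space_distr[OF prob_space_circle]) simp

lemma integral_window:
  fixes f :: "real \<Rightarrow> 'b::{banach, second_countable_topology}"
  assumes [measurable]: "f \<in> borel_measurable borel" and z: "\<And>l. l \<notin> {c - pi..c + pi} \<Longrightarrow> f l = 0"
  shows "integral\<^sup>L (window c) f = (1 / (2 * pi)) *\<^sub>R (LINT l|lborel. f l)"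
proof -
  have "integral\<^sup>L (window c) f = (LINT t|circle_measure. f (c + t))"
    unfolding window_def by (rule integral_distr) auto
  also have "\<dots> = (1 / (2 * pi)) *\<^sub>R (LINT t|lborel. indicator {- pi..pi} t *\<^sub>R f (c + t))"
    by (rule integral_circle) measurable
  also have "(LINT t|lborel. indicator {- pi..pi} t *\<^sub>R f (c + t)) = (LINT t|lborel. f (c + 1 * t))"
    by (intro Bochner_Integration.integral_cong) (auto simp: indicator_def z)
  also have "\<dots> = (LINT l|lborel. f l)"
    using lborel_integral_real_affine[of 1 f c] by simp
  finally show ?thesis .
qed

lemma window_orthonormal:
  fixes i j :: nat
  shows "(LINT l|window c. cis (- (real i * l)) * cnj (cis (- (real j * l)))) = (if i = j then 1 else 0)"
proof -
  interpret prob_space "window c" by (rule prob_space_window)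
  show ?thesis
  proof (cases "i = j")
    case True
    then show ?thesis using prob_space by (simp add: cis_cnj cis_mult)
  next
    case False
    define r where "r = real j - real i"
    have r: "r \<noteq> 0" using False by (simp add: r_def)
    have eq: "cis (- (real i * l)) * cnj (cis (- (real j * l))) = cis (r * l)" for l
      by (simp add: r_def cis_cnj cis_mult left_diff_distrib)
    have "(LINT l|window c. cis (r * l)) = (LINT t|circle_measure. cis (r * (c + t)))"
      unfolding window_def by (rule integral_distr) (auto intro!: borel_measurable_continuous_onI continuous_intros)
    also have "\<dots> = 0"
    proof (rule integral_circle_deriv[where F = "\<lambda>t. cis (r * (c + t)) / (\<i> * of_real r)"])
      fix t
      have "((\<lambda>t. cis (r * (c + t))) has_vector_derivative \<i> * of_real r * cis (r * (c + t))) (at t)"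
        by (rule cis_has_vector_derivative) (auto intro!: derivative_eq_intros)
      from has_vector_derivative_divide[OF this, of "\<i> * of_real r"]
      show "((\<lambda>t. cis (r * (c + t)) / (\<i> * of_real r)) has_vector_derivative cis (r * (c + t))) (at t)"
        using r by simp
    next
      show "continuous_on UNIV (\<lambda>t. cis (r * (c + t)))" by (intro continuous_intros)
      have "cis (r * (c + pi)) = cis (r * (c - pi)) * cis (2 * pi * of_int (int j - int i))"
        by (simp add: cis_mult r_def algebra_simps)
      also have "cis (2 * pi * of_int (int j - int i)) = 1" by (rule cis_multiple_2pi) simp
      finally show "cis (r * (c + pi)) / (\<i> * of_real r) = cis (r * (c + - pi)) / (\<i> * of_real r)" by simp
    qed
    finally show ?thesis using False by (simp add: eq)
  qed
qed

definition eps :: "nat \<Rightarrow> real" where "eps n = inverse (real (Suc n))"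

lemma eps_pos: "eps n > 0" and eps_lim: "eps \<longlonglongrightarrow> 0"
  using LIMSEQ_inverse_real_of_nat by (simp_all add: eps_def[abs_def])

text \<open>
  The density in the energy \<open>l\<close> of \<open>ft F\<close> times a plane wave, smoothed by the Poisson kernel (and
  multiplied by \<open>\<pi>\<close>). By \<open>fcoef_poisson\<close> it is, up to the sign, the imaginary part of a value of the resolvent.
\<close>

definition smoothed :: "(int ^ 'n \<Rightarrow> complex) \<Rightarrow> nat \<Rightarrow> real \<Rightarrow> int ^ 'n \<Rightarrow> complex" where
  "smoothed F n l x = fcoef (\<lambda>k. ft F k * of_real (poisson (eps n) (phi k - l))) x"

lemma measurable_phi [measurable]: "phi \<in> borel_measurable borel"
  by (intro borel_measurable_continuous_onI continuous_intros)

lemma measurable_ft [measurable]: "ft u \<in> borel_measurable borel"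
  using bmeas_ft[of u] by (simp add: bmeas_def)

lemma measurable_cis [measurable]: "cis \<in> borel_measurable borel"
  by (intro borel_measurable_continuous_onI continuous_intros)

lemma measurable_cis_lat [measurable]: "(\<lambda>k. cis (- (k \<bullet> lat x))) \<in> borel_measurable borel"
  by (intro borel_measurable_continuous_onI continuous_intros)

lemma continuous_smoothed: "continuous_on UNIV (\<lambda>l. smoothed F n l x)"
proof (rule continuous_on_sequentially[THEN iffD2], intro ballI allI impI, elim conjE)
  fix ls :: "nat \<Rightarrow> real" and l assume l: "ls \<longlonglongrightarrow> l"
  obtain M where M: "M \<ge> 0" "\<And>k. cmod (ft F k) \<le> M" using ft_bounded by blast
  have "(\<lambda>m. smoothed F n (ls m) x) \<longlonglongrightarrow> smoothed F n l x"
    unfolding smoothed_def fcoef_def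
  proof (rule integral_dominated_convergence[where w = "\<lambda>_. M * (1 / eps n)"])
    show "AE k in torus_measure. (\<lambda>m. ft F k * of_real (poisson (eps n) (phi k - ls m)) * cis (- (k \<bullet> lat x)))
       \<longlonglongrightarrow> ft F k * of_real (poisson (eps n) (phi k - l)) * cis (- (k \<bullet> lat x))"
    proof (rule AE_I2)
      fix k :: "real ^ 'a"
      have "isCont (poisson (eps n)) t" for t
        using continuous_poisson[OF eps_pos continuous_on_id, of UNIV n] by (simp add: continuous_on_eq_continuous_at)
      moreover have "(\<lambda>m. phi k - ls m) \<longlonglongrightarrow> phi k - l" using l by (intro tendsto_intros)
      ultimately have "(\<lambda>m. poisson (eps n) (phi k - ls m)) \<longlonglongrightarrow> poisson (eps n) (phi k - l)"
        by (rule isCont_tendsto_compose)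
      then show "(\<lambda>m. ft F k * of_real (poisson (eps n) (phi k - ls m)) * cis (- (k \<bullet> lat x)))
       \<longlonglongrightarrow> ft F k * of_real (poisson (eps n) (phi k - l)) * cis (- (k \<bullet> lat x))"
        by (intro tendsto_intros)
    qed
    show "AE k in torus_measure. cmod (ft F k * of_real (poisson (eps n) (phi k - ls m)) * cis (- (k \<bullet> lat x))) \<le> M * (1 / eps n)" for m
      using mult_mono[OF M(2) poisson_le[OF eps_pos] M(1) poisson_nonneg[OF eps_pos]]
      by (intro AE_I2) (auto simp: norm_mult abs_of_nonneg poisson_nonneg[OF eps_pos])
  qed (auto intro: fcoef_integrable)
  then show "((\<lambda>l. smoothed F n l x) \<circ> ls) \<longlonglongrightarrow> smoothed F n l x" by (simp add: o_def)
qed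

text \<open>
  This is the purpose of a nonnegative symbol: a bound at the origin, uniform in \<open>n\<close>, dominates all
  lattice points at once.
\<close>

lemma smoothed_le_zero:
  assumes "\<And>k. ft F k = of_real (cmod (ft F k))"
  shows "cmod (smoothed F n l x) \<le> cmod (smoothed F n l 0)"
proof -
  define g where "g k = cmod (ft F k) * poisson (eps n) (phi k - l)" for k :: "real ^ 'a"
  have e: "ft F k * of_real (poisson (eps n) (phi k - l)) = of_real (g k)" for k
    using assms[of k] unfolding g_def by (metis of_real_mult)
  have g0: "g k \<ge> 0" for k using poisson_nonneg[OF eps_pos] by (simp add: g_def)
  have "cmod (smoothed F n l x) \<le> (LINT k|torus_measure. cmod (of_real (g k) * cis (- (k \<bullet> lat x))))"
    unfolding smoothed_def fcoef_def e by (rule integral_norm_bound)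
  also have "\<dots> = (LINT k|torus_measure. g k)" by (simp add: norm_mult g0)
  also have "\<dots> \<le> cmod (LINT k|torus_measure. complex_of_real (g k))"
    by (simp only: integral_complex_of_real norm_of_real abs_ge_self)
  also have "\<dots> = cmod (smoothed F n l 0)"
    unfolding smoothed_def fcoef_def e by simp
  finally show ?thesis .
qed

text \<open>
  Fubini's theorem moves the smoothing from the density to the test function.
\<close>

lemma smoothed_integral:
  fixes F :: "int ^ 'n \<Rightarrow> complex"
  assumes s: "s \<in> borel_measurable borel" "\<And>l. cmod (s l) \<le> M" and z: "\<And>l. l \<notin> {c - pi..c + pi} \<Longrightarrow> s l = 0"
  shows "(LINT l|window c. s l * smoothed F n l x)
    = fcoef (\<lambda>k. ft F k * ((1 / (2 * pi)) *\<^sub>R (LINT l|lborel. s l * of_real (poisson (eps n) (phi k - l))))) x"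
proof -
  interpret W: prob_space "window c" by (rule prob_space_window)
  interpret pair_prob_space "window c" "torus_measure :: (real ^ 'n) measure" ..
  note [measurable] = s(1)
  obtain L where L: "L \<ge> 0" "\<And>k. cmod (ft F k) \<le> L" using ft_bounded by blast
  have M: "M \<ge> 0" using s(2) norm_ge_zero order_trans by blast
  define f where "f l k = s l * (ft F k * of_real (poisson (eps n) (phi k - l)) * cis (- (k \<bullet> lat x)))" for l and k :: "real ^ 'n"
  have fm: "(\<lambda>(l, k). f l k) \<in> borel_measurable (window c \<Otimes>\<^sub>M torus_measure)"
    unfolding f_def by measurable
  have int: "integrable (window c \<Otimes>\<^sub>M torus_measure) (\<lambda>(l, k). f l k)"
  proof (rule P.integrable_const_bound[OF _ fm])
    show "AE p in window c \<Otimes>\<^sub>M torus_measure. cmod (case p of (l, k) \<Rightarrow> f l k) \<le> M * (L * (1 / eps n))"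
    proof (rule AE_I2, clarify)
      fix l and k :: "real ^ 'n"
      have "cmod (f l k) = cmod (s l) * (cmod (ft F k) * poisson (eps n) (phi k - l))"
        using poisson_nonneg[OF eps_pos] by (simp add: f_def norm_mult)
      also have "\<dots> \<le> M * (L * (1 / eps n))"
        using s(2) L M poisson_nonneg[OF eps_pos] poisson_le[OF eps_pos] by (intro mult_mono) auto
      finally show "cmod (f l k) \<le> M * (L * (1 / eps n))" .
    qed
  qed
  have "(LINT l|window c. s l * smoothed F n l x) = (LINT l|window c. LINT k|torus_measure. f l k)"
    by (simp add: f_def smoothed_def fcoef_def)
  also have "\<dots> = (LINT k|torus_measure. LINT l|window c. f l k)"
    by (rule Fubini_integral[OF int, symmetric])
  also have "\<dots> = (LINT k|torus_measure. ft F k * ((1 / (2 * pi)) *\<^sub>R (LINT l|lborel. s l * of_real (poisson (eps n) (phi k - l)))) * cis (- (k \<bullet> lat x)))"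
  proof (intro Bochner_Integration.integral_cong refl)
    fix k :: "real ^ 'n"
    have "(LINT l|window c. f l k) = (LINT l|window c. (ft F k * cis (- (k \<bullet> lat x))) * (s l * of_real (poisson (eps n) (phi k - l))))"
      by (intro Bochner_Integration.integral_cong) (auto simp: f_def)
    also have "\<dots> = (ft F k * cis (- (k \<bullet> lat x))) * (LINT l|window c. s l * of_real (poisson (eps n) (phi k - l)))"
      by (rule integral_mult_right_zero)
    also have "(LINT l|window c. s l * of_real (poisson (eps n) (phi k - l))) = (1 / (2 * pi)) *\<^sub>R (LINT l|lborel. s l * of_real (poisson (eps n) (phi k - l)))"
      by (rule integral_window) (auto simp: z)
    finally show "(LINT l|window c. f l k) = ft F k * ((1 / (2 * pi)) *\<^sub>R (LINT l|lborel. s l * of_real (poisson (eps n) (phi k - l)))) * cis (- (k \<bullet> lat x))"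
      by simp
  qed
  finally show ?thesis by (simp add: fcoef_def)
qed

section \<open>The spectral density\<close>

text \<open>
  The situation after passage to an interval of energies on which the smoothed densities at the origin
  are uniformly bounded. The limit \<open>J\<close> is assumed pointwise only; no uniformity in \<open>l\<close> is available
  from the existence of the outgoing fields.
\<close>

locale boundary_density =
  fixes F :: "int ^ 'n \<Rightarrow> complex" and c a b K :: real and J :: "real \<Rightarrow> int ^ 'n \<Rightarrow> real"
  assumes F: "fsupp F" and F_nonneg: "\<And>k. ft F k = of_real (cmod (ft F k))"
    and in_window: "c - pi \<le> a" "b \<le> c + pi"
    and boundary_limit: "\<And>l x. l \<in> {a..b} \<Longrightarrow> (\<lambda>n. smoothed F n l x) \<longlonglongrightarrow> of_real (J l x)"
    and boundary_bound: "\<And>n l. l \<in> {a..b} \<Longrightarrow> cmod (smoothed F n l 0) \<le> K"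
begin

definition spectral_density :: "real \<Rightarrow> int ^ 'n \<Rightarrow> complex" where
  "spectral_density l x = (if l \<in> {a..b} then of_real (J l x) else 0)"

sublocale W: prob_space "window c" by (rule prob_space_window)

lemma smoothed_bound: "l \<in> {a..b} \<Longrightarrow> cmod (smoothed F n l x) \<le> K"
  using smoothed_le_zero[OF F_nonneg, of n l x] boundary_bound[of l n] by linarith

lemma measurable_smoothed [measurable]: "(\<lambda>l. smoothed F n l x) \<in> borel_measurable borel"
  by (intro borel_measurable_continuous_onI continuous_smoothed)

lemma spectral_density_limit: "(\<lambda>n. indicator {a..b} l *\<^sub>R smoothed F n l x) \<longlonglongrightarrow> spectral_density l x"
proof (cases "l \<in> {a..b}")
  case True
  then show ?thesis using boundary_limit[OF True, of x] by (simp add: spectral_density_def)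
qed (auto simp: spectral_density_def indicator_def)

lemma measurable_spectral_density [measurable]: "(\<lambda>l. spectral_density l x) \<in> borel_measurable borel"
  by (rule borel_measurable_LIMSEQ_metric[OF _ spectral_density_limit]) measurable

lemma spectral_density_bound: "cmod (spectral_density l x) \<le> max K 0"
proof (cases "l \<in> {a..b}")
  case True
  have "cmod (complex_of_real (J l x)) \<le> K"
    by (rule LIMSEQ_le_const2[OF tendsto_norm[OF boundary_limit[OF True]]]) (use True smoothed_bound in auto)
  then have "cmod (spectral_density l x) \<le> K" using True by (simp add: spectral_density_def)
  then show ?thesis by simp
qed (auto simp: spectral_density_def)

text \<open>
  The factor \<open>1 / 2\<close> is \<open>\<pi>\<close>, from the Poisson kernel, divided by the length \<open>2\<pi>\<close> of the window.
\<close>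

lemma spectral_density_continuous_test:
  assumes s: "continuous_on UNIV s" "\<And>l. cmod (s l) \<le> 1" and z: "\<And>l. l \<notin> {a..b} \<Longrightarrow> s l = 0"
  shows "(LINT l|window c. s l * spectral_density l x) = 1 / 2 * fcoef (\<lambda>k. ft F k * s (phi k)) x"
proof (rule LIMSEQ_unique)
  have [measurable]: "s \<in> borel_measurable borel" using s(1) by (rule borel_measurable_continuous_onI)
  show "(\<lambda>n. LINT l|window c. s l * smoothed F n l x) \<longlonglongrightarrow> (LINT l|window c. s l * spectral_density l x)"
  proof (rule integral_dominated_convergence[where w = "\<lambda>_. max K 0"])
    show "AE l in window c. (\<lambda>n. s l * smoothed F n l x) \<longlonglongrightarrow> s l * spectral_density l x"
    proof (rule AE_I2)
      fix l
      show "(\<lambda>n. s l * smoothed F n l x) \<longlonglongrightarrow> s l * spectral_density l x"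
      proof (cases "l \<in> {a..b}")
        case True
        then show ?thesis using boundary_limit[OF True, of x] by (intro tendsto_intros) (simp add: spectral_density_def)
      qed (simp add: z)
    qed
    show "AE l in window c. cmod (s l * smoothed F n l x) \<le> max K 0" for n
    proof (rule AE_I2)
      fix l
      show "cmod (s l * smoothed F n l x) \<le> max K 0"
      proof (cases "l \<in> {a..b}")
        case True
        have "cmod (s l * smoothed F n l x) \<le> 1 * K"
          unfolding norm_mult using smoothed_bound[OF True, of n x] s(2)[of l] by (intro mult_mono) auto
        then show ?thesis by simp
      qed (simp add: z)
    qed
  qed auto
  obtain M where M: "M \<ge> 0" "\<And>k. cmod (ft F k) \<le> M" using ft_bounded by blast
  define I where "I n y = (LINT l|lborel. s l * of_real (poisson (eps n) (y - l)))" for n y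
  have Im [measurable]: "I n \<in> borel_measurable borel" for n unfolding I_def[abs_def] by measurable
  have "(\<lambda>n. fcoef (\<lambda>k. ft F k * ((1 / (2 * pi)) *\<^sub>R I n (phi k))) x)
     \<longlonglongrightarrow> fcoef (\<lambda>k. ft F k * ((1 / (2 * pi)) *\<^sub>R (pi * s (phi k)))) x"
    unfolding fcoef_def
  proof (rule integral_dominated_convergence[where w = "\<lambda>_. M"])
    show "AE k in torus_measure. (\<lambda>n. ft F k * ((1 / (2 * pi)) *\<^sub>R I n (phi k)) * cis (- (k \<bullet> lat x)))
       \<longlonglongrightarrow> ft F k * ((1 / (2 * pi)) *\<^sub>R (pi * s (phi k))) * cis (- (k \<bullet> lat x))"
      unfolding I_def by (intro AE_I2 tendsto_intros poisson_integral_limit[where M = 1] s eps_pos eps_lim)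
    show "AE k in torus_measure. cmod (ft F k * ((1 / (2 * pi)) *\<^sub>R I n (phi k)) * cis (- (k \<bullet> lat x))) \<le> M" for n
    proof (rule AE_I2)
      fix k :: "real ^ 'n"
      have "cmod (I n (phi k)) \<le> pi * 1" unfolding I_def by (rule poisson_integral_bound) (auto simp: s eps_pos)
      then have "cmod (I n (phi k)) \<le> 2 * pi" using pi_gt_zero by linarith
      then have "cmod ((1 / (2 * pi)) *\<^sub>R I n (phi k)) \<le> 1" by (simp add: field_simps)
      then have "cmod (ft F k) * cmod ((1 / (2 * pi)) *\<^sub>R I n (phi k)) \<le> M * 1" using M by (intro mult_mono) auto
      then show "cmod (ft F k * ((1 / (2 * pi)) *\<^sub>R I n (phi k)) * cis (- (k \<bullet> lat x))) \<le> M"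
        by (simp only: norm_mult norm_cis mult_1_right)
    qed
  qed auto
  moreover have "(\<lambda>n. LINT l|window c. s l * smoothed F n l x) = (\<lambda>n. fcoef (\<lambda>k. ft F k * ((1 / (2 * pi)) *\<^sub>R I n (phi k))) x)"
    unfolding I_def using s in_window z by (intro ext smoothed_integral[where M = 1]) auto
  moreover have "fcoef (\<lambda>k. ft F k * ((1 / (2 * pi)) *\<^sub>R (pi * s (phi k)))) x = 1 / 2 * fcoef (\<lambda>k. ft F k * s (phi k)) x"
  proof -
    have "(\<lambda>k. ft F k * ((1 / (2 * pi)) *\<^sub>R (pi * s (phi k)))) = (\<lambda>k. 1 / 2 * (ft F k * s (phi k)))"
      by (simp add: fun_eq_iff scaleR_conv_of_real)
    then show ?thesis by (simp only: fcoef_cmult)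
  qed
  ultimately show "(\<lambda>n. LINT l|window c. s l * smoothed F n l x) \<longlonglongrightarrow> 1 / 2 * fcoef (\<lambda>k. ft F k * s (phi k)) x" by (simp only:)
qed

text \<open>
  Continuous test functions decrease to the indicator function of \<open>E\<close>. Compact sets are enough later, as
  they exhaust measurable sets of energies up to small measure.
\<close>

lemma spectral_density_compact_test:
  assumes E: "compact E" "E \<subseteq> {a'..b'}" and ab: "a < a'" "b' < b"
  shows "(LINT l|window c. indicator E l *\<^sub>R (cis (r * l) * spectral_density l x))
    = 1 / 2 * fcoef (\<lambda>k. ft F k * (indicator E (phi k) *\<^sub>R cis (r * phi k))) x"
proof (cases "E = {}")
  case True
  then show ?thesis by (simp add: fcoef_def)
next
  case False
  have cl: "closed E" using E(1) by (rule compact_imp_closed)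
  have [measurable]: "E \<in> sets borel" using cl by simp
  obtain M where M: "M \<ge> 0" "\<And>k. cmod (ft F k) \<le> M" using ft_bounded by blast
  define g where "g = min (a' - a) (b - b')"
  have g: "g > 0" using ab by (simp add: g_def)
  obtain N :: nat where N: "inverse (real (Suc N)) < g" using reals_Archimedean[OF g] by blast
  define t where "t m l = max 0 (1 - real (Suc (m + N)) * infdist l E)" for m :: nat and l
  define s where "s m l = complex_of_real (t m l) * cis (r * l)" for m l
  have t01: "0 \<le> t m l" "t m l \<le> 1" for m l
    using mult_nonneg_nonneg[of "real (Suc (m + N))" "infdist l E"] infdist_nonneg[of l E] by (auto simp: t_def simp del: of_nat_Suc)
  have tc: "continuous_on UNIV (t m)" for m unfolding t_def by (intro continuous_intros)
  have [measurable]: "t m \<in> borel_measurable borel" for m using tc by (rule borel_measurable_continuous_onI)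
  have tl: "(\<lambda>m. t m l) \<longlonglongrightarrow> indicator E l" for l
  proof (cases "l \<in> E")
    case True
    then show ?thesis by (simp add: t_def)
  next
    case out: False
    then have i: "infdist l E > 0" using in_closed_iff_infdist_zero[OF cl False, of l] infdist_nonneg[of l E] by linarith
    obtain m0 :: nat where m0: "1 / infdist l E < real m0" using reals_Archimedean2 by blast
    have "\<forall>\<^sub>F m in sequentially. t m l = 0"
      using eventually_ge_at_top[of m0]
    proof eventually_elim
      case (elim m)
      have "1 < real m0 * infdist l E" using m0 i by (simp add: field_simps)
      also have "\<dots> \<le> real (Suc (m + N)) * infdist l E" using elim i by (intro mult_right_mono) auto
      finally show ?case by (simp add: t_def)
    qed
    then show ?thesis using out by (simp add: tendsto_eventually)
  qed
  have tz: "t m l = 0" if "l \<notin> {a..b}" for m l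
  proof -
    obtain e where e: "e \<in> E" "infdist l E = dist l e" using infdist_attains_inf[OF cl False] by blast
    have "a' \<le> e" "e \<le> b'" using e(1) E(2) by auto
    moreover have "l < a \<or> b < l" using that by auto
    ultimately have "g \<le> infdist l E" unfolding e(2) dist_real_def g_def by linarith
    then have "inverse (real (Suc N)) \<le> infdist l E" using N by linarith
    then have "real (Suc N) * inverse (real (Suc N)) \<le> real (Suc N) * infdist l E" by (rule mult_left_mono) simp
    then have "1 \<le> real (Suc N) * infdist l E" by simp
    also have "\<dots> \<le> real (Suc (m + N)) * infdist l E" by (intro mult_right_mono infdist_nonneg) simp
    finally show ?thesis by (simp add: t_def)
  qed
  have id: "(LINT l|window c. s m l * spectral_density l x) = 1 / 2 * fcoef (\<lambda>k. ft F k * s m (phi k)) x" for m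
    by (rule spectral_density_continuous_test) (auto simp: s_def norm_mult t01 tz intro!: continuous_intros tc)
  show ?thesis
  proof (rule LIMSEQ_unique)
    show "(\<lambda>m. LINT l|window c. s m l * spectral_density l x) \<longlonglongrightarrow> (LINT l|window c. indicator E l *\<^sub>R (cis (r * l) * spectral_density l x))"
    proof (rule integral_dominated_convergence[where w = "\<lambda>_. max K 0"])
      show "AE l in window c. (\<lambda>m. s m l * spectral_density l x) \<longlonglongrightarrow> indicator E l *\<^sub>R (cis (r * l) * spectral_density l x)"
      proof (rule AE_I2)
        fix l
        have "(\<lambda>m. t m l *\<^sub>R (cis (r * l) * spectral_density l x)) \<longlonglongrightarrow> indicator E l *\<^sub>R (cis (r * l) * spectral_density l x)"
          by (intro tendsto_intros tl)
        then show "(\<lambda>m. s m l * spectral_density l x) \<longlonglongrightarrow> indicator E l *\<^sub>R (cis (r * l) * spectral_density l x)"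
          by (simp add: s_def scaleR_conv_of_real mult.assoc)
      qed
      show "AE l in window c. cmod (s m l * spectral_density l x) \<le> max K 0" for m
      proof (rule AE_I2)
        fix l
        have "cmod (s m l * spectral_density l x) \<le> 1 * max K 0"
          unfolding norm_mult by (intro mult_mono spectral_density_bound) (auto simp: s_def norm_mult t01)
        then show "cmod (s m l * spectral_density l x) \<le> max K 0" by simp
      qed
    qed (simp_all add: s_def)
    have "(\<lambda>m. fcoef (\<lambda>k. ft F k * s m (phi k)) x) \<longlonglongrightarrow> fcoef (\<lambda>k. ft F k * (indicator E (phi k) *\<^sub>R cis (r * phi k))) x"
      unfolding fcoef_def
    proof (rule integral_dominated_convergence[where w = "\<lambda>_. M"])
      show "AE k in torus_measure. (\<lambda>m. ft F k * s m (phi k) * cis (- (k \<bullet> lat x))) \<longlonglongrightarrow>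
          ft F k * (indicator E (phi k) *\<^sub>R cis (r * phi k)) * cis (- (k \<bullet> lat x))"
        unfolding s_def scaleR_conv_of_real by (intro AE_I2 tendsto_intros tl)
      show "AE k in torus_measure. cmod (ft F k * s m (phi k) * cis (- (k \<bullet> lat x))) \<le> M" for m
      proof (rule AE_I2)
        fix k :: "real ^ 'n"
        have "cmod (ft F k) * cmod (s m (phi k)) \<le> M * 1"
          using M by (intro mult_mono) (auto simp: s_def norm_mult t01)
        then show "cmod (ft F k * s m (phi k) * cis (- (k \<bullet> lat x))) \<le> M" by (simp add: norm_mult)
      qed
    qed (simp_all add: s_def)
    then have "(\<lambda>m. 1 / 2 * fcoef (\<lambda>k. ft F k * s m (phi k)) x) \<longlonglongrightarrow> 1 / 2 * fcoef (\<lambda>k. ft F k * (indicator E (phi k) *\<^sub>R cis (r * phi k))) x"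
      by (intro tendsto_intros)
    then show "(\<lambda>m. LINT l|window c. s m l * spectral_density l x) \<longlonglongrightarrow> 1 / 2 * fcoef (\<lambda>k. ft F k * (indicator E (phi k) *\<^sub>R cis (r * phi k))) x"
      by (simp only: id)
  qed
qed

text \<open>
  At a fixed lattice point, the coefficients of the evolved packet at integer times are the Fourier
  coefficients of the density. The sum over time is therefore bounded by the size of the density at this
  point.
\<close>

lemma time_bessel:
  assumes E: "compact E" "E \<subseteq> {a'..b'}" and ab: "a < a'" "b' < b"
    and q: "\<And>l. l \<in> E \<Longrightarrow> \<bar>J l x\<bar> \<le> q" "0 \<le> q" and X: "finite (X :: nat set)"
  shows "(\<Sum>n\<in>X. (cmod (fcoef (\<lambda>k. evol n k * (ft F k * indicator E (phi k))) x))\<^sup>2) \<le> (2 * q)\<^sup>2"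
proof -
  have [measurable]: "E \<in> sets borel" using compact_imp_closed[OF E(1)] by simp
  define h where "h l = indicator E l *\<^sub>R spectral_density l x" for l
  have hq: "cmod (h l) \<le> q" for l
    using q by (auto simp: h_def spectral_density_def indicator_def)
  have hm [measurable]: "h \<in> borel_measurable borel" unfolding h_def by measurable
  have u: "fcoef (\<lambda>k. evol n k * (ft F k * indicator E (phi k))) x
     = 2 * (LINT l|window c. h l * cnj (cis (- (real n * l))))" for n
  proof -
    have "(LINT l|window c. h l * cnj (cis (- (real n * l)))) = (LINT l|window c. indicator E l *\<^sub>R (cis (real n * l) * spectral_density l x))"
      by (intro Bochner_Integration.integral_cong) (auto simp: h_def cis_cnj)
    also have "\<dots> = 1 / 2 * fcoef (\<lambda>k. ft F k * (indicator E (phi k) *\<^sub>R cis (real n * phi k))) x"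
      by (rule spectral_density_compact_test[OF E ab])
    also have "(\<lambda>k. ft F k * (indicator E (phi k) *\<^sub>R cis (real n * phi k))) = (\<lambda>k. evol n k * (ft F k * indicator E (phi k)))"
      by (auto simp: fun_eq_iff evol_def indicator_def)
    finally show ?thesis by (simp add: mult.commute)
  qed
  have "(\<Sum>n\<in>X. (cmod (LINT l|window c. h l * cnj (cis (- (real n * l)))))\<^sup>2) \<le> (LINT l|window c. (cmod (h l))\<^sup>2)"
    by (rule bessel_inequality[where B = q])
       (auto simp: hq window_orthonormal X W.finite_measure_axioms intro!: borel_measurable_continuous_onI continuous_intros)
  also have "\<dots> \<le> (LINT l|window c. q\<^sup>2)"
    by (intro Bochner_Integration.integral_mono W.integrable_const_bound[of _ "q\<^sup>2"])
       (auto simp: hq power_mono)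
  also have "\<dots> = q\<^sup>2" using W.prob_space by simp
  finally show ?thesis by (simp add: u norm_mult power_mult_distrib flip: sum_distrib_left)
qed

end

lemma card_lattice_ball:
  assumes "0 \<le> R"
  shows "finite {x :: int ^ 'n. norm (lat x) \<le> R}"
    and "real (card {x :: int ^ 'n. norm (lat x) \<le> R}) \<le> (2 * R + 1) ^ CARD('n)"
proof -
  define m where "m = \<lfloor>R\<rfloor>"
  define P where "P = Pi\<^sub>E (UNIV :: 'n set) (\<lambda>_. {- m..m})"
  have m: "0 \<le> m" using assms by (simp add: m_def)
  have P: "finite P" unfolding P_def by (intro finite_PiE) auto
  have sub: "{x :: int ^ 'n. norm (lat x) \<le> R} \<subseteq> vec_lambda ` P"
  proof
    fix x :: "int ^ 'n" assume x: "x \<in> {x. norm (lat x) \<le> R}"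
    have "\<bar>x $ i\<bar> \<le> m" for i
    proof -
      have "\<bar>real_of_int (x $ i)\<bar> \<le> R" using component_le_norm_cart[of "lat x" i] x by (simp add: lat_def)
      then show ?thesis unfolding m_def by linarith
    qed
    then show "x \<in> vec_lambda ` P"
      by (intro image_eqI[of _ _ "\<lambda>i. x $ i"]) (auto simp: P_def abs_le_iff minus_le_iff)
  qed
  then show "finite {x :: int ^ 'n. norm (lat x) \<le> R}" using P finite_subset by blast
  have "card {x :: int ^ 'n. norm (lat x) \<le> R} \<le> card P"
    using card_mono[OF _ sub] card_image_le[OF P, of vec_lambda] P by (meson finite_imageI order_trans)
  also have "card P = nat (2 * m + 1) ^ CARD('n)"
    by (simp add: P_def card_PiE algebra_simps)
  finally have "real (card {x :: int ^ 'n. norm (lat x) \<le> R}) \<le> real (nat (2 * m + 1)) ^ CARD('n)"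
    by (metis of_nat_le_iff of_nat_power)
  also have "\<dots> \<le> (2 * R + 1) ^ CARD('n)"
    using m by (intro power_mono) (auto simp: m_def)
  finally show "real (card {x :: int ^ 'n. norm (lat x) \<le> R}) \<le> (2 * R + 1) ^ CARD('n)" .
qed

section \<open>Fields that decay in a cone\<close>

context boundary_density
begin

text \<open>
  Between the times \<open>T\<close> and \<open>2 * T\<close> the ball around \<open>n *\<^sub>R v\<close> stays in a region that has at most \<open>O(T^d)\<close>
  lattice points, where the square of the field is at most \<open>\<eta>\<^sup>2\<close> times \<open>O(T^(1-d))\<close>. By
  \<open>time_bessel\<close> the squared masses for these \<open>T\<close> times add up to \<open>O(\<eta>\<^sup>2 * T)\<close>, so one of them is
  \<open>O(\<eta>\<^sup>2)\<close>.
\<close>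

lemma packet_average:
  fixes v :: "real ^ 'n"
  defines "h \<equiv> norm v / 2"
  assumes E: "compact E" "E \<subseteq> {a'..b'}" and ab: "a < a'" "b' < b"
    and \<delta>: "0 < \<delta>" "\<delta> \<le> h"
    and cone: "\<And>x n. n \<ge> 1 \<Longrightarrow> dist (lat x /\<^sub>R real n) v < \<delta> \<Longrightarrow> direction x \<in> U"
    and decay: "\<And>l x. l \<in> E \<Longrightarrow> R \<le> norm (lat x) \<Longrightarrow> direction x \<in> U \<Longrightarrow>
        norm (lat x) powr ((real CARD('n) - 1) / 2) * \<bar>J l x\<bar> \<le> \<eta>"
    and \<eta>: "0 \<le> \<eta>" and T: "1 \<le> T" "1 \<le> real T * h" "R \<le> real T * h"
  shows "\<exists>n\<in>{T..<2 * T}. finite {x. dist (lat x /\<^sub>R real n) v < \<delta>} \<and>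
    l2 (fcoef (\<lambda>k. evol n k * (ft F k * indicator E (phi k)))) {x. dist (lat x /\<^sub>R real n) v < \<delta>}
      \<le> 2 * sqrt (13 ^ CARD('n) * h) * \<eta>"
proof (rule ccontr)
  define d where "d = CARD('n)"
  define p where "p = (real d - 1) / 2"
  define t where "t = real T * h"
  define A where "A n = {x :: int ^ 'n. dist (lat x /\<^sub>R real n) v < \<delta>}" for n :: nat
  define u where "u n x = fcoef (\<lambda>k. evol n k * (ft F k * indicator E (phi k))) x" for n x
  define L where "L = {x :: int ^ 'n. norm (lat x) \<le> 6 * t \<and> t \<le> norm (lat x) \<and> direction x \<in> U}"
  have d1: "d \<ge> 1" by (simp add: d_def Suc_leI)
  have h0: "0 \<le> h" by (simp add: h_def)
  have t1: "1 \<le> t" "R \<le> t" using T by (auto simp: t_def)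
  have AL: "A n \<subseteq> L" if n: "n \<in> {T..<2 * T}" for n
  proof
    fix x assume x: "x \<in> A n"
    have n1: "n \<ge> 1" using n T(1) by auto
    have eq: "lat x = real n *\<^sub>R (lat x /\<^sub>R real n)" using n1 by simp
    have dx: "norm (lat x /\<^sub>R real n - v) < h" using x \<delta> by (simp add: A_def dist_norm)
    have "norm v - norm (lat x /\<^sub>R real n - v) \<le> norm (lat x /\<^sub>R real n)"
      using norm_triangle_ineq2[of v "v - lat x /\<^sub>R real n"] by (simp add: norm_minus_commute)
    then have lo: "h \<le> norm (lat x /\<^sub>R real n)" using dx by (simp add: h_def)
    have hi: "norm (lat x /\<^sub>R real n) \<le> 3 * h"
      using norm_triangle_sub[of "lat x /\<^sub>R real n" v] dx by (simp add: h_def)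
    have nn: "norm (lat x) = real n * norm (lat x /\<^sub>R real n)" by (subst eq) simp
    have "t \<le> norm (lat x)" unfolding nn t_def using n h0 lo by (intro mult_mono) auto
    moreover have "norm (lat x) \<le> real (2 * T) * (3 * h)"
      unfolding nn using n hi h0 by (intro mult_mono) auto
    ultimately show "x \<in> L" using cone[OF n1, of x] x by (simp add: L_def A_def t_def)
  qed
  have Lsub: "L \<subseteq> {x. norm (lat x) \<le> 6 * t}" by (auto simp: L_def)
  have Lfin: "finite L" using Lsub card_lattice_ball(1)[of "6 * t"] t1 by (auto intro: finite_subset)
  have Afin: "finite (A n)" if "n \<in> {T..<2 * T}" for n using AL[OF that] Lfin by (rule finite_subset)
  have "real (card L) \<le> (2 * (6 * t) + 1) ^ d"
    using card_mono[OF card_lattice_ball(1) Lsub] card_lattice_ball(2)[of "6 * t", where 'n = 'n] t1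
    unfolding d_def by (smt (verit) of_nat_le_iff)
  also have "\<dots> \<le> (13 * t) ^ d" using t1 by (intro power_mono) auto
  finally have cL: "real (card L) \<le> (13 * t) ^ d" .
  define q where "q = \<eta> * t powr (- p)"
  have q0: "q \<ge> 0" using \<eta> by (simp add: q_def)
  have p0: "p \<ge> 0" using d1 by (simp add: p_def)
  have Jq: "\<bar>J l x\<bar> \<le> q" if l: "l \<in> E" and x: "x \<in> L" for l x
  proof -
    have nx: "t \<le> norm (lat x)" "direction x \<in> U" using x by (auto simp: L_def)
    have "norm (lat x) powr p * \<bar>J l x\<bar> \<le> \<eta>"
      using decay[OF l _ nx(2)] nx t1 by (simp add: p_def d_def)
    moreover have "t powr p * \<bar>J l x\<bar> \<le> norm (lat x) powr p * \<bar>J l x\<bar>"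
      using nx t1 p0 by (intro mult_right_mono powr_mono2) auto
    ultimately have "t powr (- p) * (t powr p * \<bar>J l x\<bar>) \<le> t powr (- p) * \<eta>" by (intro mult_left_mono) auto
    moreover have "t powr (- p) * (t powr p * \<bar>J l x\<bar>) = \<bar>J l x\<bar>"
      using t1 by (simp add: mult.assoc[symmetric] powr_add[symmetric])
    ultimately show ?thesis by (simp add: q_def mult.commute)
  qed
  \<comment> \<open>chosen so that \<open>X\<^sup>2 * T\<close> is exactly the bound obtained for the sum over all times\<close>
  define X where "X = 2 * sqrt (13 ^ d * h) * \<eta>"
  have X0: "X \<ge> 0" using \<eta> h0 by (simp add: X_def)
  have X2: "X\<^sup>2 = 4 * (13 ^ d * h) * \<eta>\<^sup>2" using h0 by (simp add: X_def power_mult_distrib)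
  assume "\<not> ?thesis"
  then have gt: "X < l2 (u n) (A n)" if "n \<in> {T..<2 * T}" for n
    using that Afin[OF that] unfolding X_def u_def A_def d_def by auto
  have gt2: "X\<^sup>2 < (\<Sum>x\<in>A n. (cmod (u n x))\<^sup>2)" if n: "n \<in> {T..<2 * T}" for n
  proof -
    have "X\<^sup>2 < (l2 (u n) (A n))\<^sup>2" using gt[OF n] X0 by (intro power_strict_mono) auto
    also have "\<dots> = (\<Sum>x\<in>A n. (cmod (u n x))\<^sup>2)" by (simp add: L2_set_def sum_nonneg)
    finally show ?thesis .
  qed
  have "real T * X\<^sup>2 = (\<Sum>n\<in>{T..<2 * T}. X\<^sup>2)" by simp
  also have "\<dots> < (\<Sum>n\<in>{T..<2 * T}. \<Sum>x\<in>A n. (cmod (u n x))\<^sup>2)"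
    using gt2 T(1) by (intro sum_strict_mono) auto
  also have "\<dots> \<le> (\<Sum>n\<in>{T..<2 * T}. \<Sum>x\<in>L. (cmod (u n x))\<^sup>2)"
    by (intro sum_mono sum_mono2 Lfin AL) auto
  also have "\<dots> = (\<Sum>x\<in>L. \<Sum>n\<in>{T..<2 * T}. (cmod (u n x))\<^sup>2)" by (rule sum.swap)
  also have "\<dots> \<le> (\<Sum>x\<in>L. (2 * q)\<^sup>2)"
    unfolding u_def by (intro sum_mono time_bessel[OF E ab]) (auto intro: Jq q0)
  also have "\<dots> = real (card L) * (2 * q)\<^sup>2" by simp
  also have "\<dots> \<le> (13 * t) ^ d * (2 * q)\<^sup>2" by (intro mult_right_mono cL) simp
  also have "\<dots> = 4 * \<eta>\<^sup>2 * 13 ^ d * (t ^ d * (t powr (- p))\<^sup>2)"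
    by (simp add: q_def power_mult_distrib)
  also have "t ^ d * (t powr (- p))\<^sup>2 = t"
  proof -
    have "(t powr (- p))\<^sup>2 = t powr (- (real d - 1))"
      using t1 by (simp add: power2_eq_square powr_add[symmetric] p_def)
    moreover have "t ^ d = t powr real d" using t1 by (simp add: powr_realpow)
    ultimately show ?thesis using t1 by (simp add: powr_add[symmetric])
  qed
  finally have "real T * X\<^sup>2 < 4 * \<eta>\<^sup>2 * 13 ^ d * t" .
  moreover have "real T * X\<^sup>2 = 4 * \<eta>\<^sup>2 * 13 ^ d * t" by (simp add: X2 t_def)
  ultimately show False by simp
qed

lemma compact_part_estimate:
  fixes v :: "real ^ 'n"
  defines "h \<equiv> norm v / 2"
  assumes E: "compact E" "E \<subseteq> {a'..b'}" and ab: "a < a'" "b' < b"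
    and \<delta>: "0 < \<delta>" "\<delta> \<le> h"
    and cone: "\<And>x n. n \<ge> 1 \<Longrightarrow> dist (lat x /\<^sub>R real n) v < \<delta> \<Longrightarrow> direction x \<in> U"
    and decay: "\<And>l x. l \<in> E \<Longrightarrow> R \<le> norm (lat x) \<Longrightarrow> direction x \<in> U \<Longrightarrow>
        norm (lat x) powr ((real CARD('n) - 1) / 2) * \<bar>J l x\<bar> \<le> \<eta>"
    and \<eta>: "0 \<le> \<eta>" and M: "\<And>k. cmod (ft F k) \<le> M"
  shows "(LINT k|torus_measure. indicator E (phi k) * (bump v (grad_phi k) ^ m * (cmod (ft F k))\<^sup>2))
    \<le> 2 * sqrt (13 ^ CARD('n) * h) * \<eta> * M + M * (inverse (1 + \<delta>\<^sup>2) ^ m * M)"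
proof (rule field_le_epsilon)
  fix e :: real assume e: "e > 0"
  have [measurable]: "E \<in> sets borel" using compact_imp_closed[OF E(1)] by simp
  have M0: "M \<ge> 0" using M norm_ge_zero order_trans by blast
  have h0: "h > 0" using \<delta> by linarith
  define B where "B k = ft F k * indicator E (phi k)" for k
  have B: "bmeas B" "\<And>k. cmod (B k) \<le> M"
    unfolding bmeas_def bounded_iff B_def using M M0 by (auto simp: norm_mult indicator_def intro!: exI[of _ M])
  obtain C where C: "C \<ge> 0" "\<And>n A. n \<ge> 1 \<Longrightarrow> finite A \<Longrightarrow> (\<forall>x. x \<notin> A \<longrightarrow> \<delta> \<le> dist (lat x /\<^sub>R real n) v) \<Longrightarrow>
     cmod (LINT k|torus_measure. B k * cnj (of_real (bump v (grad_phi k) ^ m) * ft F k))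
       \<le> l2 (fcoef (\<lambda>k. evol n k * B k)) A * M + M * (inverse (1 + \<delta>\<^sup>2) ^ m * M + C / real n)"
    using propagation[OF F M B \<delta>(1), of v m] by meson
  obtain T :: nat where T: "real T > max 1 (max (1 / h) (max (R / h) (M * C / e)))" using reals_Archimedean2 by blast
  have T1: "1 \<le> T" "1 \<le> real T * h" "R \<le> real T * h" "M * C / e \<le> real T"
    using T h0 by (auto simp: field_simps)
  obtain n where n: "n \<in> {T..<2 * T}" "finite {x. dist (lat x /\<^sub>R real n) v < \<delta>}"
    "l2 (fcoef (\<lambda>k. evol n k * B k)) {x. dist (lat x /\<^sub>R real n) v < \<delta>} \<le> 2 * sqrt (13 ^ CARD('n) * h) * \<eta>"
  proof -
    have "\<exists>n\<in>{T..<2 * T}. finite {x. dist (lat x /\<^sub>R real n) v < \<delta>} \<and>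
      l2 (fcoef (\<lambda>k. evol n k * (ft F k * indicator E (phi k)))) {x. dist (lat x /\<^sub>R real n) v < \<delta>}
        \<le> 2 * sqrt (13 ^ CARD('n) * (norm v / 2)) * \<eta>"
    proof (rule packet_average[OF E ab \<delta>(1) \<delta>(2)[unfolded h_def] _ _ \<eta> T1(1) T1(2,3)[unfolded h_def]])
      show "direction x \<in> U" if "1 \<le> n" "dist (lat x /\<^sub>R real n) v < \<delta>" for x n
        using that by (rule cone)
      show "norm (lat x) powr ((real CARD('n) - 1) / 2) * \<bar>J l x\<bar> \<le> \<eta>"
        if "l \<in> E" "R \<le> norm (lat x)" "direction x \<in> U" for l x
        using that by (rule decay)
    qed
    then show ?thesis using that unfolding B_def h_def by blast
  qed
  have n1: "n \<ge> 1" using n(1) T1(1) by auto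
  have "M * (C / real n) \<le> e"
  proof -
    have "M * C \<le> real T * e" using T1(4) e by (simp add: field_simps)
    also have "\<dots> \<le> real n * e" using n(1) e by (intro mult_right_mono) auto
    finally show ?thesis using n1 by (simp add: field_simps)
  qed
  moreover have "cmod (LINT k|torus_measure. B k * cnj (of_real (bump v (grad_phi k) ^ m) * ft F k))
       \<le> l2 (fcoef (\<lambda>k. evol n k * B k)) {x. dist (lat x /\<^sub>R real n) v < \<delta>} * M + M * (inverse (1 + \<delta>\<^sup>2) ^ m * M + C / real n)"
    by (rule C(2)[OF n1 n(2)]) auto
  moreover have "l2 (fcoef (\<lambda>k. evol n k * B k)) {x. dist (lat x /\<^sub>R real n) v < \<delta>} * M \<le> 2 * sqrt (13 ^ CARD('n) * h) * \<eta> * M"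
    by (rule mult_right_mono[OF n(3) M0])
  ultimately have le: "cmod (LINT k|torus_measure. B k * cnj (of_real (bump v (grad_phi k) ^ m) * ft F k))
     \<le> 2 * sqrt (13 ^ CARD('n) * h) * \<eta> * M + M * (inverse (1 + \<delta>\<^sup>2) ^ m * M) + e"
    by (simp add: distrib_left)
  have eq: "B k * cnj (of_real (bump v (grad_phi k) ^ m) * ft F k) =
     complex_of_real (indicator E (phi k) * (bump v (grad_phi k) ^ m * (cmod (ft F k))\<^sup>2))" for k
  proof -
    have "ft F k * cnj (ft F k) = of_real ((cmod (ft F k))\<^sup>2)" by (rule complex_norm_square[symmetric])
    then have "(ft F k * cnj (ft F k)) * (indicator E (phi k) * of_real (bump v (grad_phi k) ^ m)) =
      of_real ((cmod (ft F k))\<^sup>2) * (indicator E (phi k) * of_real (bump v (grad_phi k) ^ m))" by simp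
    then show ?thesis by (auto simp: B_def indicator_def mult_ac)
  qed
  have "(LINT k|torus_measure. indicator E (phi k) * (bump v (grad_phi k) ^ m * (cmod (ft F k))\<^sup>2))
     \<le> cmod (LINT k|torus_measure. complex_of_real (indicator E (phi k) * (bump v (grad_phi k) ^ m * (cmod (ft F k))\<^sup>2)))"
    by (simp only: integral_complex_of_real norm_of_real abs_ge_self)
  also have "\<dots> \<le> 2 * sqrt (13 ^ CARD('n) * h) * \<eta> * M + M * (inverse (1 + \<delta>\<^sup>2) ^ m * M) + e"
    using le unfolding eq .
  finally show "(LINT k|torus_measure. indicator E (phi k) * (bump v (grad_phi k) ^ m * (cmod (ft F k))\<^sup>2))
    \<le> 2 * sqrt (13 ^ CARD('n) * h) * \<eta> * M + M * (inverse (1 + \<delta>\<^sup>2) ^ m * M) + e" .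
qed

text \<open>
  The distribution of \<open>phi\<close> under the weight \<open>ft F\<close> has, up to a constant, \<open>J l 0\<close> as its density, which
  is bounded. So a small set of energies carries little of the source.
\<close>

lemma remainder_estimate:
  assumes E: "compact E" "E \<subseteq> {a'..b'}" and ab: "a < a'" "b' < b"
  shows "(LINT k|torus_measure. (indicator {a'..b'} (phi k) - indicator E (phi k)) * cmod (ft F k))
    \<le> 2 * max K 0 * measure (window c) ({a'..b'} - E)"
proof -
  have [measurable]: "E \<in> sets borel" using compact_imp_closed[OF E(1)] by simp
  define D where "D = {a'..b'} - E"
  have Dm [measurable]: "D \<in> sets borel" by (simp add: D_def)
  have di: "indicator D l = (indicator {a'..b'} l - indicator E l :: real)" for l
    using E(2) by (auto simp: D_def indicator_def)
  obtain M where M: "M \<ge> 0" "\<And>k. cmod (ft F k) \<le> M" using ft_bounded by blast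
  have bE: "bmeas (\<lambda>k. ft F k * (indicator G (phi k) *\<^sub>R cis (0 * phi k)))" if "G \<in> sets borel" for G :: "real set"
    unfolding bmeas_def bounded_iff using that M by (auto simp: norm_mult indicator_def intro!: exI[of _ M])
  have iE: "integrable (window c) (\<lambda>l. indicator G l *\<^sub>R (cis (0 * l) * spectral_density l 0))" if "G \<in> sets borel" for G :: "real set"
    using that spectral_density_bound[of _ 0] by (intro W.integrable_const_bound[of _ "max K 0"]) (auto simp: indicator_def norm_mult)
  define c1 where "c1 = (LINT k|torus_measure. indicator D (phi k) * cmod (ft F k))"
  have "complex_of_real c1 = (LINT k|torus_measure. complex_of_real (indicator D (phi k) * cmod (ft F k)))"
    unfolding c1_def by (rule integral_complex_of_real[symmetric])
  also have "\<dots> = fcoef (\<lambda>k. ft F k * (indicator {a'..b'} (phi k) *\<^sub>R cis (0 * phi k)) - ft F k * (indicator E (phi k) *\<^sub>R cis (0 * phi k))) 0"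
    unfolding fcoef_def
  proof (intro Bochner_Integration.integral_cong refl)
    fix k :: "real ^ 'n"
    have "complex_of_real (indicator D (phi k) * cmod (ft F k)) = of_real (indicator D (phi k)) * ft F k"
      by (subst (2) F_nonneg) simp
    then show "complex_of_real (indicator D (phi k) * cmod (ft F k)) =
      (ft F k * (indicator {a'..b'} (phi k) *\<^sub>R cis (0 * phi k)) - ft F k * (indicator E (phi k) *\<^sub>R cis (0 * phi k))) * cis (- (k \<bullet> lat 0))"
      by (simp add: di scaleR_conv_of_real algebra_simps)
  qed
  also have "\<dots> = 2 * (LINT l|window c. indicator {a'..b'} l *\<^sub>R (cis (0 * l) * spectral_density l 0)) -
      2 * (LINT l|window c. indicator E l *\<^sub>R (cis (0 * l) * spectral_density l 0))"
    unfolding fcoef_diff[OF bE[OF atLeastAtMost_borel] bE[OF \<open>E \<in> sets borel\<close>]]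
      spectral_density_compact_test[OF compact_Icc order_refl ab] spectral_density_compact_test[OF E ab] by simp
  also have "\<dots> = 2 * (LINT l|window c. indicator {a'..b'} l *\<^sub>R (cis (0 * l) * spectral_density l 0) - indicator E l *\<^sub>R (cis (0 * l) * spectral_density l 0))"
    unfolding Bochner_Integration.integral_diff[OF iE[OF atLeastAtMost_borel] iE[OF \<open>E \<in> sets borel\<close>]] right_diff_distrib
    by (rule refl)
  also have "(LINT l|window c. indicator {a'..b'} l *\<^sub>R (cis (0 * l) * spectral_density l 0) - indicator E l *\<^sub>R (cis (0 * l) * spectral_density l 0))
      = (LINT l|window c. indicator D l *\<^sub>R spectral_density l 0)"
    by (intro Bochner_Integration.integral_cong refl) (simp add: di scaleR_diff_left)
  finally have eq: "complex_of_real c1 = 2 * (LINT l|window c. indicator D l *\<^sub>R spectral_density l 0)" .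
  have "cmod (LINT l|window c. indicator D l *\<^sub>R spectral_density l 0) \<le> (LINT l|window c. max K 0 * indicator D l)"
  proof (rule integral_norm_bound[THEN order_trans], rule Bochner_Integration.integral_mono)
    show "integrable (window c) (\<lambda>l. max K 0 * indicator D l)"
      by (intro integrable_mult_right W.integrable_const_bound[of _ 1]) (auto simp: indicator_def)
    show "integrable (window c) (\<lambda>l. cmod (indicator D l *\<^sub>R spectral_density l 0))"
      using spectral_density_bound[of _ 0] by (intro W.integrable_const_bound[of _ "max K 0"]) (auto simp: indicator_def)
    show "cmod (indicator D l *\<^sub>R spectral_density l 0) \<le> max K 0 * indicator D l" for l
      using spectral_density_bound[of l 0] by (auto simp: indicator_def)
  qed
  also have "\<dots> = max K 0 * measure (window c) D" by simp
  finally have "cmod (complex_of_real c1) \<le> 2 * (max K 0 * measure (window c) D)"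
    unfolding eq by (simp add: norm_mult)
  then have "c1 \<le> 2 * max K 0 * measure (window c) D" by simp
  then show ?thesis unfolding c1_def di unfolding D_def .
qed

end

lemma measurable_bump_grad [measurable]: "(\<lambda>k. bump v (grad_phi k)) \<in> borel_measurable borel"
  by (intro borel_measurable_continuous_onI continuous_intros)

lemma half_share:
  fixes e D :: real
  assumes "0 < e" "0 \<le> D"
  shows "0 < e / (2 * (D + 1))" "D * (e / (2 * (D + 1))) \<le> e / 2"
proof -
  show "0 < e / (2 * (D + 1))" using assms by simp
  have "D * (e / (2 * (D + 1))) = (D / (D + 1)) * (e / 2)" using assms by (simp add: field_simps)
  also have "\<dots> \<le> 1 * (e / 2)" using assms by (intro mult_right_mono) auto
  finally show "D * (e / (2 * (D + 1))) \<le> e / 2" by simp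
qed

context boundary_density
begin

text \<open>
  The decay is not uniform in the energy, but it is so on a compact set of almost full measure:
  exhaust the interval by the sets on which the bound holds beyond radius \<open>N\<close>, and use inner regularity.
\<close>

lemma exists_compact_decay_set:
  assumes sub: "{a'..b'} \<subseteq> {a..b}"
    and decay: "\<And>l \<eta>. l \<in> {a'..b'} \<Longrightarrow> \<eta> > 0 \<Longrightarrow> \<exists>R. \<forall>x. R \<le> norm (lat x) \<longrightarrow> direction x \<in> U \<longrightarrow>
        norm (lat x) powr ((real CARD('n) - 1) / 2) * \<bar>J l x\<bar> \<le> \<eta>"
    and \<eta>: "\<eta> > 0" and \<tau>: "\<tau> > 0"
  obtains E R where "compact E" "E \<subseteq> {a'..b'}" "measure (window c) ({a'..b'} - E) < \<tau>"
    "\<And>l x. l \<in> E \<Longrightarrow> R \<le> norm (lat x) \<Longrightarrow> direction x \<in> U \<Longrightarrow>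
        norm (lat x) powr ((real CARD('n) - 1) / 2) * \<bar>J l x\<bar> \<le> \<eta>"
proof -
  define p where "p = (real CARD('n) - 1) / 2"
  define S where "S N = {a'..b'} \<inter> (\<Inter>x\<in>{x. real N \<le> norm (lat x) \<and> direction x \<in> U}.
      {l. norm (lat x) powr p * cmod (spectral_density l x) \<le> \<eta>})" for N :: nat
  have Sm: "S N \<in> sets borel" for N
  proof (cases "{x :: int ^ 'n. real N \<le> norm (lat x) \<and> direction x \<in> U} = {}")
    case True
    then show ?thesis unfolding S_def by (simp only: INF_empty) simp
  next
    case False
    then show ?thesis unfolding S_def
      by (intro sets.Int sets.countable_INT' countableI_type) (auto intro!: borel_measurable_le)
  qed
  have mono: "incseq S" by (auto simp: incseq_def S_def)
  have un: "(\<Union>N. S N) = {a'..b'}"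
  proof (intro equalityI subsetI)
    fix l assume l: "l \<in> {a'..b'}"
    obtain R where R: "\<And>x. R \<le> norm (lat x) \<Longrightarrow> direction x \<in> U \<Longrightarrow> norm (lat x) powr p * \<bar>J l x\<bar> \<le> \<eta>"
      using decay[OF l \<eta>] unfolding p_def by blast
    obtain N :: nat where N: "R \<le> real N" using real_arch_simple by blast
    have "l \<in> S N" using l R N sub by (auto simp: S_def spectral_density_def)
    then show "l \<in> (\<Union>N. S N)" by blast
  qed (auto simp: S_def)
  have "(\<lambda>N. measure (window c) (S N)) \<longlonglongrightarrow> measure (window c) {a'..b'}"
    unfolding un[symmetric] by (rule W.finite_Lim_measure_incseq) (use Sm mono in auto)
  then have "\<forall>\<^sub>F N in sequentially. measure (window c) (S N) > measure (window c) {a'..b'} - \<tau> / 2"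
    using \<tau> by (intro order_tendstoD) auto
  then obtain N where N: "measure (window c) (S N) > measure (window c) {a'..b'} - \<tau> / 2"
    using eventually_happens' sequentially_bot by blast
  have "emeasure (window c) (S N) = (SUP K \<in> {K. K \<subseteq> S N \<and> compact K}. emeasure (window c) K)"
    by (rule inner_regular) (use Sm W.emeasure_space_1 in auto)
  moreover have "\<exists>E. E \<subseteq> S N \<and> compact E \<and> measure (window c) E > measure (window c) (S N) - \<tau> / 2"
  proof (cases "measure (window c) (S N) - \<tau> / 2 < 0")
    case True
    then show ?thesis by (intro exI[of _ "{}"]) auto
  next
    case False
    have "ennreal (measure (window c) (S N) - \<tau> / 2) < emeasure (window c) (S N)"
      using False \<tau> unfolding W.emeasure_eq_measure by (intro ennreal_lessI) auto
    then obtain E where "E \<subseteq> S N" "compact E" "ennreal (measure (window c) (S N) - \<tau> / 2) < emeasure (window c) E"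
      unfolding calculation less_SUP_iff by auto
    then show ?thesis using False unfolding W.emeasure_eq_measure by (auto simp: ennreal_less_iff)
  qed
  then obtain E where E: "E \<subseteq> S N" "compact E" "measure (window c) E > measure (window c) (S N) - \<tau> / 2" by blast
  have Esub: "E \<subseteq> {a'..b'}" using E(1) by (auto simp: S_def)
  have Eb: "E \<in> sets borel" using compact_imp_closed[OF E(2)] by simp
  have "measure (window c) ({a'..b'} - E) = measure (window c) {a'..b'} - measure (window c) E"
    by (rule W.finite_measure_Diff) (use Eb Esub in auto)
  then have "measure (window c) ({a'..b'} - E) < \<tau>" using N E(3) by linarith
  moreover have "norm (lat x) powr p * \<bar>J l x\<bar> \<le> \<eta>" if "l \<in> E" "real N \<le> norm (lat x)" "direction x \<in> U" for l x
  proof -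
    have "l \<in> S N" using that(1) E(1) by blast
    then have "norm (lat x) powr p * cmod (spectral_density l x) \<le> \<eta>" using that by (auto simp: S_def)
    moreover have "l \<in> {a..b}" using that(1) Esub sub by blast
    ultimately show ?thesis by (simp add: spectral_density_def)
  qed
  ultimately show ?thesis using that[of E "real N"] E(2) Esub unfolding p_def by blast
qed

lemma bump_moment_bound:
  fixes v :: "real ^ 'n"
  assumes ab: "a < a'" "b' < b" and \<delta>: "0 < \<delta>" "\<delta> \<le> norm v / 2"
    and cone: "\<And>x n. n \<ge> 1 \<Longrightarrow> dist (lat x /\<^sub>R real n) v < \<delta> \<Longrightarrow> direction x \<in> U"
    and decay: "\<And>l \<eta>. l \<in> {a'..b'} \<Longrightarrow> \<eta> > 0 \<Longrightarrow> \<exists>R. \<forall>x. R \<le> norm (lat x) \<longrightarrow> direction x \<in> U \<longrightarrow>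
        norm (lat x) powr ((real CARD('n) - 1) / 2) * \<bar>J l x\<bar> \<le> \<eta>"
    and M: "\<And>k. cmod (ft F k) \<le> M"
  shows "(LINT k|torus_measure. indicator {a'..b'} (phi k) * (bump v (grad_phi k) ^ m * (cmod (ft F k))\<^sup>2))
    \<le> inverse (1 + \<delta>\<^sup>2) ^ m * M\<^sup>2"
proof (rule field_le_epsilon)
  fix e :: real assume e: "e > 0"
  have M0: "M \<ge> 0" using M norm_ge_zero order_trans by blast
  define C where "C = 2 * sqrt (13 ^ CARD('n) * (norm v / 2))"
  have C0: "C \<ge> 0" by (simp add: C_def)
  define \<eta> where "\<eta> = e / (2 * (C * M + 1))"
  have \<eta>: "\<eta> > 0" "C * \<eta> * M \<le> e / 2"
    using half_share[OF e mult_nonneg_nonneg[OF C0 M0]] by (auto simp: \<eta>_def mult_ac)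
  define \<tau> where "\<tau> = e / (2 * (M * (2 * max K 0) + 1))"
  have \<tau>: "\<tau> > 0" "M * (2 * max K 0 * \<tau>) \<le> e / 2"
  proof -
    have "0 \<le> M * (2 * max K 0)" using M0 by simp
    from half_share[OF e this] show "\<tau> > 0" "M * (2 * max K 0 * \<tau>) \<le> e / 2"
      by (simp_all only: \<tau>_def mult.assoc)
  qed
  have sub: "{a'..b'} \<subseteq> {a..b}" using ab by auto
  obtain E R where E: "compact E" "E \<subseteq> {a'..b'}" and Em: "measure (window c) ({a'..b'} - E) < \<tau>"
    and dec: "\<And>l x. l \<in> E \<Longrightarrow> R \<le> norm (lat x) \<Longrightarrow> direction x \<in> U \<Longrightarrow>
        norm (lat x) powr ((real CARD('n) - 1) / 2) * \<bar>J l x\<bar> \<le> \<eta>"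
    using exists_compact_decay_set[OF sub decay \<eta>(1) \<tau>(1)] by blast
  have [measurable]: "E \<in> sets borel" using compact_imp_closed[OF E(1)] by simp
  define G where "G k = bump v (grad_phi k) ^ m * (cmod (ft F k))\<^sup>2" for k
  have G: "0 \<le> G k" "G k \<le> M * cmod (ft F k)" "G k \<le> M * M" for k
  proof -
    have b: "0 \<le> bump v (grad_phi k) ^ m" "bump v (grad_phi k) ^ m \<le> 1"
      using bump_pos[of v "grad_phi k"] bump_le_one[of v "grad_phi k"] by (auto intro: power_le_one)
    show "0 \<le> G k" using b by (simp add: G_def)
    have "G k \<le> 1 * (cmod (ft F k))\<^sup>2" unfolding G_def using b by (intro mult_right_mono) auto
    also have "\<dots> \<le> M * cmod (ft F k)" using M[of k] by (simp add: power2_eq_square mult_right_mono)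
    finally show 1: "G k \<le> M * cmod (ft F k)" .
    also have "\<dots> \<le> M * M" using M[of k] M0 by (intro mult_left_mono)
    finally show "G k \<le> M * M" .
  qed
  have Gm [measurable]: "G \<in> borel_measurable borel" unfolding G_def by measurable
  have iG: "integrable torus_measure (\<lambda>k. indicator D (phi k) * G k)" if [measurable]: "D \<in> sets borel" for D :: "real set"
    using G M0 by (intro integrable_torus_bounded) (auto simp: bounded_iff indicator_def intro!: exI[of _ "M * M"])
  have iF: "integrable torus_measure (\<lambda>k. M * ((indicator {a'..b'} (phi k) - indicator E (phi k)) * cmod (ft F k)))"
    using M M0 by (intro integrable_mult_right integrable_torus_bounded) (auto simp: bounded_iff indicator_def intro!: exI[of _ M])
  have "(LINT k|torus_measure. indicator {a'..b'} (phi k) * G k)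
     \<le> (LINT k|torus_measure. indicator E (phi k) * G k + M * ((indicator {a'..b'} (phi k) - indicator E (phi k)) * cmod (ft F k)))"
  proof (rule Bochner_Integration.integral_mono)
    show "integrable torus_measure (\<lambda>k. indicator {a'..b'} (phi k) * G k)" by (rule iG) simp
    show "integrable torus_measure (\<lambda>k. indicator E (phi k) * G k + M * ((indicator {a'..b'} (phi k) - indicator E (phi k)) * cmod (ft F k)))"
      by (intro Bochner_Integration.integrable_add iG iF) simp
    show "indicator {a'..b'} (phi k) * G k \<le> indicator E (phi k) * G k + M * ((indicator {a'..b'} (phi k) - indicator E (phi k)) * cmod (ft F k))" for k
      using G[of k] E(2) by (auto simp: indicator_def)
  qed
  also have "\<dots> = (LINT k|torus_measure. indicator E (phi k) * G k)
      + M * (LINT k|torus_measure. (indicator {a'..b'} (phi k) - indicator E (phi k)) * cmod (ft F k))"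
    by (subst Bochner_Integration.integral_add[OF iG iF]) auto
  also have "\<dots> \<le> (C * \<eta> * M + M * (inverse (1 + \<delta>\<^sup>2) ^ m * M)) + M * (2 * max K 0 * \<tau>)"
  proof (intro add_mono mult_left_mono M0)
    show "(LINT k|torus_measure. indicator E (phi k) * G k) \<le> C * \<eta> * M + M * (inverse (1 + \<delta>\<^sup>2) ^ m * M)"
      unfolding C_def G_def
    proof (rule compact_part_estimate[OF E ab \<delta> _ _ less_imp_le[OF \<eta>(1)] M])
      show "direction x \<in> U" if "1 \<le> n" "dist (lat x /\<^sub>R real n) v < \<delta>" for x n
        using that by (rule cone)
      show "norm (lat x) powr ((real CARD('n) - 1) / 2) * \<bar>J l x\<bar> \<le> \<eta>"
        if "l \<in> E" "R \<le> norm (lat x)" "direction x \<in> U" for l x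
        using that by (rule dec)
    qed
    have "(LINT k|torus_measure. (indicator {a'..b'} (phi k) - indicator E (phi k)) * cmod (ft F k))
      \<le> 2 * max K 0 * measure (window c) ({a'..b'} - E)" by (rule remainder_estimate[OF E ab])
    also have "\<dots> \<le> 2 * max K 0 * \<tau>" using Em by (intro mult_left_mono) auto
    finally show "(LINT k|torus_measure. (indicator {a'..b'} (phi k) - indicator E (phi k)) * cmod (ft F k)) \<le> 2 * max K 0 * \<tau>" .
  qed
  also have "\<dots> \<le> inverse (1 + \<delta>\<^sup>2) ^ m * M\<^sup>2 + e"
    using \<eta>(2) \<tau>(2) by (simp add: power2_eq_square mult_ac)
  finally show "(LINT k|torus_measure. indicator {a'..b'} (phi k) * (bump v (grad_phi k) ^ m * (cmod (ft F k))\<^sup>2))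
    \<le> inverse (1 + \<delta>\<^sup>2) ^ m * M\<^sup>2 + e" unfolding G_def .
qed

text \<open>
  If \<open>ft F k0\<close> did not vanish, the integral of \<open>bump_moment_bound\<close> would decay at most like \<open>q1 ^ m\<close> with
  \<open>q1\<close> as close to \<open>1\<close> as desired, because the bump is close to \<open>1\<close> near \<open>k0\<close>.
\<close>

lemma vanishing_point:
  fixes k0 :: "real ^ 'n"
  assumes ab: "a < a'" "b' < b" and \<delta>: "0 < \<delta>" "\<delta> \<le> norm (grad_phi k0) / 2"
    and cone: "\<And>x n. n \<ge> 1 \<Longrightarrow> dist (lat x /\<^sub>R real n) (grad_phi k0) < \<delta> \<Longrightarrow> direction x \<in> U"
    and decay: "\<And>l \<eta>. l \<in> {a'..b'} \<Longrightarrow> \<eta> > 0 \<Longrightarrow> \<exists>R. \<forall>x. R \<le> norm (lat x) \<longrightarrow> direction x \<in> U \<longrightarrow>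
        norm (lat x) powr ((real CARD('n) - 1) / 2) * \<bar>J l x\<bar> \<le> \<eta>"
    and k0: "\<And>i. \<bar>k0 $ i\<bar> < pi" "phi k0 \<in> {a'<..<b'}"
  shows "ft F k0 = 0"
proof (rule ccontr)
  assume nz: "ft F k0 \<noteq> 0"
  define v where "v = grad_phi k0"
  define q0 where "q0 = inverse (1 + \<delta>\<^sup>2)"
  have q0: "0 < q0" "q0 < 1" using \<delta>(1) by (auto simp: q0_def add_pos_nonneg inverse_less_1_iff)
  \<comment> \<open>any number strictly between \<open>q0\<close> and \<open>1\<close> serves\<close>
  define q1 where "q1 = (1 + q0) / 2"
  have q1: "q0 < q1" "q1 < 1" using q0 by (auto simp: q1_def)
  define f1 where "f1 = cmod (ft F k0) / 2"
  have f1: "0 < f1" "f1 < cmod (ft F k0)" using nz by (auto simp: f1_def)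
  obtain M where M: "M \<ge> 0" "\<And>k. cmod (ft F k) \<le> M" using ft_bounded by blast
  define O' where "O' = {k. phi k \<in> {a'<..<b'} \<and> q1 < bump v (grad_phi k) \<and> f1 < cmod (ft F k)}"
  have "open O'"
  proof -
    have "O' = {k. a' < phi k} \<inter> {k. phi k < b'} \<inter> {k. q1 < bump v (grad_phi k)} \<inter> {k. f1 < cmod (ft F k)}"
      by (auto simp: O'_def)
    then show ?thesis by (auto intro!: open_Int open_Collect_less continuous_intros continuous_ft)
  qed
  moreover have "k0 \<in> O'" using k0(2) f1 q1 by (simp add: O'_def v_def bump_def)
  ultimately obtain e where e: "e > 0" "ball k0 e \<subseteq> O'" by (auto simp: open_contains_ball)
  define \<mu> where "\<mu> = measure torus_measure (ball k0 e)"
  have \<mu>: "\<mu> > 0"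
  proof (rule ccontr)
    assume "\<not> \<mu> > 0"
    then have "measure torus_measure (ball k0 e) = 0" using measure_nonneg[of torus_measure "ball k0 e"] unfolding \<mu>_def by linarith
    then have "AE k in torus_measure. k \<notin> ball k0 e"
      by (intro AE_not_in) (auto simp: null_sets_def torus.emeasure_eq_measure)
    then show False by (rule torus_pos[OF k0(1) e(1)])
  qed
  have lower: "q1 ^ m * f1\<^sup>2 * \<mu> \<le> q0 ^ m * M\<^sup>2" for m
  proof -
    have "q1 ^ m * f1\<^sup>2 * \<mu> = (LINT k|torus_measure. indicator (ball k0 e) k * (q1 ^ m * f1\<^sup>2))"
      by (simp add: \<mu>_def)
    also have "\<dots> \<le> (LINT k|torus_measure. indicator {a'..b'} (phi k) * (bump v (grad_phi k) ^ m * (cmod (ft F k))\<^sup>2))"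
    proof (rule Bochner_Integration.integral_mono)
      show "integrable torus_measure (\<lambda>k. indicator (ball k0 e) k * (q1 ^ m * f1\<^sup>2))"
        by (intro integrable_mult_left integrable_torus_bounded) (auto simp: bounded_iff indicator_def intro!: exI[of _ 1])
      have G: "\<bar>bump v (grad_phi k) ^ m * (cmod (ft F k))\<^sup>2\<bar> \<le> 1 * M\<^sup>2" for k
        using bump_pos[of v "grad_phi k"] bump_le_one[of v "grad_phi k"] M(2)[of k]
        unfolding abs_mult by (intro mult_mono) (auto intro!: power_le_one power_mono simp: abs_of_nonneg less_imp_le)
      show "integrable torus_measure (\<lambda>k. indicator {a'..b'} (phi k) * (bump v (grad_phi k) ^ m * (cmod (ft F k))\<^sup>2))"
        using G by (intro integrable_torus_bounded) (auto simp: bounded_iff indicator_def intro!: exI[of _ "M\<^sup>2"])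
      fix k :: "real ^ 'n"
      show "indicator (ball k0 e) k * (q1 ^ m * f1\<^sup>2) \<le> indicator {a'..b'} (phi k) * (bump v (grad_phi k) ^ m * (cmod (ft F k))\<^sup>2)"
      proof (cases "k \<in> ball k0 e")
        case True
        then have k: "phi k \<in> {a'..b'}" "q1 < bump v (grad_phi k)" "f1 < cmod (ft F k)" using e(2) by (auto simp: O'_def)
        have "q1 ^ m * f1\<^sup>2 \<le> bump v (grad_phi k) ^ m * (cmod (ft F k))\<^sup>2"
          using k q0 q1 f1 by (intro mult_mono power_mono) auto
        then show ?thesis using True k by simp
      next
        case False
        have "0 \<le> bump v (grad_phi k)" using bump_pos[of v "grad_phi k"] by simp
        then show ?thesis using False by simp
      qed
    qed
    also have "\<dots> \<le> q0 ^ m * M\<^sup>2" unfolding q0_def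
    proof (rule bump_moment_bound[OF ab \<delta>[folded v_def] _ _ M(2)])
      show "direction x \<in> U" if "1 \<le> n" "dist (lat x /\<^sub>R real n) v < \<delta>" for x n
        using that unfolding v_def by (rule cone)
      show "\<exists>R. \<forall>x. R \<le> norm (lat x) \<longrightarrow> direction x \<in> U \<longrightarrow> norm (lat x) powr ((real CARD('n) - 1) / 2) * \<bar>J l x\<bar> \<le> \<eta>"
        if "l \<in> {a'..b'}" "\<eta> > 0" for l \<eta> using that by (rule decay)
    qed
    finally show ?thesis .
  qed
  have "(\<lambda>m. (q0 / q1) ^ m * M\<^sup>2) \<longlonglongrightarrow> 0 * M\<^sup>2"
    using q0 q1 by (intro tendsto_intros LIMSEQ_realpow_zero) auto
  moreover have "f1\<^sup>2 * \<mu> \<le> (q0 / q1) ^ m * M\<^sup>2" for m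
  proof -
    have "0 < q1 ^ m" using q0 q1 by simp
    then show ?thesis using lower[of m] by (simp add: power_divide field_simps)
  qed
  ultimately have "f1\<^sup>2 * \<mu> \<le> 0" by (intro LIMSEQ_le_const[of _ "0 * M\<^sup>2", simplified]) auto
  then show False using f1 \<mu> by (simp add: mult_le_0_iff)
qed

end

section \<open>Finitely supported sources\<close>

text \<open>
  Multiplying by the inverse of one of the exponentials and differentiating eliminates it.
\<close>

lemma exponential_sum_zero:
  fixes \<theta> :: "'i \<Rightarrow> real"
  assumes "finite A" "inj_on \<theta> A" "r > 0" "\<And>t. \<bar>t\<bar> < r \<Longrightarrow> (\<Sum>y\<in>A. c y * cis (t * \<theta> y)) = 0" "y \<in> A"
  shows "c y = 0"
  using assms
proof (induction A arbitrary: c \<theta> y rule: finite_induct)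
  case (insert z A)
  define g where "g t = (\<Sum>y\<in>A. c y * cis (t * (\<theta> y - \<theta> z)))" for t
  have g: "g t = - c z" if t: "\<bar>t\<bar> < r" for t
  proof -
    have "cis (- (t * \<theta> z)) * (c z * cis (t * \<theta> z) + (\<Sum>y\<in>A. c y * cis (t * \<theta> y))) = 0"
      using insert.prems(3)[OF t] insert.hyps by simp
    moreover have "cis (- (t * \<theta> z)) * (\<Sum>y\<in>A. c y * cis (t * \<theta> y)) = g t"
      unfolding g_def sum_distrib_left
      by (intro sum.cong refl) (simp add: cis_mult mult.left_commute right_diff_distrib)
    moreover have "cis (- (t * \<theta> z)) * (c z * cis (t * \<theta> z)) = c z"
      by (simp add: cis_mult mult.left_commute)
    ultimately have "c z + g t = 0" by (simp add: distrib_left)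
    then show ?thesis by (simp add: add_eq_0_iff)
  qed
  define c' where "c' y = c y * (\<i> * of_real (\<theta> y - \<theta> z))" for y
  have d: "(\<Sum>y\<in>A. c' y * cis (t * (\<theta> y - \<theta> z))) = 0" if t: "\<bar>t\<bar> < r" for t
  proof -
    have 1: "(g has_vector_derivative (\<Sum>y\<in>A. c y * (\<i> * of_real (\<theta> y - \<theta> z) * cis (t * (\<theta> y - \<theta> z))))) (at t)"
      unfolding g_def
      by (intro has_vector_derivative_sum has_vector_derivative_mult_right cis_has_vector_derivative)
         (auto intro!: derivative_eq_intros)
    have 2: "(g has_vector_derivative 0) (at t)"
    proof (rule has_vector_derivative_transform_within_open)
      show "((\<lambda>t. - c z) has_vector_derivative 0) (at t)" by simp
      show "open {- r<..<r}" "t \<in> {- r<..<r}" using t by (auto simp: abs_less_iff)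
    qed (use g in \<open>auto simp: abs_less_iff\<close>)
    have "(\<Sum>y\<in>A. c y * (\<i> * of_real (\<theta> y - \<theta> z) * cis (t * (\<theta> y - \<theta> z)))) = 0"
      by (rule vector_derivative_unique_at[OF 1 2])
    then show ?thesis by (simp add: c'_def mult.assoc)
  qed
  have inj: "inj_on (\<lambda>y. \<theta> y - \<theta> z) A" using insert.prems(1) by (auto simp: inj_on_def)
  have A: "c y = 0" if y: "y \<in> A" for y
  proof -
    have "c' y = 0" by (rule insert.IH[OF inj insert.prems(2) d y])
    moreover have "\<theta> y \<noteq> \<theta> z" using insert.prems(1) y insert.hyps(2) by (auto simp: inj_on_def)
    ultimately show ?thesis by (simp add: c'_def)
  qed
  have "c z = 0" using g[of 0] insert.prems(2) A by (simp add: g_def)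
  then show ?case using A insert.prems(4) by auto
qed simp

text \<open>
  Countably many hyperplanes do not cover the space.
\<close>

lemma generic_direction:
  obtains v :: "real ^ 'n" where "\<And>z :: int ^ 'n. z \<noteq> 0 \<Longrightarrow> v \<bullet> lat z \<noteq> 0"
proof -
  have "negligible (\<Union>z\<in>{z :: int ^ 'n. z \<noteq> 0}. {v. lat z \<bullet> v = 0})"
  proof (rule negligible_countable_Union)
    show "countable ((\<lambda>z :: int ^ 'n. {v. lat z \<bullet> v = 0}) ` {z. z \<noteq> 0})"
      by (intro countable_image countableI_type)
    fix S assume "S \<in> (\<lambda>z :: int ^ 'n. {v. lat z \<bullet> v = 0}) ` {z. z \<noteq> 0}"
    then obtain z :: "int ^ 'n" where z: "z \<noteq> 0" "S = {v. lat z \<bullet> v = 0}" by blast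
    have "lat z \<noteq> 0" using z(1) lat_eq_iff[of z 0] by simp
    then show "negligible S" unfolding z(2) by (intro negligible_hyperplane) auto
  qed
  then have "(\<Union>z\<in>{z :: int ^ 'n. z \<noteq> 0}. {v. lat z \<bullet> v = 0}) \<noteq> UNIV"
    using non_negligible_UNIV by metis
  then obtain v where "v \<notin> (\<Union>z\<in>{z :: int ^ 'n. z \<noteq> 0}. {v. lat z \<bullet> v = 0})" by blast
  then show ?thesis using that[of v] by (auto simp: inner_commute)
qed

text \<open>
  On a line in a generic direction the frequencies of the plane waves are distinct.
\<close>

lemma ft_zero_on_open:
  fixes u :: "int ^ 'n \<Rightarrow> complex"
  assumes u: "fsupp u" and S: "open S" "S \<noteq> {}" "\<And>k. k \<in> S \<Longrightarrow> ft u k = 0"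
  shows "u = (\<lambda>x. 0)"
proof
  fix x
  obtain k0 where k0: "k0 \<in> S" using S(2) by blast
  obtain e where e: "e > 0" "ball k0 e \<subseteq> S" using S(1) k0 by (auto simp: open_contains_ball)
  obtain v :: "real ^ 'n" where v: "\<And>z :: int ^ 'n. z \<noteq> 0 \<Longrightarrow> v \<bullet> lat z \<noteq> 0" by (rule generic_direction) blast
  define A where "A = {y. u y \<noteq> 0}"
  have A: "finite A" using u by (simp add: A_def fsupp_def)
  define r where "r = e / (norm v + 1)"
  have r: "r > 0" using e(1) by (simp add: r_def add_nonneg_pos)
  have zero: "(\<Sum>y\<in>A. (u y * cis (k0 \<bullet> lat y)) * cis (t * (v \<bullet> lat y))) = 0" if t: "\<bar>t\<bar> < r" for t
  proof -
    have "\<bar>t\<bar> * norm v \<le> \<bar>t\<bar> * (norm v + 1)" by (intro mult_left_mono) auto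
    also have "\<dots> < e"
    proof -
      have "0 < norm v + 1" by (simp add: add_nonneg_pos)
      then show ?thesis using t by (simp only: r_def pos_less_divide_eq)
    qed
    finally have "norm (t *\<^sub>R v) < e" by simp
    then have "k0 + t *\<^sub>R v \<in> ball k0 e" by (simp add: dist_norm)
    then have "ft u (k0 + t *\<^sub>R v) = 0" using e(2) S(3) by blast
    then show ?thesis by (simp add: ft_def A_def inner_add_left mult.assoc flip: cis_mult)
  qed
  have inj: "inj_on (\<lambda>y. v \<bullet> lat y) A"
  proof (rule inj_onI)
    fix y z assume "v \<bullet> lat y = v \<bullet> lat z"
    then have "v \<bullet> lat (y - z) = 0" by (simp add: lat_diff inner_diff_right)
    then show "y = z" using v[of "y - z"] by auto
  qed
  show "u x = 0"
  proof (rule ccontr)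
    assume "u x \<noteq> 0"
    then have "x \<in> A" by (simp add: A_def)
    from exponential_sum_zero[OF A inj r zero this] have "u x * cis (k0 \<bullet> lat x) = 0" by blast
    then show False using \<open>u x \<noteq> 0\<close> by simp
  qed
qed

lemma ft_mult_zero:
  fixes u v :: "int ^ 'n \<Rightarrow> complex"
  assumes "fsupp u" "fsupp v" "\<And>k. ft u k * ft v k = 0" and "u \<noteq> (\<lambda>x. 0)"
  shows "v = (\<lambda>x. 0)"
proof (rule ft_zero_on_open[OF assms(2)])
  show "open {k. ft u k \<noteq> 0}" by (intro open_Collect_neq continuous_ft continuous_on_const)
  show "{k. ft u k \<noteq> 0} \<noteq> {}"
    using ft_zero_on_open[OF assms(1) open_UNIV] assms(4) by auto
  show "ft v k = 0" if "k \<in> {k. ft u k \<noteq> 0}" for k using assms(3)[of k] that by auto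
qed

text \<open>
  The factor \<open>ft v\<close> is nonzero on a nonempty open set, so \<open>ft u\<close> vanishes there.
\<close>

lemma conv_zero_divisor:
  assumes "fsupp u" "fsupp v" "conv u v = (\<lambda>x. 0)" "v \<noteq> (\<lambda>x. 0)"
  shows "u = (\<lambda>x. 0)"
proof (rule ft_mult_zero[OF assms(2,1) _ assms(4)])
  fix k
  have "ft v k * ft u k = ft (conv u v) k" by (simp add: ft_conv assms(1,2) mult.commute)
  also have "\<dots> = 0" by (simp add: assms(3) ft_def)
  finally show "ft v k * ft u k = 0" .
qed

definition adj :: "(int ^ 'n \<Rightarrow> complex) \<Rightarrow> int ^ 'n \<Rightarrow> complex" where
  "adj u x = cnj (u (- x))"

lemma fsupp_reflect: "fsupp u \<Longrightarrow> fsupp (\<lambda>x :: int ^ 'n. u (- x))"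
  and fsupp_cnj: "fsupp u \<Longrightarrow> fsupp (\<lambda>x. cnj (u x))"
proof -
  assume u: "fsupp u"
  have "{y :: int ^ 'n. u (- y) \<noteq> 0} = uminus ` {y. u y \<noteq> 0}" by (auto intro: image_eqI[of _ uminus "- _"])
  then show "fsupp (\<lambda>x :: int ^ 'n. u (- x))" using u by (simp add: fsupp_def)
qed (simp add: fsupp_def)

lemma fsupp_adj: "fsupp u \<Longrightarrow> fsupp (adj u)"
  unfolding adj_def[abs_def] by (intro fsupp_cnj fsupp_reflect)

lemma ft_reflect: "ft (\<lambda>x. u (- x)) k = ft u (- k)"
  unfolding ft_def
  by (rule sum.reindex_bij_witness[of _ uminus uminus]) (auto simp: lat_uminus)

lemma ft_cnj: "ft (\<lambda>x. cnj (u x)) k = cnj (ft u (- k))"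
  unfolding ft_def cnj_sum by (intro sum.cong) (auto simp: cis_cnj)

lemma ft_adj: "ft (adj u) k = cnj (ft u k)"
  unfolding adj_def[abs_def] using ft_cnj[of "\<lambda>x. u (- x)" k] ft_reflect[of u "- k"] by simp

lemma conv_decay:
  fixes x :: "nat \<Rightarrow> int ^ 'n" and \<psi> :: "int ^ 'n \<Rightarrow> complex"
  assumes x: "escapes x" "(\<lambda>m. direction (x m)) \<longlonglongrightarrow> \<omega>"
    and \<psi>: "\<And>z. escapes z \<Longrightarrow> (\<lambda>m. direction (z m)) \<longlonglongrightarrow> \<omega> \<Longrightarrow>
        (\<lambda>m. norm (lat (z m)) powr p * cmod (\<psi> (z m))) \<longlonglongrightarrow> 0"
  shows "(\<lambda>m. norm (lat (x m)) powr p * cmod (conv h \<psi> (x m))) \<longlonglongrightarrow> 0"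
proof (rule Lim_null_comparison)
  have pos: "\<forall>\<^sub>F m in sequentially. norm (lat (x m)) > 0"
    using x(1) unfolding filterlim_at_top_dense by blast
  have one: "(\<lambda>m. norm (lat (x m)) powr p * cmod (\<psi> (x m - y))) \<longlonglongrightarrow> 0" for y
  proof -
    note s = shifted_sequence[OF x, of y]
    have "(\<lambda>m. (norm (lat (x m - y)) / norm (lat (x m))) powr (- p) * (norm (lat (x m - y)) powr p * cmod (\<psi> (x m - y)))) \<longlonglongrightarrow> 1 powr (- p) * 0"
      by (intro tendsto_mult \<psi> s(1,3) tendsto_powr s(2) tendsto_const) simp
    then have "(\<lambda>m. (norm (lat (x m - y)) / norm (lat (x m))) powr (- p) * (norm (lat (x m - y)) powr p * cmod (\<psi> (x m - y)))) \<longlonglongrightarrow> 0" by simp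
    then show ?thesis
    proof (rule Lim_transform_eventually)
      have "\<forall>\<^sub>F m in sequentially. norm (lat (x m - y)) > 0"
        using s(1) unfolding filterlim_at_top_dense by blast
      with pos show "\<forall>\<^sub>F m in sequentially. (norm (lat (x m - y)) / norm (lat (x m))) powr (- p) * (norm (lat (x m - y)) powr p * cmod (\<psi> (x m - y)))
         = norm (lat (x m)) powr p * cmod (\<psi> (x m - y))"
        by eventually_elim (simp add: powr_divide powr_minus field_simps)
    qed
  qed
  have "(\<lambda>m. \<Sum>y | h y \<noteq> 0. cmod (h y) * (norm (lat (x m)) powr p * cmod (\<psi> (x m - y)))) \<longlonglongrightarrow> (\<Sum>y | h y \<noteq> 0. cmod (h y) * 0)"
    by (intro tendsto_intros one)
  then show "(\<lambda>m. \<Sum>y | h y \<noteq> 0. cmod (h y) * (norm (lat (x m)) powr p * cmod (\<psi> (x m - y)))) \<longlonglongrightarrow> 0" by simp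
  show "\<forall>\<^sub>F m in sequentially. norm (norm (lat (x m)) powr p * cmod (conv h \<psi> (x m)))
     \<le> (\<Sum>y | h y \<noteq> 0. cmod (h y) * (norm (lat (x m)) powr p * cmod (\<psi> (x m - y))))"
  proof (intro always_eventually allI)
    fix m
    have "cmod (conv h \<psi> (x m)) \<le> (\<Sum>y | h y \<noteq> 0. cmod (h y) * cmod (\<psi> (x m - y)))"
      unfolding conv_def by (rule order_trans[OF norm_sum]) (simp add: norm_mult)
    then have "norm (lat (x m)) powr p * cmod (conv h \<psi> (x m)) \<le> norm (lat (x m)) powr p * (\<Sum>y | h y \<noteq> 0. cmod (h y) * cmod (\<psi> (x m - y)))"
      by (rule mult_left_mono) simp
    then show "norm (norm (lat (x m)) powr p * cmod (conv h \<psi> (x m)))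
     \<le> (\<Sum>y | h y \<noteq> 0. cmod (h y) * (norm (lat (x m)) powr p * cmod (\<psi> (x m - y))))"
      by (simp add: sum_distrib_left mult.left_commute)
  qed
qed

lemma uniform_decay:
  fixes \<psi> :: "int ^ 'n \<Rightarrow> complex"
  assumes dec: "\<And>\<omega> x. norm \<omega> = 1 \<Longrightarrow> dist \<omega> \<omega>0 \<le> \<rho> \<Longrightarrow> escapes x \<Longrightarrow>
       (\<lambda>m. direction (x m)) \<longlonglongrightarrow> \<omega> \<Longrightarrow> (\<lambda>m. norm (lat (x m)) powr p * cmod (\<psi> (x m))) \<longlonglongrightarrow> 0"
    and \<eta>: "\<eta> > 0"
  shows "\<exists>R. \<forall>x. R \<le> norm (lat x) \<longrightarrow> dist (direction x) \<omega>0 \<le> \<rho> \<longrightarrow> norm (lat x) powr p * cmod (\<psi> x) \<le> \<eta>"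
proof (rule ccontr)
  assume neg: "\<not> ?thesis"
  then have "\<forall>m::nat. \<exists>x. real (Suc m) \<le> norm (lat x) \<and> dist (direction x) \<omega>0 \<le> \<rho> \<and> norm (lat x) powr p * cmod (\<psi> x) > \<eta>"
    by (meson not_le)
  then obtain x where x: "\<And>m. real (Suc m) \<le> norm (lat (x m))" "\<And>m. dist (direction (x m)) \<omega>0 \<le> \<rho>"
    "\<And>m. norm (lat (x m)) powr p * cmod (\<psi> (x m)) > \<eta>" by metis
  have sph: "\<forall>m. direction (x m) \<in> sphere 0 1"
  proof
    fix m
    have "0 < norm (lat (x m))" using x(1)[of m] by linarith
    then show "direction (x m) \<in> sphere 0 1" using norm_direction[of "x m"] by auto
  qed
  obtain \<omega> r where \<omega>: "\<omega> \<in> sphere 0 1" "strict_mono r" "((\<lambda>m. direction (x m)) \<circ> r) \<longlonglongrightarrow> \<omega>"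
    using compact_sphere[of "0 :: real ^ 'n" 1] sph unfolding compact_def by metis
  have lim: "(\<lambda>m. direction (x (r m))) \<longlonglongrightarrow> \<omega>" using \<omega>(3) by (simp add: o_def)
  have d: "dist \<omega> \<omega>0 \<le> \<rho>"
    by (rule LIMSEQ_le_const2[OF tendsto_dist[OF lim tendsto_const]]) (use x(2) in blast)
  have inf: "escapes (\<lambda>m. x (r m))"
  proof (rule filterlim_at_top_mono[OF filterlim_real_sequentially], rule always_eventually, rule allI)
    fix m
    have "real m \<le> real (r m)" using seq_suble[OF \<omega>(2), of m] by simp
    also have "\<dots> \<le> norm (lat (x (r m)))" using x(1)[of "r m"] by simp
    finally show "real m \<le> norm (lat (x (r m)))" .
  qed
  have "(\<lambda>m. norm (lat (x (r m))) powr p * cmod (\<psi> (x (r m)))) \<longlonglongrightarrow> 0"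
    by (rule dec[OF _ d inf lim]) (use \<omega>(1) in simp)
  then have "\<forall>\<^sub>F m in sequentially. norm (lat (x (r m))) powr p * cmod (\<psi> (x (r m))) < \<eta>"
    using \<eta> by (rule order_tendstoD)
  then obtain m where "norm (lat (x (r m))) powr p * cmod (\<psi> (x (r m))) < \<eta>"
    using eventually_happens' sequentially_bot by blast
  then show False using x(3)[of "r m"] by simp
qed

text \<open>
  Pointwise convergence bounds the sequence at each point. The sets on which a given bound holds are closed
  and cover the interval, so by the theorem of Baire one of them contains an interval.
\<close>

lemma baire_uniform_bound:
  fixes f :: "nat \<Rightarrow> real \<Rightarrow> complex"
  assumes ab: "\<alpha> < \<beta>" and f: "\<And>n. continuous_on UNIV (f n)" and conv: "\<And>l. l \<in> {\<alpha>..\<beta>} \<Longrightarrow> convergent (\<lambda>n. f n l)"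
  obtains a b K where "\<alpha> \<le> a" "a < b" "b \<le> \<beta>" "\<And>n l. l \<in> {a..b} \<Longrightarrow> cmod (f n l) \<le> K"
proof -
  define S where "S = {\<alpha>..\<beta>}"
  define A where "A N = {l \<in> S. \<forall>n. cmod (f n l) \<le> real N}" for N :: nat
  have clA: "closed (A N)" for N
  proof -
    have "A N = S \<inter> (\<Inter>n. {l. cmod (f n l) \<le> real N})" by (auto simp: A_def)
    moreover have "closed {l. cmod (f n l) \<le> real N}" for n
      by (intro closed_Collect_le continuous_intros f)
    ultimately show ?thesis by (auto simp: S_def intro!: closed_Int closed_INT)
  qed
  have un: "(\<Union>N. A N) = S"
  proof (intro equalityI subsetI)
    fix l assume l: "l \<in> S"
    then have "Bseq (\<lambda>n. f n l)" using conv convergent_imp_Bseq by (auto simp: S_def)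
    then obtain K where K: "\<And>n. cmod (f n l) \<le> K" by (auto simp: Bseq_def)
    obtain N :: nat where "K \<le> real N" using real_arch_simple by blast
    then have "l \<in> A N" using l K by (auto simp: A_def intro: order_trans)
    then show "l \<in> (\<Union>N. A N)" by blast
  qed (auto simp: A_def)
  have "\<exists>N. \<not> S \<subseteq> closure (S - A N)"
  proof (rule ccontr)
    assume "\<not> ?thesis"
    then have dense: "S \<subseteq> closure (S - A N)" for N by blast
    have "S \<subseteq> closure (\<Inter>(range (\<lambda>N. S - A N)))"
    proof (rule Baire)
      show "closed S" by (simp add: S_def)
      fix T assume "T \<in> range (\<lambda>N. S - A N)"
      then obtain N where T: "T = S - A N" by blast
      have "openin (top_of_set S) (S - A N)"
        using clA[of N] by (intro openin_diff) (auto simp: A_def closedin_closed_eq intro!: closed_subset)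
      then show "openin (top_of_set S) T \<and> S \<subseteq> closure T" using dense T by blast
    qed simp
    moreover have "\<Inter>(range (\<lambda>N. S - A N)) = {}" using un by blast
    ultimately have "S \<subseteq> {}" by (simp only: closure_empty)
    then show False using ab by (simp add: S_def)
  qed
  then obtain N l where l: "l \<in> S" "l \<notin> closure (S - A N)" by blast
  then obtain e where e: "e > 0" "\<And>y. y \<in> S - A N \<Longrightarrow> e \<le> dist y l"
    unfolding closure_approachable by (meson not_le)
  define a where "a = max \<alpha> (l - e / 2)"
  define b where "b = min \<beta> (l + e / 2)"
  have "a < b" using l(1) ab e(1) by (auto simp: a_def b_def S_def)
  moreover have "cmod (f n y) \<le> real N" if y: "y \<in> {a..b}" for n y
  proof -
    have "y \<in> S" using y by (auto simp: a_def b_def S_def)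
    moreover have "dist y l < e" using y e(1) by (auto simp: a_def b_def dist_real_def abs_less_iff)
    ultimately have "y \<in> A N" using e(2)[of y] by force
    then show ?thesis by (simp add: A_def)
  qed
  ultimately show ?thesis using that[of a b "real N"] by (simp add: a_def b_def)
qed

section \<open>Far fields\<close>

lemma open_Lambda: "open (Lambda TYPE('n::finite))"
proof -
  have "Lambda TYPE('n) = {\<zeta>. 2 * real CARD('n) - 4 < \<bar>\<zeta>\<bar>} \<inter> {\<zeta>. \<bar>\<zeta>\<bar> < 2 * real CARD('n)}"
    by (auto simp: Lambda_def)
  then show ?thesis by (auto intro!: open_Int open_Collect_less continuous_intros)
qed

text \<open>
  The point \<open>kappa \<omega>0 l\<close> belongs to this set, except that it may lie on the boundary of the cube (for
  negative energies); scaling it down slightly repairs this.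
\<close>

lemma packet_points:
  fixes \<omega>0 :: "real ^ 'n"
  assumes lam: "l \<in> Lambda TYPE('n)" "l \<in> {a<..<b}" and \<omega>0: "norm \<omega>0 = 1" and \<rho>: "\<rho> > 0"
  defines "P \<equiv> {k. (\<forall>i. \<bar>k $ i\<bar> < pi) \<and> phi k \<in> {a<..<b} \<and> grad_phi k \<noteq> 0 \<and>
     dist (grad_phi k /\<^sub>R norm (grad_phi k)) \<omega>0 < \<rho>}"
  shows "open P" "P \<noteq> {}"
proof -
  define Q where "Q = {k. phi k \<in> {a<..<b} \<and> grad_phi k \<noteq> 0 \<and> dist (grad_phi k /\<^sub>R norm (grad_phi k)) \<omega>0 < \<rho>}"
  have oQ: "open Q"
  proof -
    define V where "V = {k :: real ^ 'n. grad_phi k \<noteq> 0}"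
    have oV: "open V" unfolding V_def by (intro open_Collect_neq continuous_intros)
    have "open (V \<inter> (\<lambda>k. dist (grad_phi k /\<^sub>R norm (grad_phi k)) \<omega>0) -` {..<\<rho>})"
      by (rule continuous_open_preimage) (auto simp: V_def intro!: continuous_intros oV[unfolded V_def])
    moreover have "Q = {k. a < phi k} \<inter> {k. phi k < b} \<inter> (V \<inter> (\<lambda>k. dist (grad_phi k /\<^sub>R norm (grad_phi k)) \<omega>0) -` {..<\<rho>})"
      by (auto simp: Q_def V_def)
    ultimately show ?thesis by (auto intro!: open_Int open_Collect_less continuous_intros)
  qed
  have "P = (\<Inter>i. {k. \<bar>k $ i\<bar> < pi}) \<inter> Q" by (auto simp: P_def Q_def)
  then show "open P" by (auto intro!: open_Int open_INT open_Collect_less continuous_intros oQ)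
  define k1 where "k1 = kappa \<omega>0 l"
  note kap = kappa_Lambda[OF lam(1) \<omega>0, folded k1_def]
  have "grad_phi k1 \<noteq> 0" using kap(2) \<omega>0 by auto
  then have k1: "k1 \<in> Q" using kap lam(2) \<rho> by (simp add: Q_def Gamma_surface_def)
  have "((\<lambda>t. (1 - t) *\<^sub>R k1) \<longlongrightarrow> (1 - 0) *\<^sub>R k1) (at_right 0)" by (intro tendsto_intros)
  then have "\<forall>\<^sub>F t in at_right (0::real). (1 - t) *\<^sub>R k1 \<in> Q"
    using k1 oQ by (intro topological_tendstoD) auto
  moreover have "\<forall>\<^sub>F t in at_right (0::real). t < 1"
    by (rule eventually_at_right_real[of 0 1, THEN eventually_mono]) auto
  moreover have "\<forall>\<^sub>F t in at_right (0::real). 0 < t" by (rule eventually_at_right_less)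
  ultimately have "\<forall>\<^sub>F t in at_right (0::real). (1 - t) *\<^sub>R k1 \<in> Q \<and> 0 < t \<and> t < 1"
    by eventually_elim auto
  then obtain t where t: "(1 - t) *\<^sub>R k1 \<in> Q" "0 < t" "t < (1::real)"
    using eventually_happens' trivial_limit_at_right_real by blast
  have "\<bar>((1 - t) *\<^sub>R k1) $ i\<bar> < pi" for i
  proof -
    have "- pi < k1 $ i \<and> k1 $ i \<le> pi" using kap(1) by (simp add: Gamma_surface_def torus_def)
    then have "\<bar>k1 $ i\<bar> \<le> pi" by linarith
    then have "(1 - t) * \<bar>k1 $ i\<bar> \<le> (1 - t) * pi" using t by (intro mult_left_mono) auto
    also have "\<dots> < 1 * pi" using t by (intro mult_strict_right_mono) auto
    finally show ?thesis using t by (simp add: abs_mult)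
  qed
  then show "P \<noteq> {}" using t(1) by (auto simp: P_def Q_def)
qed

text \<open>
  The source \<open>s\<close> is convolved with its reflections and conjugates to obtain \<open>F\<close> with
  \<open>ft F k = \<bar>ft s k\<bar>\<^sup>2 * \<bar>ft s (- k)\<bar>\<^sup>2\<close>. This is nonnegative, and even, so that \<open>F\<close> is real and the imaginary part of
  the field is governed by the Poisson kernel. Convolutions inherit the decay of the field.
\<close>

theorem no_decaying_far_field:
  fixes s :: "int ^ 'n \<Rightarrow> complex" and \<omega>0 :: "real ^ 'n"
  assumes s: "fsupp s" and \<omega>0: "norm \<omega>0 = 1" and \<rho>: "\<rho> > 0" and I: "\<alpha> < \<beta>" "{\<alpha>..\<beta>} \<subseteq> Lambda TYPE('n)"
    and \<Psi>: "\<And>l. l \<in> {\<alpha>..\<beta>} \<Longrightarrow> is_psi_minus s l (\<Psi> l)"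
    and dec: "\<And>l \<omega> x. l \<in> {\<alpha>..\<beta>} \<Longrightarrow> norm \<omega> = 1 \<Longrightarrow> dist \<omega> \<omega>0 < \<rho> \<Longrightarrow>
       escapes x \<Longrightarrow> (\<lambda>m. direction (x m)) \<longlonglongrightarrow> \<omega> \<Longrightarrow>
       (\<lambda>m. norm (lat (x m)) powr ((real CARD('n) - 1) / 2) * cmod (\<Psi> l (x m))) \<longlonglongrightarrow> 0"
  shows "s = (\<lambda>x. 0)"
proof -
  define t where "t = conv (adj s) (conv (\<lambda>x. cnj (s x)) (\<lambda>x. s (- x)))"
  define F where "F = conv t s"
  have ts: "fsupp t" unfolding t_def by (intro fsupp_conv fsupp_adj fsupp_cnj fsupp_reflect s)
  have Fs: "fsupp F" unfolding F_def by (intro fsupp_conv ts s)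
  have ftF: "ft F k = of_real ((cmod (ft s k))\<^sup>2 * (cmod (ft s (- k)))\<^sup>2)" for k
  proof -
    have "ft F k = (ft s k * cnj (ft s k)) * (ft s (- k) * cnj (ft s (- k)))"
      by (simp add: F_def t_def ft_conv fsupp_conv fsupp_adj fsupp_cnj fsupp_reflect s ft_adj ft_cnj ft_reflect mult_ac)
    then show ?thesis by (simp only: complex_norm_square[symmetric] of_real_mult)
  qed
  have Fpos: "ft F k = of_real (cmod (ft F k))" for k
    unfolding ftF norm_of_real by (simp add: abs_of_nonneg)
  have "(\<lambda>x. cnj (F x)) = F"
    by (rule ft_inject[OF fsupp_cnj[OF Fs] Fs]) (simp add: ft_cnj ftF mult.commute)
  then have Fcnj: "cnj (F x) = F x" for x by metis
  define J where "J l x = - Im (conv t (\<Psi> l) x)" for l x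
  have sm: "smoothed F n l x = of_real (- Im (resolvent (spectral_point l (eps n)) F x))" for n l x
    unfolding smoothed_def poisson_def using fcoef_poisson[OF Fs Fcnj eps_pos] by simp
  have lim: "(\<lambda>n. smoothed F n l x) \<longlonglongrightarrow> of_real (J l x)" if l: "l \<in> {\<alpha>..\<beta>}" for l x
  proof -
    have "is_psi_minus F l (conv t (\<Psi> l))" unfolding F_def by (rule psi_minus_conv[OF \<Psi>[OF l] s ts])
    then have 1: "((\<lambda>\<epsilon>. resolvent (spectral_point l \<epsilon>) F x) \<longlongrightarrow> conv t (\<Psi> l) x) (at_right 0)"
      by (simp add: is_psi_minus_def)
    have 2: "filterlim eps (at_right 0) sequentially"
      by (rule filterlim_at_withinI) (auto simp: eps_lim eps_pos)
    have "(\<lambda>n. resolvent (spectral_point l (eps n)) F x) \<longlonglongrightarrow> conv t (\<Psi> l) x"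
      using filterlim_compose[OF 1 2] .
    then show ?thesis unfolding sm J_def by (intro tendsto_intros)
  qed
  \<comment> \<open>the interval has to fit into one window of length \<open>2\<pi>\<close>\<close>
  define \<beta>' where "\<beta>' = min \<beta> (\<alpha> + 1)"
  have \<beta>': "\<alpha> < \<beta>'" "\<beta>' \<le> \<beta>" "\<beta>' \<le> \<alpha> + 1" using I(1) by (auto simp: \<beta>'_def)
  obtain a b K where ab: "\<alpha> \<le> a" "a < b" "b \<le> \<beta>'" and K: "\<And>n l. l \<in> {a..b} \<Longrightarrow> cmod (smoothed F n l 0) \<le> K"
  proof (rule baire_uniform_bound[OF \<beta>'(1), of "\<lambda>n l. smoothed F n l 0"])
    show "continuous_on UNIV (\<lambda>l. smoothed F n l 0)" for n by (rule continuous_smoothed)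
    show "convergent (\<lambda>n. smoothed F n l 0)" if "l \<in> {\<alpha>..\<beta>'}" for l
      using lim[of l 0] that \<beta>' by (auto intro: convergentI)
  qed (use that in blast)
  have sub: "{a..b} \<subseteq> {\<alpha>..\<beta>}" using ab \<beta>' by auto
  interpret boundary_density F a a b K J
  proof
    have "b \<le> a + 1" using ab \<beta>' by linarith
    then show "a - pi \<le> a" "b \<le> a + pi" using pi_gt3 by auto
    show "(\<lambda>n. smoothed F n l x) \<longlonglongrightarrow> of_real (J l x)" if "l \<in> {a..b}" for l x
      using lim that sub by blast
  qed (use Fs Fpos K in auto)
  \<comment> \<open>the middle third leaves room on both sides for continuous cutoffs of the energy\<close>
  define a' where "a' = (2 * a + b) / 3"
  define b' where "b' = (a + 2 * b) / 3"
  have ab': "a < a'" "a' < b'" "b' < b" using ab by (auto simp: a'_def b'_def)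
  define U where "U = {u. dist u \<omega>0 \<le> \<rho> / 2}"
  have decay: "\<exists>R. \<forall>x. R \<le> norm (lat x) \<longrightarrow> direction x \<in> U \<longrightarrow>
        norm (lat x) powr ((real CARD('n) - 1) / 2) * \<bar>J l x\<bar> \<le> \<eta>" if l: "l \<in> {a'..b'}" and \<eta>: "\<eta> > 0" for l \<eta>
  proof -
    have l': "l \<in> {\<alpha>..\<beta>}" using l ab' sub by auto
    have "\<exists>R. \<forall>x. R \<le> norm (lat x) \<longrightarrow> dist (direction x) \<omega>0 \<le> \<rho> / 2 \<longrightarrow>
        norm (lat x) powr ((real CARD('n) - 1) / 2) * cmod (conv t (\<Psi> l) x) \<le> \<eta>"
    proof (rule uniform_decay[OF _ \<eta>])
      fix \<omega> :: "real ^ 'n" and x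
      assume w: "norm \<omega> = 1" "dist \<omega> \<omega>0 \<le> \<rho> / 2" and x: "escapes x" "(\<lambda>m. direction (x m)) \<longlonglongrightarrow> \<omega>"
      have w2: "dist \<omega> \<omega>0 < \<rho>" using w(2) \<rho> by linarith
      show "(\<lambda>m. norm (lat (x m)) powr ((real CARD('n) - 1) / 2) * cmod (conv t (\<Psi> l) (x m))) \<longlonglongrightarrow> 0"
        by (rule conv_decay[OF x dec[OF l' w(1) w2]])
    qed
    then obtain R where R: "\<And>x. R \<le> norm (lat x) \<Longrightarrow> direction x \<in> U \<Longrightarrow>
        norm (lat x) powr ((real CARD('n) - 1) / 2) * cmod (conv t (\<Psi> l) x) \<le> \<eta>" by (auto simp: U_def)
    have "norm (lat x) powr ((real CARD('n) - 1) / 2) * \<bar>J l x\<bar> \<le> \<eta>" if "R \<le> norm (lat x)" "direction x \<in> U" for x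
      by (rule order_trans[OF mult_left_mono R[OF that]]) (auto simp: J_def abs_Im_le_cmod)
    then show ?thesis by blast
  qed
  define l0 where "l0 = (a' + b') / 2"
  have l0: "l0 \<in> {a'<..<b'}" using ab' by (simp add: l0_def)
  have l0L: "l0 \<in> Lambda TYPE('n)" using l0 ab' sub I(2) by auto
  define P where "P = {k. (\<forall>i. \<bar>k $ i\<bar> < pi) \<and> phi k \<in> {a'<..<b'} \<and> grad_phi k \<noteq> 0 \<and>
     dist (grad_phi k /\<^sub>R norm (grad_phi k)) \<omega>0 < \<rho> / 2}"
  have P: "open P" "P \<noteq> {}" unfolding P_def using packet_points[OF l0L l0 \<omega>0, of "\<rho> / 2"] \<rho> by auto
  have "ft F k0 = 0" if k0: "k0 \<in> P" for k0
  proof -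
    define v where "v = grad_phi k0"
    have v: "v \<noteq> 0" "dist (v /\<^sub>R norm v) \<omega>0 < \<rho> / 2" using k0 by (auto simp: P_def v_def)
    have "isCont (\<lambda>y. dist (y /\<^sub>R norm y) \<omega>0) v" using v(1) by (intro continuous_intros) auto
    then have "\<forall>\<^sub>F y in at v. dist (y /\<^sub>R norm y) \<omega>0 < \<rho> / 2"
      unfolding isCont_def using v(2) by (rule order_tendstoD)
    then obtain e where e: "e > 0" "\<And>y. y \<noteq> v \<Longrightarrow> dist y v < e \<Longrightarrow> dist (y /\<^sub>R norm y) \<omega>0 < \<rho> / 2"
      by (auto simp: eventually_at)
    have e2: "dist (y /\<^sub>R norm y) \<omega>0 < \<rho> / 2" if "dist y v < e" for y
      using e(2)[of y] that v(2) by (cases "y = v") auto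
    define \<delta> where "\<delta> = min e (norm v / 2)"
    have \<delta>: "0 < \<delta>" "\<delta> \<le> norm v / 2" "\<delta> \<le> e" using e(1) v(1) by (auto simp: \<delta>_def)
    show ?thesis
    proof (rule vanishing_point[OF ab'(1,3) \<delta>(1) \<delta>(2)[unfolded v_def]])
      fix x :: "int ^ 'n" and n :: nat assume n: "1 \<le> n" and d: "dist (lat x /\<^sub>R real n) (grad_phi k0) < \<delta>"
      have "dist ((lat x /\<^sub>R real n) /\<^sub>R norm (lat x /\<^sub>R real n)) \<omega>0 < \<rho> / 2"
        by (rule e2) (use d \<delta>(3) in \<open>simp add: v_def\<close>)
      moreover have "(lat x /\<^sub>R real n) /\<^sub>R norm (lat x /\<^sub>R real n) = direction x"
        using n by (simp add: direction_def)
      ultimately show "direction x \<in> U" by (simp add: U_def)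
    next
      show "\<exists>R. \<forall>x. R \<le> norm (lat x) \<longrightarrow> direction x \<in> U \<longrightarrow> norm (lat x) powr ((real CARD('n) - 1) / 2) * \<bar>J l x\<bar> \<le> \<eta>"
        if "l \<in> {a'..b'}" "\<eta> > 0" for l \<eta> using that by (rule decay)
    qed (use k0 in \<open>auto simp: P_def\<close>)
  qed
  then have F0: "F = (\<lambda>x. 0)" by (rule ft_zero_on_open[OF Fs P])
  show ?thesis
  proof (rule ccontr)
    assume nz: "s \<noteq> (\<lambda>x. 0)"
    have "ft s k * ft (\<lambda>x. s (- x)) k = 0" for k
    proof -
      have "ft F k = 0" by (simp add: F0 ft_def)
      then show ?thesis using ftF[of k] by (simp add: ft_reflect)
    qed
    from ft_mult_zero[OF s fsupp_reflect[OF s] this nz] have "s (- x) = 0" for x by metis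
    then have "s x = 0" for x using \<open>\<And>x. s (- x) = 0\<close>[of "- x"] by simp
    then show False using nz by auto
  qed
qed

lemma far_field_limit:
  fixes f :: "int ^ 'n \<Rightarrow> complex" and x :: "nat \<Rightarrow> int ^ 'n"
  assumes cont: "continuous_on (sphere 0 1) (\<lambda>\<omega>. a \<omega> lam)"
    and bigo: "(\<lambda>x. cmod (\<psi> x -
                 exp (- \<i> * complex_of_real (mu (direction x) lam * norm (lat x)))
                 / complex_of_real (norm (lat x) powr ((real CARD('n) - 1) / 2))
                 * a (direction x) lam))
            \<in> O[filtercomap (\<lambda>x. norm (lat x)) at_top](
                \<lambda>x. norm (lat x) powr (- (real CARD('n) + 1) / 2))"
    and x: "escapes x" "(\<lambda>m. direction (x m)) \<longlonglongrightarrow> \<omega>"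
  shows "(\<lambda>m. of_real (norm (lat (x m)) powr ((real CARD('n) - 1) / 2)) *
      cis (phase lam (x m)) * \<psi> (x m)) \<longlonglongrightarrow> a \<omega> lam"
proof -
  define p where "p = (real CARD('n) - 1) / 2"
  define E where "E z = \<psi> z - cis (- (phase lam z)) / of_real (norm (lat z) powr p) * a (direction z) lam" for z
  have ph: "exp (- \<i> * complex_of_real (mu (direction z) lam * norm (lat z))) = cis (- (phase lam z))" for z
  proof -
    have "mu (direction z) lam * norm (lat z) = kappa (direction z) lam \<bullet> (norm (lat z) *\<^sub>R direction z)"
      by (simp add: mu_def mult.commute)
    also have "\<dots> = phase lam z" by (simp only: norm_scale_direction)
    finally show ?thesis by (simp add: cis_conv_exp)
  qed
  obtain C where C: "C > 0" "\<forall>\<^sub>F z in filtercomap (\<lambda>z. norm (lat z)) at_top. cmod (E z) \<le> C * norm (lat z) powr (- (real CARD('n) + 1) / 2)"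
    using bigo unfolding ph p_def[symmetric] E_def[symmetric] by (auto elim!: landau_o.bigE)
  have fl: "filterlim x (filtercomap (\<lambda>z. norm (lat z)) at_top) sequentially"
    using x(1) by (simp add: filterlim_filtercomap_iff o_def)
  have ev: "\<forall>\<^sub>F m in sequentially. cmod (E (x m)) \<le> C * norm (lat (x m)) powr (- (real CARD('n) + 1) / 2)"
    using fl C(2) by (rule eventually_compose_filterlim[rotated])
  have pos: "\<forall>\<^sub>F m in sequentially. norm (lat (x m)) > 0"
    using x(1) unfolding filterlim_at_top_dense by blast
  have aw: "(\<lambda>m. a (direction (x m)) lam) \<longlonglongrightarrow> a \<omega> lam"
  proof (rule continuous_on_tendsto_compose[OF cont x(2)])
    show "\<omega> \<in> sphere 0 1" using direction_limit_unit[OF x] by simp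
    show "\<forall>\<^sub>F m in sequentially. direction (x m) \<in> sphere 0 1"
      using eventually_direction_unit[OF x(1)] by eventually_elim simp
  qed
  have small: "(\<lambda>m. of_real (norm (lat (x m)) powr p) * cis (phase lam (x m)) * E (x m)) \<longlonglongrightarrow> 0"
  proof (rule Lim_null_comparison)
    show "\<forall>\<^sub>F m in sequentially. cmod (of_real (norm (lat (x m)) powr p) * cis (phase lam (x m)) * E (x m)) \<le> C * inverse (norm (lat (x m)))"
      using ev pos
    proof eventually_elim
      case (elim m)
      have "cmod (of_real (norm (lat (x m)) powr p) * cis (phase lam (x m)) * E (x m)) = norm (lat (x m)) powr p * cmod (E (x m))"
        by (simp add: norm_mult)
      also have "\<dots> \<le> norm (lat (x m)) powr p * (C * norm (lat (x m)) powr (- (real CARD('n) + 1) / 2))"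
        by (intro mult_left_mono elim) simp
      also have "\<dots> = C * (norm (lat (x m)) powr p * norm (lat (x m)) powr (- (real CARD('n) + 1) / 2))" by simp
      also have "norm (lat (x m)) powr p * norm (lat (x m)) powr (- (real CARD('n) + 1) / 2) = norm (lat (x m)) powr (-1)"
        unfolding powr_add[symmetric] by (intro arg_cong2[where f = "(powr)"]) (simp_all add: p_def field_simps)
      also have "norm (lat (x m)) powr (-1) = inverse (norm (lat (x m)))" using elim by (simp add: powr_minus)
      finally show ?case .
    qed
    have "(\<lambda>m. C * inverse (norm (lat (x m)))) \<longlonglongrightarrow> C * 0" by (intro tendsto_intros tendsto_inverse_0_at_top x(1))
    then show "(\<lambda>m. C * inverse (norm (lat (x m)))) \<longlonglongrightarrow> 0" by simp
  qed
  have "(\<lambda>m. of_real (norm (lat (x m)) powr p) * cis (phase lam (x m)) * E (x m) + a (direction (x m)) lam) \<longlonglongrightarrow> 0 + a \<omega> lam"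
    by (intro tendsto_add small aw)
  then have "(\<lambda>m. of_real (norm (lat (x m)) powr p) * cis (phase lam (x m)) * E (x m) + a (direction (x m)) lam) \<longlonglongrightarrow> a \<omega> lam" by simp
  then show ?thesis unfolding p_def[symmetric]
  proof (rule Lim_transform_eventually)
    show "\<forall>\<^sub>F m in sequentially. of_real (norm (lat (x m)) powr p) * cis (phase lam (x m)) * E (x m) + a (direction (x m)) lam
      = of_real (norm (lat (x m)) powr p) * cis (phase lam (x m)) * \<psi> (x m)"
      using pos
    proof eventually_elim
      case (elim m)
      define N where "N = complex_of_real (norm (lat (x m)) powr p)"
      have N: "N \<noteq> 0" using elim by (simp add: N_def)
      define w where "w = cis (phase lam (x m))"
      have w: "w * cis (- (phase lam (x m))) = 1" by (simp add: w_def cis_mult)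
      have "N * w * (cis (- (phase lam (x m))) / N * a (direction (x m)) lam) = a (direction (x m)) lam"
        using N w by (simp add: field_simps)
      then show ?case unfolding E_def N_def[symmetric] w_def[symmetric] by (simp add: right_diff_distrib)
    qed
  qed
qed

text \<open>
  A translation by \<open>y\<close> multiplies the far field in the direction \<open>\<omega>\<close> by \<open>cis (kappa \<omega> lam \<bullet> lat y)\<close>, by
  \<open>phase_limit\<close>.
\<close>

lemma far_field_limit_conv:
  fixes x :: "nat \<Rightarrow> int ^ 'n"
  assumes lam: "lam \<in> Lambda TYPE('n)"
    and ff: "\<And>x. escapes x \<Longrightarrow> (\<lambda>m. direction (x m)) \<longlonglongrightarrow> \<omega> \<Longrightarrow>
      (\<lambda>m. of_real (norm (lat (x m)) powr p) * cis (phase lam (x m)) * \<psi> (x m)) \<longlonglongrightarrow> c"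
    and x: "escapes x" "(\<lambda>m. direction (x m)) \<longlonglongrightarrow> \<omega>"
  shows "(\<lambda>m. of_real (norm (lat (x m)) powr p) * cis (phase lam (x m)) * conv h \<psi> (x m))
     \<longlonglongrightarrow> ft h (kappa \<omega> lam) * c"
proof -
  have pos: "\<forall>\<^sub>F m in sequentially. norm (lat (x m)) > 0"
    using x(1) unfolding filterlim_at_top_dense by blast
  have one: "(\<lambda>m. of_real (norm (lat (x m)) powr p) * cis (phase lam (x m)) * \<psi> (x m - y))
     \<longlonglongrightarrow> cis (kappa \<omega> lam \<bullet> lat y) * c" for y
  proof -
    note s = shifted_sequence[OF x, of y]
    have 1: "(\<lambda>m. (norm (lat (x m - y)) / norm (lat (x m))) powr (- p)) \<longlonglongrightarrow> 1 powr (- p)"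
      by (intro tendsto_powr s(2) tendsto_const) simp
    have "(\<lambda>m. of_real ((norm (lat (x m - y)) / norm (lat (x m))) powr (- p)) *
       (cis (phase lam (x m)) * cis (- (phase lam (x m - y)))) *
       (of_real (norm (lat (x m - y)) powr p) * cis (phase lam (x m - y)) * \<psi> (x m - y)))
       \<longlonglongrightarrow> of_real (1 powr (- p)) * cis (kappa \<omega> lam \<bullet> lat y) * c"
      by (intro tendsto_mult tendsto_of_real 1 phase_limit[OF lam x] ff s(1,3))
    then have "(\<lambda>m. of_real ((norm (lat (x m - y)) / norm (lat (x m))) powr (- p)) *
       (cis (phase lam (x m)) * cis (- (phase lam (x m - y)))) *
       (of_real (norm (lat (x m - y)) powr p) * cis (phase lam (x m - y)) * \<psi> (x m - y)))
       \<longlonglongrightarrow> cis (kappa \<omega> lam \<bullet> lat y) * c" by simp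
    then show ?thesis
    proof (rule Lim_transform_eventually)
      have "\<forall>\<^sub>F m in sequentially. norm (lat (x m - y)) > 0"
        using s(1) unfolding filterlim_at_top_dense by blast
      with pos show "\<forall>\<^sub>F m in sequentially. of_real ((norm (lat (x m - y)) / norm (lat (x m))) powr (- p)) *
       (cis (phase lam (x m)) * cis (- (phase lam (x m - y)))) *
       (of_real (norm (lat (x m - y)) powr p) * cis (phase lam (x m - y)) * \<psi> (x m - y))
         = of_real (norm (lat (x m)) powr p) * cis (phase lam (x m)) * \<psi> (x m - y)"
      proof eventually_elim
        case (elim m)
        have r: "(norm (lat (x m - y)) / norm (lat (x m))) powr (- p) * norm (lat (x m - y)) powr p = norm (lat (x m)) powr p"
          using elim by (simp add: powr_divide powr_minus field_simps)
        have ph: "cis (- t) * cis t = 1" for t by (simp add: cis_mult)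
        have "A * (B * D) * (G * H * V) = (A * G) * B * (D * H) * V" for A B D G H V :: complex by (simp add: mult_ac)
        then show ?case by (simp only: ph r of_real_mult[symmetric] mult_1_right)
      qed
    qed
  qed
  have "(\<lambda>m. \<Sum>y | h y \<noteq> 0. h y * (of_real (norm (lat (x m)) powr p) * cis (phase lam (x m)) * \<psi> (x m - y)))
     \<longlonglongrightarrow> (\<Sum>y | h y \<noteq> 0. h y * (cis (kappa \<omega> lam \<bullet> lat y) * c))"
    by (intro tendsto_intros one)
  then show ?thesis
    by (simp add: conv_def ft_def sum_distrib_left sum_distrib_right mult_ac)
qed

text \<open>
  Round the points \<open>m *\<^sub>R \<omega>\<close> to the lattice.
\<close>

lemma direction_sequence:
  fixes \<omega> :: "real ^ 'n"
  assumes "norm \<omega> = 1"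
  obtains x :: "nat \<Rightarrow> int ^ 'n" where "escapes x" "(\<lambda>m. direction (x m)) \<longlonglongrightarrow> \<omega>"
proof -
  define x where "x m = (\<chi> i. \<lfloor>real (Suc m) * \<omega> $ i\<rfloor>)" for m
  have comp: "(\<lambda>m. (lat (x m) /\<^sub>R real (Suc m)) $ i) \<longlonglongrightarrow> \<omega> $ i" for i
  proof (rule tendsto_sandwich)
    show "\<forall>\<^sub>F m in sequentially. \<omega> $ i - inverse (real (Suc m)) \<le> (lat (x m) /\<^sub>R real (Suc m)) $ i"
    proof (intro always_eventually allI)
      fix m
      have "real (Suc m) * \<omega> $ i - 1 \<le> of_int \<lfloor>real (Suc m) * \<omega> $ i\<rfloor>" by linarith
      then have "inverse (real (Suc m)) * (real (Suc m) * \<omega> $ i - 1) \<le> inverse (real (Suc m)) * of_int \<lfloor>real (Suc m) * \<omega> $ i\<rfloor>"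
        by (intro mult_left_mono) auto
      moreover have "inverse (real (Suc m)) * (real (Suc m) * \<omega> $ i - 1) = \<omega> $ i - inverse (real (Suc m))"
        by (simp add: right_diff_distrib mult.assoc[symmetric] del: of_nat_Suc)
      ultimately show "\<omega> $ i - inverse (real (Suc m)) \<le> (lat (x m) /\<^sub>R real (Suc m)) $ i"
        by (simp add: x_def lat_def del: of_nat_Suc)
    qed
    show "\<forall>\<^sub>F m in sequentially. (lat (x m) /\<^sub>R real (Suc m)) $ i \<le> \<omega> $ i"
    proof (intro always_eventually allI)
      fix m
      have "inverse (real (Suc m)) * of_int \<lfloor>real (Suc m) * \<omega> $ i\<rfloor> \<le> inverse (real (Suc m)) * (real (Suc m) * \<omega> $ i)"
        by (intro mult_left_mono) auto
      also have "\<dots> = \<omega> $ i" by (simp add: mult.assoc[symmetric] del: of_nat_Suc)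
      finally show "(lat (x m) /\<^sub>R real (Suc m)) $ i \<le> \<omega> $ i" by (simp add: x_def lat_def del: of_nat_Suc)
    qed
    have "(\<lambda>m. \<omega> $ i - inverse (real (Suc m))) \<longlonglongrightarrow> \<omega> $ i - 0"
      by (intro tendsto_intros LIMSEQ_inverse_real_of_nat)
    then show "(\<lambda>m. \<omega> $ i - inverse (real (Suc m))) \<longlonglongrightarrow> \<omega> $ i" by simp
  qed auto
  have v: "(\<lambda>m. lat (x m) /\<^sub>R real (Suc m)) \<longlonglongrightarrow> \<omega>" by (rule vec_tendstoI) (rule comp)
  have n: "(\<lambda>m. norm (lat (x m) /\<^sub>R real (Suc m))) \<longlonglongrightarrow> 1" using tendsto_norm[OF v] assms by simp
  have "filterlim (\<lambda>m. norm (lat (x m) /\<^sub>R real (Suc m)) * real (Suc m)) at_top sequentially"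
    by (rule filterlim_tendsto_pos_mult_at_top[OF n zero_less_one filterlim_compose[OF filterlim_real_sequentially filterlim_Suc]])
  moreover have "norm (lat (x m) /\<^sub>R real (Suc m)) * real (Suc m) = norm (lat (x m))" for m by simp
  ultimately have 1: "escapes x" by (simp only:)
  have "(\<lambda>m. (lat (x m) /\<^sub>R real (Suc m)) /\<^sub>R norm (lat (x m) /\<^sub>R real (Suc m))) \<longlonglongrightarrow> \<omega> /\<^sub>R 1"
    by (intro tendsto_intros v n) simp
  moreover have "(lat (x m) /\<^sub>R real (Suc m)) /\<^sub>R norm (lat (x m) /\<^sub>R real (Suc m)) = direction (x m)" for m
    by (simp add: direction_def)
  ultimately have 2: "(\<lambda>m. direction (x m)) \<longlonglongrightarrow> \<omega>" by simp
  from 1 2 show ?thesis by (rule that)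
qed

section \<open>Phase retrieval\<close>

lemma fsupp_bounded:
  fixes f :: "int ^ 'n \<Rightarrow> complex"
  assumes "bounded D" "lat ` {x. f x \<noteq> 0} \<subseteq> D"
  shows "fsupp f"
proof -
  obtain R where R: "R > 0" "\<And>y. y \<in> D \<Longrightarrow> norm y \<le> R" using assms(1) by (auto simp: bounded_pos)
  have "{x. f x \<noteq> 0} \<subseteq> {x. norm (lat x) \<le> R}" using assms(2) R(2) by auto
  then show ?thesis unfolding fsupp_def using card_lattice_ball(1)[of R] R(1) by (auto intro: finite_subset)
qed

text \<open>
  Both sides are the outgoing field of the source \<open>conv h f\<close>.
\<close>

lemma psi_minus_cross:
  assumes f: "fsupp f" "is_psi_minus f lam \<psi>" "fsupp h" "is_psi_minus h lam \<xi>"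
  shows "conv h \<psi> = conv f \<xi>"
proof -
  have "is_psi_minus (conv h f) lam (conv h \<psi>)" by (rule psi_minus_conv[OF f(2) f(1) f(3)])
  moreover have "is_psi_minus (conv h f) lam (conv f \<xi>)"
    unfolding conv_commute[OF f(3) f(1)] by (rule psi_minus_conv[OF f(4) f(3) f(1)])
  ultimately show ?thesis by (rule psi_minus_unique)
qed

text \<open>
  Here \<open>A\<close> is the far-field amplitude of \<open>f\<^sub>0\<close>. It cannot be cancelled pointwise, but the identity says that the
  amplitude of \<open>p * f\<^sub>0\<close> vanishes, where \<open>p\<close> is the difference of the autocorrelations of \<open>f\<close> and \<open>g\<close>.
\<close>

lemma modulus_identity_forces_equal_powers:
  fixes f g f\<^sub>0 :: "int ^ 'n \<Rightarrow> complex" and \<omega>0 :: "real ^ 'n"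
  assumes fin: "fsupp f" "fsupp g" "fsupp f\<^sub>0" and f0: "f\<^sub>0 \<noteq> (\<lambda>x. 0)"
    and \<omega>0: "norm \<omega>0 = 1" and \<rho>: "\<rho> > 0" and I: "\<alpha> < \<beta>" "{\<alpha>..\<beta>} \<subseteq> Lambda TYPE('n)"
    and \<Psi>: "\<And>l. l \<in> {\<alpha>..\<beta>} \<Longrightarrow> is_psi_minus f\<^sub>0 l (\<Psi> l)"
    and lim: "\<And>l \<omega> x. l \<in> {\<alpha>..\<beta>} \<Longrightarrow> escapes x \<Longrightarrow> (\<lambda>m. direction (x m)) \<longlonglongrightarrow> \<omega> \<Longrightarrow>
      (\<lambda>m. of_real (norm (lat (x m)) powr ((real CARD('n) - 1) / 2)) *
         cis (phase l (x m)) * \<Psi> l (x m)) \<longlonglongrightarrow> A \<omega> l"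
    and eq: "\<And>l \<omega>. l \<in> {\<alpha>..\<beta>} \<Longrightarrow> norm \<omega> = 1 \<Longrightarrow> dist \<omega> \<omega>0 < \<rho> \<Longrightarrow>
       cmod (ft f (kappa \<omega> l) * A \<omega> l) = cmod (ft g (kappa \<omega> l) * A \<omega> l)"
  shows "(cmod (ft f k))\<^sup>2 = (cmod (ft g k))\<^sup>2"
proof -
  define p where "p x = conv f (adj f) x - conv g (adj g) x" for x
  have c: "fsupp (conv f (adj f))" "fsupp (conv g (adj g))" by (intro fsupp_conv fsupp_adj fin)+
  have p: "fsupp p" unfolding p_def[abs_def] by (rule ft_diff_add(1)[OF c])
  have ftp: "ft p k = of_real ((cmod (ft f k))\<^sup>2 - (cmod (ft g k))\<^sup>2)" for k
    unfolding p_def[abs_def] ft_diff_add(2)[OF c] of_real_diff complex_norm_square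
    by (simp add: ft_conv fsupp_adj fin ft_adj)
  have "conv p f\<^sub>0 = (\<lambda>x. 0)"
  proof (rule no_decaying_far_field[OF _ \<omega>0 \<rho> I])
    show "fsupp (conv p f\<^sub>0)" by (rule fsupp_conv[OF p fin(3)])
    show "is_psi_minus (conv p f\<^sub>0) l (conv p (\<Psi> l))" if "l \<in> {\<alpha>..\<beta>}" for l
      by (rule psi_minus_conv[OF \<Psi>[OF that] fin(3) p])
    fix l \<omega> and x :: "nat \<Rightarrow> int ^ 'n"
    assume l: "l \<in> {\<alpha>..\<beta>}" and w: "norm \<omega> = 1" "dist \<omega> \<omega>0 < \<rho>"
      and x: "escapes x" "(\<lambda>m. direction (x m)) \<longlonglongrightarrow> \<omega>"
    have "(cmod (ft f (kappa \<omega> l)))\<^sup>2 * (cmod (A \<omega> l))\<^sup>2 = (cmod (ft g (kappa \<omega> l)))\<^sup>2 * (cmod (A \<omega> l))\<^sup>2"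
      using eq[OF l w] by (simp add: norm_mult flip: power_mult_distrib)
    then have z: "ft p (kappa \<omega> l) * A \<omega> l = 0" by (auto simp: ftp)
    have lL: "l \<in> Lambda TYPE('n)" using l I(2) by blast
    have "(\<lambda>m. of_real (norm (lat (x m)) powr ((real CARD('n) - 1) / 2)) * cis (phase l (x m)) * conv p (\<Psi> l) (x m))
       \<longlonglongrightarrow> ft p (kappa \<omega> l) * A \<omega> l"
      by (rule far_field_limit_conv[OF lL _ x]) (rule lim[OF l])
    then have "(\<lambda>m. cmod (of_real (norm (lat (x m)) powr ((real CARD('n) - 1) / 2)) * cis (phase l (x m)) * conv p (\<Psi> l) (x m))) \<longlonglongrightarrow> 0"
      unfolding z by (rule tendsto_norm_zero)
    then show "(\<lambda>m. norm (lat (x m)) powr ((real CARD('n) - 1) / 2) * cmod (conv p (\<Psi> l) (x m))) \<longlonglongrightarrow> 0"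
      by (simp add: norm_mult)
  qed
  then have "p = (\<lambda>x. 0)" by (rule conv_zero_divisor[OF p fin(3) _ f0])
  then have "ft p k = 0" by (simp add: ft_def)
  then have "complex_of_real ((cmod (ft f k))\<^sup>2 - (cmod (ft g k))\<^sup>2) = 0" by (simp only: ftp)
  then show ?thesis by (simp only: of_real_eq_0_iff)
qed

text \<open>
  Expanding the squares leaves \<open>Re (ft w * cnj (ft f\<^sub>0)) = 0\<close> for \<open>w = f - g\<close>. In position space this is
  \<open>P + Q = 0\<close> for two functions whose supports lie on different sides of the hyperplane orthogonal to \<open>v\<close>
  through the origin.
\<close>

lemma separated_phase_retrieval:
  fixes f g f\<^sub>0 :: "int ^ 'n \<Rightarrow> complex"
  assumes fin: "fsupp f" "fsupp g" "fsupp f\<^sub>0" and f0: "f\<^sub>0 \<noteq> (\<lambda>x. 0)"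
    and sep: "\<And>y z. f y \<noteq> 0 \<or> g y \<noteq> 0 \<Longrightarrow> f\<^sub>0 z \<noteq> 0 \<Longrightarrow> v \<bullet> lat z < v \<bullet> lat y"
    and m: "\<And>k. (cmod (ft f k))\<^sup>2 = (cmod (ft g k))\<^sup>2"
      "\<And>k. (cmod (ft f k + ft f\<^sub>0 k))\<^sup>2 = (cmod (ft g k + ft f\<^sub>0 k))\<^sup>2"
  shows "f = g"
proof -
  define w where "w x = f x - g x" for x
  have w: "fsupp w" and ftw: "ft w k = ft f k - ft g k" for k unfolding w_def[abs_def] by (rule ft_diff_add[OF fin(1,2)])+
  define P where "P = conv w (adj f\<^sub>0)"
  define Q where "Q = conv (adj w) f\<^sub>0"
  have PQ: "fsupp P" "fsupp Q" unfolding P_def Q_def by (intro fsupp_conv fsupp_adj w fin)+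
  have "(\<lambda>x. P x + Q x) = (\<lambda>x. 0)"
  proof (rule ft_inject[OF ft_diff_add(3)[OF PQ]])
    show "fsupp (\<lambda>x :: int ^ 'n. 0 :: complex)" by (simp add: fsupp_def)
    fix k
    have ex: "(cmod (a + b))\<^sup>2 = (cmod a)\<^sup>2 + (cmod b)\<^sup>2 + 2 * Re (a * cnj b)" for a b :: complex
      by (simp only: cmod_power2 complex_eq_iff plus_complex.sel times_complex.sel cnj.sel) (simp add: power2_eq_square algebra_simps)
    have "Re (ft f k * cnj (ft f\<^sub>0 k)) = Re (ft g k * cnj (ft f\<^sub>0 k))"
      using m(1)[of k] m(2)[of k] unfolding ex by linarith
    then have re: "Re (ft w k * cnj (ft f\<^sub>0 k)) = 0" by (simp add: ftw left_diff_distrib)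
    have "ft (\<lambda>x. P x + Q x) k = ft w k * cnj (ft f\<^sub>0 k) + cnj (ft w k * cnj (ft f\<^sub>0 k))"
      by (simp only: ft_diff_add(4)[OF PQ]) (simp add: P_def Q_def ft_conv fsupp_adj w fin ft_adj)
    also have "\<dots> = 0" unfolding complex_add_cnj using re by simp
    finally show "ft (\<lambda>x. P x + Q x) k = ft (\<lambda>x. 0) k" by (simp add: ft_def)
  qed
  then have sum: "P x + Q x = 0" for x by metis
  have nzw: "f y \<noteq> 0 \<or> g y \<noteq> 0" if "w y \<noteq> 0" for y using that by (auto simp: w_def)
  have Ppos: "v \<bullet> lat x > 0" if x: "P x \<noteq> 0" for x
  proof -
    obtain y where y: "w y \<noteq> 0" "adj f\<^sub>0 (x - y) \<noteq> 0"
      using x unfolding P_def conv_def by (metis (mono_tags, lifting) mem_Collect_eq mult_eq_0_iff sum.neutral)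
    then have "f\<^sub>0 (y - x) \<noteq> 0" by (simp add: adj_def)
    from sep[OF nzw[OF y(1)] this] show ?thesis by (simp add: lat_diff inner_diff_right)
  qed
  have Qneg: "v \<bullet> lat x < 0" if x: "Q x \<noteq> 0" for x
  proof -
    obtain y where y: "adj w y \<noteq> 0" "f\<^sub>0 (x - y) \<noteq> 0"
      using x unfolding Q_def conv_def by (metis (mono_tags, lifting) mem_Collect_eq mult_eq_0_iff sum.neutral)
    then have "w (- y) \<noteq> 0" by (simp add: adj_def)
    from sep[OF nzw[OF this] y(2)] show ?thesis by (simp add: lat_diff lat_uminus inner_diff_right)
  qed
  have "P x = 0" for x
  proof (rule ccontr)
    assume px: "P x \<noteq> 0"
    then have "Q x \<noteq> 0" using sum[of x] by auto
    then show False using Ppos[OF px] Qneg[of x] by simp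
  qed
  then have "conv w (adj f\<^sub>0) = (\<lambda>x. 0)" unfolding P_def by auto
  moreover have "adj f\<^sub>0 \<noteq> (\<lambda>x. 0)"
  proof
    assume "adj f\<^sub>0 = (\<lambda>x. 0)"
    then have "adj f\<^sub>0 (- x) = 0" for x by simp
    then have "f\<^sub>0 x = 0" for x by (simp add: adj_def)
    then show False using f0 by auto
  qed
  ultimately have "w = (\<lambda>x. 0)" by (intro conv_zero_divisor[OF w fsupp_adj[OF fin(3)]])
  then have "f x - g x = 0" for x unfolding w_def[abs_def] by metis
  then show ?thesis by auto
qed

theorem theorem2p12:
  fixes D\<^sub>0 D :: "(real ^ 'n) set"
    and f\<^sub>0 f g :: "int ^ 'n \<Rightarrow> complex"
    and a\<^sub>f a\<^sub>g a1\<^sub>f a1\<^sub>g :: "real ^ 'n \<Rightarrow> real \<Rightarrow> complex"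
    and N :: "((real ^ 'n) \<times> real) set"
    and \<omega>\<^sub>0 :: "real ^ 'n" and lam\<^sub>0 :: real
  assumes "open D\<^sub>0" and "convex D\<^sub>0" and "bounded D\<^sub>0" and "D\<^sub>0 \<inter> range lat \<noteq> {}"
    and "open D" and "convex D" and "bounded D" and "D \<inter> range lat \<noteq> {}"
    and "setdist D D\<^sub>0 > 0"
    and "lat ` {x. f\<^sub>0 x \<noteq> 0} \<subseteq> D\<^sub>0" and "f\<^sub>0 \<noteq> (\<lambda>x. 0)"
    and "lat ` {x. f x \<noteq> 0} \<subseteq> D" and "lat ` {x. g x \<noteq> 0} \<subseteq> D"
    and "openin (top_of_set (sphere 0 1 \<times> Lambda TYPE('n))) N" and "(\<omega>\<^sub>0, lam\<^sub>0) \<in> N"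
    and "is_far_field_amplitude f a\<^sub>f"
    and "is_far_field_amplitude g a\<^sub>g"
    and "is_far_field_amplitude (\<lambda>x. f x + f\<^sub>0 x) a1\<^sub>f"
    and "is_far_field_amplitude (\<lambda>x. g x + f\<^sub>0 x) a1\<^sub>g"
    and "\<And>\<omega> lam. (\<omega>, lam) \<in> N \<Longrightarrow> (cmod (a\<^sub>f \<omega> lam))\<^sup>2 = (cmod (a\<^sub>g \<omega> lam))\<^sup>2"
    and "\<And>\<omega> lam. (\<omega>, lam) \<in> N \<Longrightarrow> (cmod (a1\<^sub>f \<omega> lam))\<^sup>2 = (cmod (a1\<^sub>g \<omega> lam))\<^sup>2"
  shows "f = g"
proof -
  note D0 = assms(1-4) and D = assms(5-8) and dist = assms(9)
  note supp0 = assms(10) and f0 = assms(11) and supp = assms(12,13) and N = assms(14,15)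
  note ff = assms(16-19) and af = assms(20) and a1f = assms(21)
  define d where "d = (real CARD('n) - 1) / 2"
  have fin: "fsupp f" "fsupp g" "fsupp f\<^sub>0"
    using fsupp_bounded[OF D(3) supp(1)] fsupp_bounded[OF D(3) supp(2)] fsupp_bounded[OF D0(3) supp0] by auto
  have fin1: "fsupp (\<lambda>x. f x + f\<^sub>0 x)" "fsupp (\<lambda>x. g x + f\<^sub>0 x)" using ft_diff_add(3) fin by blast+
  \<comment> \<open>the outgoing field of \<open>u\<close> at energy \<open>l\<close>, together with its limit along all escaping sequences\<close>
  define outgoing where "outgoing (u :: int ^ 'n \<Rightarrow> complex) (l :: real) \<psi> (A :: real ^ 'n \<Rightarrow> complex) \<longleftrightarrow> is_psi_minus u l \<psi> \<and>
     (\<forall>x \<omega>. escapes x \<longrightarrow> (\<lambda>m. direction (x m)) \<longlonglongrightarrow> \<omega> \<longrightarrow>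
      (\<lambda>m. of_real (norm (lat (x m)) powr d) * cis (phase l (x m)) * \<psi> (x m)) \<longlonglongrightarrow> A \<omega>)"
    for u l \<psi> A
  have out: "\<exists>\<psi>. outgoing u l \<psi> (\<lambda>\<omega>. a \<omega> l)" if ffa: "is_far_field_amplitude u a" and l: "l \<in> Lambda TYPE('n)" for u :: "int ^ 'n \<Rightarrow> complex" and a l
  proof -
    obtain \<psi> where c: "continuous_on (sphere 0 1) (\<lambda>\<omega>. a \<omega> l)" and p: "is_psi_minus u l \<psi>"
      and b: "(\<lambda>x. cmod (\<psi> x -
                 exp (- \<i> * complex_of_real (mu (direction x) l * norm (lat x)))
                 / complex_of_real (norm (lat x) powr ((real CARD('n) - 1) / 2))
                 * a (direction x) l))
            \<in> O[filtercomap (\<lambda>x. norm (lat x)) at_top](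
                \<lambda>x. norm (lat x) powr (- (real CARD('n) + 1) / 2))"
      using ffa[unfolded is_far_field_amplitude_def, THEN bspec, OF l]
      by (elim conjE exE)
    show ?thesis unfolding outgoing_def d_def
      by (intro exI[of _ \<psi>] conjI allI impI p) (rule far_field_limit[where a = a and lam = l and \<psi> = \<psi>, OF c b])
  qed
  have out_diff: "outgoing (\<lambda>x. u x - v x) l (\<lambda>x. \<psi> x - \<xi> x) (\<lambda>\<omega>. A \<omega> - B \<omega>)"
    if "outgoing u l \<psi> A" "outgoing v l \<xi> B" "fsupp u" "fsupp v" for u v l \<psi> \<xi> A B
    unfolding outgoing_def right_diff_distrib
  proof (intro conjI allI impI)
    show "is_psi_minus (\<lambda>x. u x - v x) l (\<lambda>x. \<psi> x - \<xi> x)"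
      using that by (intro psi_minus_diff) (simp_all add: outgoing_def)
  qed (intro tendsto_diff; use that in \<open>simp add: outgoing_def\<close>)
  have out_unique: "A \<omega> = B \<omega>" if o: "outgoing u l \<psi> A" "outgoing u l \<xi> B" and w: "norm \<omega> = 1" for u l \<psi> \<xi> A B \<omega>
  proof -
    obtain x :: "nat \<Rightarrow> int ^ 'n" where x: "escapes x" "(\<lambda>m. direction (x m)) \<longlonglongrightarrow> \<omega>"
      using direction_sequence[OF w] by blast
    have eq: "\<psi> = \<xi>" by (rule psi_minus_unique[of u l]) (use o in \<open>simp_all add: outgoing_def\<close>)
    show ?thesis
      by (rule LIMSEQ_unique[of "\<lambda>m. of_real (norm (lat (x m)) powr d) * cis (phase l (x m)) * \<psi> (x m)"])
         (use o x in \<open>simp_all add: outgoing_def eq\<close>)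
  qed
  have cross: "ft h (kappa \<omega> l) * A \<omega> = ft u (kappa \<omega> l) * B \<omega>"
    if o: "outgoing u l \<psi> A" "outgoing h l \<xi> B" and fu: "fsupp u" "fsupp h" and w: "norm \<omega> = 1" and l: "l \<in> Lambda TYPE('n)"
    for u h l \<psi> \<xi> A B \<omega>
  proof -
    obtain x :: "nat \<Rightarrow> int ^ 'n" where x: "escapes x" "(\<lambda>m. direction (x m)) \<longlonglongrightarrow> \<omega>"
      using direction_sequence[OF w] by blast
    have "conv h \<psi> = conv u \<xi>"
      by (rule psi_minus_cross[where lam = l, OF fu(1) _ fu(2)]) (use o in \<open>simp_all add: outgoing_def\<close>)
    moreover have "(\<lambda>m. of_real (norm (lat (x m)) powr d) * cis (phase l (x m)) * conv h \<psi> (x m)) \<longlonglongrightarrow> ft h (kappa \<omega> l) * A \<omega>"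
      by (rule far_field_limit_conv[OF l _ x]) (use o(1) in \<open>auto simp: outgoing_def\<close>)
    moreover have "(\<lambda>m. of_real (norm (lat (x m)) powr d) * cis (phase l (x m)) * conv u \<xi> (x m)) \<longlonglongrightarrow> ft u (kappa \<omega> l) * B \<omega>"
      by (rule far_field_limit_conv[OF l _ x]) (use o(2) in \<open>auto simp: outgoing_def\<close>)
    ultimately show ?thesis using LIMSEQ_unique[of "\<lambda>m. of_real (norm (lat (x m)) powr d) * cis (phase l (x m)) * conv u \<xi> (x m)"] by (simp only:)
  qed
  obtain T where T: "open T" "N = (sphere 0 1 \<times> Lambda TYPE('n)) \<inter> T" using N(1) by (auto simp: openin_open)
  have "(\<omega>\<^sub>0, lam\<^sub>0) \<in> (sphere 0 1 \<times> Lambda TYPE('n)) \<inter> T" using N(2) unfolding T(2) .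
  then have base: "norm \<omega>\<^sub>0 = 1" "lam\<^sub>0 \<in> Lambda TYPE('n)" "(\<omega>\<^sub>0, lam\<^sub>0) \<in> T" by simp_all
  obtain U V where UV: "open U" "open V" "(\<omega>\<^sub>0, lam\<^sub>0) \<in> U \<times> V" "U \<times> V \<subseteq> T"
    by (rule open_prod_elim[OF T(1) base(3)])
  have UV': "\<omega>\<^sub>0 \<in> U" "lam\<^sub>0 \<in> V \<inter> Lambda TYPE('n)" using UV(3) base(2) by simp_all
  obtain \<rho> where \<rho>: "\<rho> > 0" "\<forall>\<omega>. dist \<omega> \<omega>\<^sub>0 < \<rho> \<longrightarrow> \<omega> \<in> U"
    using UV(1)[unfolded open_dist, THEN bspec, OF UV'(1)] by (elim exE conjE)
  have "open (V \<inter> Lambda TYPE('n))" by (intro open_Int UV(2) open_Lambda)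
  from this[unfolded open_dist, THEN bspec, OF UV'(2)]
  obtain e where e: "e > 0" "\<forall>l. dist l lam\<^sub>0 < e \<longrightarrow> l \<in> V \<inter> Lambda TYPE('n)"
    by (elim exE conjE)
  define \<alpha> where "\<alpha> = lam\<^sub>0 - e / 2"
  define \<beta> where "\<beta> = lam\<^sub>0 + e / 2"
  have I: "\<alpha> < \<beta>" "{\<alpha>..\<beta>} \<subseteq> V \<inter> Lambda TYPE('n)" 
  proof -
    show "\<alpha> < \<beta>" using e(1) by (simp add: \<alpha>_def \<beta>_def)
    show "{\<alpha>..\<beta>} \<subseteq> V \<inter> Lambda TYPE('n)"
    proof
      fix l assume "l \<in> {\<alpha>..\<beta>}"
      then have "lam\<^sub>0 - e / 2 \<le> l" "l \<le> lam\<^sub>0 + e / 2" by (simp_all add: \<alpha>_def \<beta>_def)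
      then have "\<bar>l - lam\<^sub>0\<bar> \<le> e / 2" by linarith
      then show "l \<in> V \<inter> Lambda TYPE('n)" using e(1) by (intro e(2)[rule_format]) (simp add: dist_real_def)
    qed
  qed
  have inN: "(\<omega>, l) \<in> N" if "l \<in> {\<alpha>..\<beta>}" "norm \<omega> = 1" "dist \<omega> \<omega>\<^sub>0 < \<rho>" for \<omega> l
  proof -
    have "\<omega> \<in> U" using \<rho>(2) that(3) by blast
    moreover have "l \<in> V \<inter> Lambda TYPE('n)" using that(1) I(2) by blast
    ultimately show ?thesis using that(2) UV(4) unfolding T(2) by auto
  qed
  define A where "A \<omega> l = a1\<^sub>f \<omega> l - a\<^sub>f \<omega> l" for \<omega> l
  \<comment> \<open>existence of the field of \<open>f\<^sub>0\<close> is not assumed; it is the difference of two fields that exist\<close>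
  have sub: "(\<lambda>x. (f x + f\<^sub>0 x) - f x) = f\<^sub>0" "(\<lambda>x. (g x + f\<^sub>0 x) - g x) = f\<^sub>0" by auto
  have "\<exists>\<psi>. outgoing f\<^sub>0 l \<psi> (\<lambda>\<omega>. A \<omega> l) \<and>
      (\<forall>\<omega>. norm \<omega> = 1 \<longrightarrow> ft f\<^sub>0 (kappa \<omega> l) * a\<^sub>f \<omega> l = ft f (kappa \<omega> l) * A \<omega> l \<and>
        ft f\<^sub>0 (kappa \<omega> l) * a\<^sub>g \<omega> l = ft g (kappa \<omega> l) * A \<omega> l \<and> a1\<^sub>g \<omega> l = a\<^sub>g \<omega> l + A \<omega> l)"
    if l: "l \<in> Lambda TYPE('n)" for l
  proof -
    obtain \<psi>f \<psi>g \<psi>1f \<psi>1g where o: "outgoing f l \<psi>f (\<lambda>\<omega>. a\<^sub>f \<omega> l)" "outgoing g l \<psi>g (\<lambda>\<omega>. a\<^sub>g \<omega> l)"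
      "outgoing (\<lambda>x. f x + f\<^sub>0 x) l \<psi>1f (\<lambda>\<omega>. a1\<^sub>f \<omega> l)" "outgoing (\<lambda>x. g x + f\<^sub>0 x) l \<psi>1g (\<lambda>\<omega>. a1\<^sub>g \<omega> l)"
      using out[OF ff(1) l] out[OF ff(2) l] out[OF ff(3) l] out[OF ff(4) l] by blast
    have o0: "outgoing f\<^sub>0 l (\<lambda>x. \<psi>1f x - \<psi>f x) (\<lambda>\<omega>. A \<omega> l)"
      using out_diff[OF o(3,1) fin1(1) fin(1)] unfolding sub A_def .
    have o0': "outgoing f\<^sub>0 l (\<lambda>x. \<psi>1g x - \<psi>g x) (\<lambda>\<omega>. a1\<^sub>g \<omega> l - a\<^sub>g \<omega> l)"
      using out_diff[OF o(4,2) fin1(2) fin(2)] unfolding sub .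
    show ?thesis
    proof (intro exI conjI allI impI)
      show "outgoing f\<^sub>0 l (\<lambda>x. \<psi>1f x - \<psi>f x) (\<lambda>\<omega>. A \<omega> l)" by (rule o0)
      fix \<omega> :: "real ^ 'n" assume w: "norm \<omega> = 1"
      show "ft f\<^sub>0 (kappa \<omega> l) * a\<^sub>f \<omega> l = ft f (kappa \<omega> l) * A \<omega> l" by (rule cross[OF o(1) o0 fin(1,3) w l])
      show "ft f\<^sub>0 (kappa \<omega> l) * a\<^sub>g \<omega> l = ft g (kappa \<omega> l) * A \<omega> l" by (rule cross[OF o(2) o0 fin(2,3) w l])
      show "a1\<^sub>g \<omega> l = a\<^sub>g \<omega> l + A \<omega> l" using out_unique[OF o0 o0' w] by simp
    qed
  qed
  then have "\<forall>l\<in>Lambda TYPE('n). \<exists>\<psi>. outgoing f\<^sub>0 l \<psi> (\<lambda>\<omega>. A \<omega> l) \<and>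
      (\<forall>\<omega>. norm \<omega> = 1 \<longrightarrow> ft f\<^sub>0 (kappa \<omega> l) * a\<^sub>f \<omega> l = ft f (kappa \<omega> l) * A \<omega> l \<and>
        ft f\<^sub>0 (kappa \<omega> l) * a\<^sub>g \<omega> l = ft g (kappa \<omega> l) * A \<omega> l \<and> a1\<^sub>g \<omega> l = a\<^sub>g \<omega> l + A \<omega> l)"
    by (rule ballI)
  from bchoice[OF this] obtain \<Psi> where \<Psi>': "\<forall>l\<in>Lambda TYPE('n). outgoing f\<^sub>0 l (\<Psi> l) (\<lambda>\<omega>. A \<omega> l) \<and>
      (\<forall>\<omega>. norm \<omega> = 1 \<longrightarrow> ft f\<^sub>0 (kappa \<omega> l) * a\<^sub>f \<omega> l = ft f (kappa \<omega> l) * A \<omega> l \<and>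
        ft f\<^sub>0 (kappa \<omega> l) * a\<^sub>g \<omega> l = ft g (kappa \<omega> l) * A \<omega> l \<and> a1\<^sub>g \<omega> l = a\<^sub>g \<omega> l + A \<omega> l)" ..
  have \<Psi>: "\<And>l. l \<in> Lambda TYPE('n) \<Longrightarrow> outgoing f\<^sub>0 l (\<Psi> l) (\<lambda>\<omega>. A \<omega> l)"
    and rel: "\<And>l \<omega>. l \<in> Lambda TYPE('n) \<Longrightarrow> norm \<omega> = 1 \<Longrightarrow> ft f\<^sub>0 (kappa \<omega> l) * a\<^sub>f \<omega> l = ft f (kappa \<omega> l) * A \<omega> l"
      "\<And>l \<omega>. l \<in> Lambda TYPE('n) \<Longrightarrow> norm \<omega> = 1 \<Longrightarrow> ft f\<^sub>0 (kappa \<omega> l) * a\<^sub>g \<omega> l = ft g (kappa \<omega> l) * A \<omega> l"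
      "\<And>l \<omega>. l \<in> Lambda TYPE('n) \<Longrightarrow> norm \<omega> = 1 \<Longrightarrow> a1\<^sub>g \<omega> l = a\<^sub>g \<omega> l + A \<omega> l"
    using \<Psi>' by simp_all
  have IL: "{\<alpha>..\<beta>} \<subseteq> Lambda TYPE('n)" using I(2) by blast
  have psi0: "is_psi_minus f\<^sub>0 l (\<Psi> l)" if "l \<in> {\<alpha>..\<beta>}" for l using \<Psi>[of l] IL that by (auto simp: outgoing_def)
  have lim0: "(\<lambda>m. of_real (norm (lat (x m)) powr ((real CARD('n) - 1) / 2)) *
         cis (phase l (x m)) * \<Psi> l (x m)) \<longlonglongrightarrow> A \<omega> l"
    if "l \<in> {\<alpha>..\<beta>}" "escapes x" "(\<lambda>m. direction (x m)) \<longlonglongrightarrow> \<omega>" for l \<omega> x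
    using \<Psi>[of l] IL that by (auto simp: outgoing_def d_def)
  have m1: "(cmod (ft f k))\<^sup>2 = (cmod (ft g k))\<^sup>2" for k
  proof (rule modulus_identity_forces_equal_powers[OF fin f0 base(1) \<rho>(1) I(1) IL psi0 lim0])
    fix l and \<omega> :: "real ^ 'n" assume h: "l \<in> {\<alpha>..\<beta>}" "norm \<omega> = 1" "dist \<omega> \<omega>\<^sub>0 < \<rho>"
    have "cmod (a\<^sub>f \<omega> l) = cmod (a\<^sub>g \<omega> l)" using af[OF inN[OF h]] by simp
    then show "cmod (ft f (kappa \<omega> l) * A \<omega> l) = cmod (ft g (kappa \<omega> l) * A \<omega> l)"
      using rel(1)[of l \<omega>] rel(2)[of l \<omega>] h IL by (metis norm_mult subsetD)
  qed
  have m2: "(cmod (ft f k + ft f\<^sub>0 k))\<^sup>2 = (cmod (ft g k + ft f\<^sub>0 k))\<^sup>2" for k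
    unfolding ft_diff_add(4)[OF fin(1,3), symmetric] ft_diff_add(4)[OF fin(2,3), symmetric]
  proof (rule modulus_identity_forces_equal_powers[OF fin1 fin(3) f0 base(1) \<rho>(1) I(1) IL psi0 lim0])
    fix l and \<omega> :: "real ^ 'n" assume h: "l \<in> {\<alpha>..\<beta>}" "norm \<omega> = 1" "dist \<omega> \<omega>\<^sub>0 < \<rho>"
    have l: "l \<in> Lambda TYPE('n)" using h IL by blast
    have 0: "cmod (a1\<^sub>f \<omega> l) = cmod (a1\<^sub>g \<omega> l)" using a1f[OF inN[OF h]] by simp
    have 1: "ft (\<lambda>x. f x + f\<^sub>0 x) (kappa \<omega> l) * A \<omega> l = ft f\<^sub>0 (kappa \<omega> l) * a1\<^sub>f \<omega> l"
      unfolding ft_diff_add(4)[OF fin(1,3)] distrib_right rel(1)[OF l h(2), symmetric] by (simp add: A_def algebra_simps)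
    have 2: "ft (\<lambda>x. g x + f\<^sub>0 x) (kappa \<omega> l) * A \<omega> l = ft f\<^sub>0 (kappa \<omega> l) * a1\<^sub>g \<omega> l"
      unfolding ft_diff_add(4)[OF fin(2,3)] distrib_right rel(2)[OF l h(2), symmetric] rel(3)[OF l h(2)] by (simp add: algebra_simps)
    show "cmod (ft (\<lambda>x. f x + f\<^sub>0 x) (kappa \<omega> l) * A \<omega> l) = cmod (ft (\<lambda>x. g x + f\<^sub>0 x) (kappa \<omega> l) * A \<omega> l)"
      unfolding 1 2 norm_mult 0 ..
  qed
  have "setdist (closure D\<^sub>0) (closure D) > 0" using dist by (simp add: setdist_sym)
  then have disj: "closure D\<^sub>0 \<inter> closure D = {}"
    using setdist_eq_0I[of _ "closure D\<^sub>0" "closure D"] by fastforce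
  have "\<exists>v b. (\<forall>x\<in>closure D\<^sub>0. v \<bullet> x < b) \<and> (\<forall>x\<in>closure D. v \<bullet> x > b)"
    by (rule separating_hyperplane_compact_closed)
       (use D0 D disj in \<open>auto simp: convex_closure compact_closure\<close>)
  then obtain v b where v: "\<And>x. x \<in> closure D\<^sub>0 \<Longrightarrow> v \<bullet> x < b" "\<And>x. x \<in> closure D \<Longrightarrow> b < v \<bullet> x" by blast
  show ?thesis
  proof (rule separated_phase_retrieval[OF fin f0 _ m1 m2])
    fix y z assume y: "f y \<noteq> 0 \<or> g y \<noteq> 0" and z: "f\<^sub>0 z \<noteq> 0"
    have "lat y \<in> closure D" "lat z \<in> closure D\<^sub>0" using y z supp supp0 closure_subset by blast+
    then show "v \<bullet> lat z < v \<bullet> lat y" using v by (meson less_trans)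
  qed
qed

end
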